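(* Let $L$ be a classical, list-compatible proposition/term language. Then for each natural number $n$ there is a term $\phi(n)$ of $L$, of length $O(n)$, whose referent is the largest number that can be represented in $L$ by a term of length at most $n$. The term $\phi(n)$ can be written explicitly (as a function of $n$).
   Context: A proposition/term (PT) language is a formal syntax together with an intended interpretation. Terms are built from variables, constants, primitive functions, and quantifier-like operators (QLOs): a QLO $\Psi(x_1,\dots,x_k\mid t_1,\dots,t_n,\phi_1,\dots,\phi_m)$ binds the variables $x_i$ and is given meaning by a reductive interpretation $\Psi(\ldots)=s \Leftrightarrow \Theta(\ldots,s,\ldots)$ for a fixed QLO-free schematic formula $\Theta$ (example: $\mathrm{elt}\{x:\phi(x)\}$, "the unique $x$ with $\phi(x)$"). Formulas are built from atomic formulas $R(t_1,\dots,t_n)$ (the relations $=$ and the unary existence relation $t\downarrow$, "$t$ has a referent", are always present), the connectives "and", "or", and some subset of the quantifier templates $\forall x<t$, $\exists x<t$, $\forall x$, $\exists x$. Negation is not primitive: some primitive relations are declared negatable (then $\neg R(\ldots)$ is atomic), and negation of compound formulas is defined by de Morgan duality when the dual formula is available. Terms may fail to have referents; a formula containing a non-referring term is indeterminate. Semantics is Kleene's weak three-valued logic (a formula is true, false, or indeterminate; unnegatable formulas are never false). A primitive relation is strongly negatable if every tuple either satisfies or fails to satisfy it. A PT language is classical if it allows unbounded universal and existential quantification and every primitive relation other than $\downarrow$ is strongly negatable. It is list-compatible if it has a single domain of discourse, can reproduce (interpret) gradualist number theory (the natural numbers with $0,1,+,\times$, exponentiation, $=,<$, bounded quantifiers,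 unbounded existential quantifiers, and the operator $\mathrm{fst}\{n:\phi(n)\}$ = least $n$ with $\phi(n)$), and has an encoding of finite lists $[a_1,\dots,a_n]$ with formulas/terms expressing "$x$ is a list", "the $n$th element of $x$", and "the length of $x$". The length of a term is its number of symbols.
   Formalization: The language is assumed to have finitely many primitive functions (taken to be total), relations and quantifier-like operators, and the claim about the largest number is made for those n for which some number is representable by a term of length at most n; otherwise no largest number need exist. *)

theory Defs
  imports Complex_Main "HOL-Library.Landau_Symbols" "HOL-Library.Nat_Bijection"
begin

section \<open>Syntax\<close>

datatype 'r rsym = REq | RDown | RPrim 'r

text \<open>
  Constants are 0-ary functions.  The constructors \<open>TPar\<close> and \<open>FPar\<close> are holes for term and
  formula parameters applied to arguments; they occur only in \<^emph>\<open>schematic\<close> terms and formulas,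
  such as the right-hand side \<open>\<Theta>\<close> of a reductive interpretation.  The Boolean in \<open>Atom\<close> and
  \<open>FPar\<close> is \<open>False\<close> for the negated version.  \<open>Qlo q xs ts \<phi>s\<close> binds all of \<open>xs\<close> in all of \<open>ts\<close>
  and \<open>\<phi>s\<close>; in \<open>BAll x t \<phi>\<close> and \<open>BEx x t \<phi>\<close> the bound \<open>t\<close> is outside the scope of \<open>x\<close>.
\<close>

datatype ('f, 'r, 'q) trm =
    Var nat
  | Fun 'f "('f, 'r, 'q) trm list"
  | Qlo 'q "nat list" "('f, 'r, 'q) trm list" "('f, 'r, 'q) fm list"
  | TPar nat "('f, 'r, 'q) trm list"
and ('f, 'r, 'q) fm =
    Atom bool "'r rsym" "('f, 'r, 'q) trm list"
  | FPar bool nat "('f, 'r, 'q) trm list"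
  | And "('f, 'r, 'q) fm" "('f, 'r, 'q) fm"
  | Or "('f, 'r, 'q) fm" "('f, 'r, 'q) fm"
  | BAll nat "('f, 'r, 'q) trm" "('f, 'r, 'q) fm"
  | BEx nat "('f, 'r, 'q) trm" "('f, 'r, 'q) fm"
  | All nat "('f, 'r, 'q) fm"
  | Ex nat "('f, 'r, 'q) fm"

fun fv_trm :: "('f, 'r, 'q) trm \<Rightarrow> nat set" and fv_fm :: "('f, 'r, 'q) fm \<Rightarrow> nat set" where
  "fv_trm (Var x) = {x}"
| "fv_trm (Fun f ts) = (\<Union>t\<in>set ts. fv_trm t)"
| "fv_trm (Qlo q xs ts \<phi>s) = ((\<Union>t\<in>set ts. fv_trm t) \<union> (\<Union>\<phi>\<in>set \<phi>s. fv_fm \<phi>)) - set xs"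
| "fv_trm (TPar i ts) = (\<Union>t\<in>set ts. fv_trm t)"
| "fv_fm (Atom b R ts) = (\<Union>t\<in>set ts. fv_trm t)"
| "fv_fm (FPar b j ts) = (\<Union>t\<in>set ts. fv_trm t)"
| "fv_fm (And \<phi> \<psi>) = fv_fm \<phi> \<union> fv_fm \<psi>"
| "fv_fm (Or \<phi> \<psi>) = fv_fm \<phi> \<union> fv_fm \<psi>"
| "fv_fm (BAll x t \<phi>) = fv_trm t \<union> (fv_fm \<phi> - {x})"
| "fv_fm (BEx x t \<phi>) = fv_trm t \<union> (fv_fm \<phi> - {x})"
| "fv_fm (All x \<phi>) = fv_fm \<phi> - {x}"
| "fv_fm (Ex x \<phi>) = fv_fm \<phi> - {x}"

text \<open>
  Written form in Polish notation, so that no punctuation is needed.  \<open>SBound\<close> is the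
  \<open><\<close> of a bounded quantifier.
\<close>

datatype ('f, 'r, 'q) sym =
    SVar nat | SFun 'f | SQlo 'q | SRel "'r rsym" | STPar nat | SFPar nat
  | SNot | SAnd | SOr | SAll | SEx | SBound

fun symbols :: "('f, 'r, 'q) trm \<Rightarrow> ('f, 'r, 'q) sym list"
  and symbols_fm :: "('f, 'r, 'q) fm \<Rightarrow> ('f, 'r, 'q) sym list" where
  "symbols (Var x) = [SVar x]"
| "symbols (Fun f ts) = SFun f # concat (map symbols ts)"
| "symbols (Qlo q xs ts \<phi>s) =
     SQlo q # map SVar xs @ concat (map symbols ts) @ concat (map symbols_fm \<phi>s)"
| "symbols (TPar i ts) = STPar i # concat (map symbols ts)"
| "symbols_fm (Atom b R ts) = (if b then [] else [SNot]) @ SRel R # concat (map symbols ts)"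
| "symbols_fm (FPar b j ts) = (if b then [] else [SNot]) @ SFPar j # concat (map symbols ts)"
| "symbols_fm (And \<phi> \<psi>) = SAnd # symbols_fm \<phi> @ symbols_fm \<psi>"
| "symbols_fm (Or \<phi> \<psi>) = SOr # symbols_fm \<phi> @ symbols_fm \<psi>"
| "symbols_fm (BAll x t \<phi>) = SAll # SVar x # SBound # symbols t @ symbols_fm \<phi>"
| "symbols_fm (BEx x t \<phi>) = SEx # SVar x # SBound # symbols t @ symbols_fm \<phi>"
| "symbols_fm (All x \<phi>) = SAll # SVar x # symbols_fm \<phi>"
| "symbols_fm (Ex x \<phi>) = SEx # SVar x # symbols_fm \<phi>"

definition trm_length :: "('f, 'r, 'q) trm \<Rightarrow> nat" where
  "trm_length t = length (symbols t)"


section \<open>Proposition/term languages\<close>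

text \<open>
  The type \<open>'a\<close> is the (single) domain of discourse.  Primitive functions are total on it.
  \<open>rel_sat\<close> and \<open>rel_fails\<close> give the tuples satisfying, respectively failing to satisfy, a
  primitive relation; the latter is relevant for negatable relations only.  \<open>less_rel\<close> is the
  relation \<open><\<close> of the bounded quantifier templates.

  The QLO \<open>q\<close> binds \<open>qlo_vars q\<close> variables, and takes \<open>qlo_terms q\<close> terms and \<open>qlo_forms q\<close>
  formulas.  In its reductive interpretation \<open>reduct q\<close> (the formula \<open>\<Theta>\<close>), \<open>Var 0\<close> is the
  candidate referent \<open>s\<close>, and \<open>TPar i\<close>, \<open>FPar j\<close> stand for the \<open>i\<close>-th term and the \<open>j\<close>-th
  formula as functions of the bound variables.  Only the formula arguments with index in
  \<open>qlo_neg q\<close> may occur negated in \<open>\<Theta>\<close>, and these have to be negatable.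
\<close>

record ('a, 'f, 'r, 'q) pt_lang =
  funs :: "'f set"
  fun_arity :: "'f \<Rightarrow> nat"
  fun_val :: "'f \<Rightarrow> 'a list \<Rightarrow> 'a"
  rels :: "'r set"
  rel_arity :: "'r \<Rightarrow> nat"
  rel_sat :: "'r \<Rightarrow> 'a list \<Rightarrow> bool"
  rel_fails :: "'r \<Rightarrow> 'a list \<Rightarrow> bool"
  neg_rels :: "'r rsym set"
  less_rel :: "'r option"
  has_ball :: bool
  has_bex :: bool
  has_all :: bool
  has_ex :: bool
  qlos :: "'q set"
  qlo_vars :: "'q \<Rightarrow> nat"
  qlo_terms :: "'q \<Rightarrow> nat"
  qlo_forms :: "'q \<Rightarrow> nat"
  qlo_neg :: "'q \<Rightarrow> nat set"
  reduct :: "'q \<Rightarrow> ('f, 'r, 'q) fm"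

fun is_rsym :: "('a, 'f, 'r, 'q) pt_lang \<Rightarrow> 'r rsym \<Rightarrow> bool" where
  "is_rsym L (RPrim r) \<longleftrightarrow> r \<in> rels L"
| "is_rsym L _ \<longleftrightarrow> True"

fun arity :: "('a, 'f, 'r, 'q) pt_lang \<Rightarrow> 'r rsym \<Rightarrow> nat" where
  "arity L REq = 2"
| "arity L RDown = 1"
| "arity L (RPrim r) = rel_arity L r"

fun sat :: "('a, 'f, 'r, 'q) pt_lang \<Rightarrow> 'r rsym \<Rightarrow> 'a list \<Rightarrow> bool" where
  "sat L REq as \<longleftrightarrow> as ! 0 = as ! 1"
| "sat L RDown as \<longleftrightarrow> True"
| "sat L (RPrim r) as \<longleftrightarrow> rel_sat L r as"

fun fails :: "('a, 'f, 'r, 'q) pt_lang \<Rightarrow> 'r rsym \<Rightarrow> 'a list \<Rightarrow> bool" where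
  "fails L REq as \<longleftrightarrow> as ! 0 \<noteq> as ! 1"
| "fails L RDown as \<longleftrightarrow> False"
| "fails L (RPrim r) as \<longleftrightarrow> rel_fails L r as"

text \<open>
  A formula is negatable if its de Morgan dual is a formula of the language.  The set \<open>N\<close>
  contains the formula holes that stand for negatable formulas.
\<close>

fun negatable :: "('a, 'f, 'r, 'q) pt_lang \<Rightarrow> nat set \<Rightarrow> ('f, 'r, 'q) fm \<Rightarrow> bool" where
  "negatable L N (Atom b R ts) \<longleftrightarrow> (b \<longrightarrow> R \<in> neg_rels L)"
| "negatable L N (FPar b j ts) \<longleftrightarrow> (b \<longrightarrow> j \<in> N)"
| "negatable L N (And \<phi> \<psi>) \<longleftrightarrow> negatable L N \<phi> \<and> negatable L N \<psi>"
| "negatable L N (Or \<phi> \<psi>) \<longleftrightarrow> negatable L N \<phi> \<and> negatable L N \<psi>"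
| "negatable L N (BAll x t \<phi>) \<longleftrightarrow> has_bex L \<and> negatable L N \<phi>"
| "negatable L N (BEx x t \<phi>) \<longleftrightarrow> has_ball L \<and> negatable L N \<phi>"
| "negatable L N (All x \<phi>) \<longleftrightarrow> has_ex L \<and> negatable L N \<phi>"
| "negatable L N (Ex x \<phi>) \<longleftrightarrow> has_all L \<and> negatable L N \<phi>"

text \<open>
  Well-formedness of schematic terms and formulas; \<open>ta\<close> and \<open>fa\<close> list the arities of the
  available term and formula holes.
\<close>

fun wf_trm :: "('a, 'f, 'r, 'q) pt_lang \<Rightarrow> nat list \<Rightarrow> nat list \<Rightarrow> nat set \<Rightarrow> ('f, 'r, 'q) trm \<Rightarrow> bool"
  and wf_fm :: "('a, 'f, 'r, 'q) pt_lang \<Rightarrow> nat list \<Rightarrow> nat list \<Rightarrow> nat set \<Rightarrow> ('f, 'r, 'q) fm \<Rightarrow> bool"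
  where
  "wf_trm L ta fa N (Var x) \<longleftrightarrow> True"
| "wf_trm L ta fa N (Fun f ts) \<longleftrightarrow>
     f \<in> funs L \<and> length ts = fun_arity L f \<and> (\<forall>t\<in>set ts. wf_trm L ta fa N t)"
| "wf_trm L ta fa N (Qlo q xs ts \<phi>s) \<longleftrightarrow>
     q \<in> qlos L \<and> distinct xs \<and> length xs = qlo_vars L q \<and>
     length ts = qlo_terms L q \<and> length \<phi>s = qlo_forms L q \<and>
     (\<forall>t\<in>set ts. wf_trm L ta fa N t) \<and> (\<forall>\<phi>\<in>set \<phi>s. wf_fm L ta fa N \<phi>) \<and>
     (\<forall>j<length \<phi>s. j \<in> qlo_neg L q \<longrightarrow> negatable L N (\<phi>s ! j))"
| "wf_trm L ta fa N (TPar i ts) \<longleftrightarrow>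
     i < length ta \<and> length ts = ta ! i \<and> (\<forall>t\<in>set ts. wf_trm L ta fa N t)"
| "wf_fm L ta fa N (Atom b R ts) \<longleftrightarrow>
     is_rsym L R \<and> length ts = arity L R \<and> (\<forall>t\<in>set ts. wf_trm L ta fa N t) \<and>
     (\<not> b \<longrightarrow> R \<in> neg_rels L)"
| "wf_fm L ta fa N (FPar b j ts) \<longleftrightarrow>
     j < length fa \<and> length ts = fa ! j \<and> (\<forall>t\<in>set ts. wf_trm L ta fa N t) \<and> (\<not> b \<longrightarrow> j \<in> N)"
| "wf_fm L ta fa N (And \<phi> \<psi>) \<longleftrightarrow> wf_fm L ta fa N \<phi> \<and> wf_fm L ta fa N \<psi>"
| "wf_fm L ta fa N (Or \<phi> \<psi>) \<longleftrightarrow> wf_fm L ta fa N \<phi> \<and> wf_fm L ta fa N \<psi>"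
| "wf_fm L ta fa N (BAll x t \<phi>) \<longleftrightarrow> has_ball L \<and> wf_trm L ta fa N t \<and> wf_fm L ta fa N \<phi>"
| "wf_fm L ta fa N (BEx x t \<phi>) \<longleftrightarrow> has_bex L \<and> wf_trm L ta fa N t \<and> wf_fm L ta fa N \<phi>"
| "wf_fm L ta fa N (All x \<phi>) \<longleftrightarrow> has_all L \<and> wf_fm L ta fa N \<phi>"
| "wf_fm L ta fa N (Ex x \<phi>) \<longleftrightarrow> has_ex L \<and> wf_fm L ta fa N \<phi>"


section \<open>Semantics\<close>

text \<open>
  Truth values are \<open>Some True\<close>, \<open>Some False\<close> and \<open>None\<close> (indeterminate).  In weak Kleene logic
  an indeterminate component (for quantifiers: an indeterminate instance in the range of the
  quantifier) makes the compound indeterminate.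
\<close>

definition kleene2 :: "(bool \<Rightarrow> bool \<Rightarrow> bool) \<Rightarrow> bool option \<Rightarrow> bool option \<Rightarrow> bool option" where
  "kleene2 c u v = (case (u, v) of (Some p, Some q) \<Rightarrow> Some (c p q) | _ \<Rightarrow> None)"

definition kleene_all :: "bool option set \<Rightarrow> bool option" where
  "kleene_all V = (if None \<in> V then None else Some (Some False \<notin> V))"

definition kleene_ex :: "bool option set \<Rightarrow> bool option" where
  "kleene_ex V = (if None \<in> V then None else Some (Some True \<in> V))"

text \<open>Formulas that are not negatable are never false.\<close>

definition never_false_unless :: "bool \<Rightarrow> bool option \<Rightarrow> bool option" where
  "never_false_unless b v = (if v = Some False \<and> \<not> b then None else v)"

definition assign :: "(nat \<Rightarrow> 'a) \<Rightarrow> nat list \<Rightarrow> 'a list \<Rightarrow> nat \<Rightarrow> 'a" where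
  "assign \<sigma> xs as = (\<lambda>y. case map_of (zip xs as) y of Some a \<Rightarrow> a | None \<Rightarrow> \<sigma> y)"

definition below :: "('a, 'f, 'r, 'q) pt_lang \<Rightarrow> 'a \<Rightarrow> 'a set" where
  "below L v = {d. \<exists>r. less_rel L = Some r \<and> rel_sat L r [d, v]}"

text \<open>
  Values of schematic terms and formulas, relative to an interpretation \<open>Q\<close> of the QLOs,
  meanings \<open>tp\<close> and \<open>fp\<close> of the holes, and the set \<open>N\<close> of negatable formula holes.
\<close>

type_synonym ('a, 'q) qlo_interp =
  "'q \<Rightarrow> nat set \<Rightarrow> (nat \<Rightarrow> 'a list \<Rightarrow> 'a option) \<Rightarrow> (nat \<Rightarrow> 'a list \<Rightarrow> bool option) \<Rightarrow> 'a option"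

fun tval :: "('a, 'f, 'r, 'q) pt_lang \<Rightarrow> ('a, 'q) qlo_interp \<Rightarrow> nat set \<Rightarrow>
      (nat \<Rightarrow> 'a list \<Rightarrow> 'a option) \<Rightarrow> (nat \<Rightarrow> 'a list \<Rightarrow> bool option) \<Rightarrow>
      (nat \<Rightarrow> 'a) \<Rightarrow> ('f, 'r, 'q) trm \<Rightarrow> 'a option"
  and fval :: "('a, 'f, 'r, 'q) pt_lang \<Rightarrow> ('a, 'q) qlo_interp \<Rightarrow> nat set \<Rightarrow>
      (nat \<Rightarrow> 'a list \<Rightarrow> 'a option) \<Rightarrow> (nat \<Rightarrow> 'a list \<Rightarrow> bool option) \<Rightarrow>
      (nat \<Rightarrow> 'a) \<Rightarrow> ('f, 'r, 'q) fm \<Rightarrow> bool option"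
  where
  "tval L Q N tp fp \<sigma> (Var x) = Some (\<sigma> x)"
| "tval L Q N tp fp \<sigma> (Fun f ts) =
     map_option (fun_val L f) (those (map (tval L Q N tp fp \<sigma>) ts))"
| "tval L Q N tp fp \<sigma> (Qlo q xs ts \<phi>s) =
     Q q {j. j < length \<phi>s \<and> negatable L N (\<phi>s ! j)}
       (\<lambda>i as. map (tval L Q N tp fp (assign \<sigma> xs as)) ts ! i)
       (\<lambda>j as. map (fval L Q N tp fp (assign \<sigma> xs as)) \<phi>s ! j)"
| "tval L Q N tp fp \<sigma> (TPar i ts) =
     Option.bind (those (map (tval L Q N tp fp \<sigma>) ts)) (tp i)"
| "fval L Q N tp fp \<sigma> (Atom b R ts) =
     Option.bind (those (map (tval L Q N tp fp \<sigma>) ts))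
       (\<lambda>as. if sat L R as then Some b
             else if R \<in> neg_rels L \<and> fails L R as then Some (\<not> b) else None)"
| "fval L Q N tp fp \<sigma> (FPar b j ts) =
     Option.bind (those (map (tval L Q N tp fp \<sigma>) ts))
       (\<lambda>as. if b then fp j as else map_option Not (fp j as))"
| "fval L Q N tp fp \<sigma> (And \<phi> \<psi>) =
     never_false_unless (negatable L N (And \<phi> \<psi>))
       (kleene2 (\<and>) (fval L Q N tp fp \<sigma> \<phi>) (fval L Q N tp fp \<sigma> \<psi>))"
| "fval L Q N tp fp \<sigma> (Or \<phi> \<psi>) =
     never_false_unless (negatable L N (Or \<phi> \<psi>))
       (kleene2 (\<or>) (fval L Q N tp fp \<sigma> \<phi>) (fval L Q N tp fp \<sigma> \<psi>))"
| "fval L Q N tp fp \<sigma> (BAll x t \<phi>) =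
     never_false_unless (negatable L N (BAll x t \<phi>))
       (Option.bind (tval L Q N tp fp \<sigma> t)
         (\<lambda>v. kleene_all ((\<lambda>d. fval L Q N tp fp (\<sigma>(x := d)) \<phi>) ` below L v)))"
| "fval L Q N tp fp \<sigma> (BEx x t \<phi>) =
     never_false_unless (negatable L N (BEx x t \<phi>))
       (Option.bind (tval L Q N tp fp \<sigma> t)
         (\<lambda>v. kleene_ex ((\<lambda>d. fval L Q N tp fp (\<sigma>(x := d)) \<phi>) ` below L v)))"
| "fval L Q N tp fp \<sigma> (All x \<phi>) =
     never_false_unless (negatable L N (All x \<phi>))
       (kleene_all (range (\<lambda>d. fval L Q N tp fp (\<sigma>(x := d)) \<phi>)))"
| "fval L Q N tp fp \<sigma> (Ex x \<phi>) =
     never_false_unless (negatable L N (Ex x \<phi>))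
       (kleene_ex (range (\<lambda>d. fval L Q N tp fp (\<sigma>(x := d)) \<phi>)))"

text \<open>
  \<open>\<Theta>\<close> is QLO-free, so the QLO interpretation under which it is evaluated is irrelevant.
\<close>

definition reduct_true :: "('a, 'f, 'r, 'q) pt_lang \<Rightarrow> 'q \<Rightarrow> nat set \<Rightarrow>
    (nat \<Rightarrow> 'a list \<Rightarrow> 'a option) \<Rightarrow> (nat \<Rightarrow> 'a list \<Rightarrow> bool option) \<Rightarrow> 'a \<Rightarrow> bool" where
  "reduct_true L q N tp fp s \<longleftrightarrow>
     fval L (\<lambda>_ _ _ _. None) N tp fp (\<lambda>_. s) (reduct L q) = Some True"

definition qlo_val :: "('a, 'f, 'r, 'q) pt_lang \<Rightarrow> ('a, 'q) qlo_interp" where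
  "qlo_val L q N tp fp =
     (if \<exists>!s. reduct_true L q N tp fp s then Some (THE s. reduct_true L q N tp fp s) else None)"

text \<open>
  Well-posedness of a language.  The last condition says that \<open>\<Theta>\<close> determines at most one
  referent, so that \<open>\<Psi>(\<dots>) = s \<longleftrightarrow> \<Theta>(\<dots>, s, \<dots>)\<close> can indeed be taken as an interpretation.
\<close>

definition pt_language :: "('a, 'f, 'r, 'q) pt_lang \<Rightarrow> bool" where
  "pt_language L \<longleftrightarrow>
     finite (funs L) \<and> finite (rels L) \<and> finite (qlos L) \<and>
     (\<forall>r as. \<not> (rel_sat L r as \<and> rel_fails L r as)) \<and>
     (has_ball L \<or> has_bex L \<longrightarrow> (\<exists>r\<in>rels L. less_rel L = Some r \<and> rel_arity L r = 2)) \<and>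
     (\<forall>q\<in>qlos L. qlo_neg L q \<subseteq> {..<qlo_forms L q} \<and>
        wf_fm (L\<lparr>qlos := {}\<rparr>) (replicate (qlo_terms L q) (qlo_vars L q))
          (replicate (qlo_forms L q) (qlo_vars L q)) (qlo_neg L q) (reduct L q) \<and>
        fv_fm (reduct L q) \<subseteq> {0} \<and>
        (\<forall>N tp fp s s'.
           qlo_neg L q \<subseteq> N \<and> (\<forall>j as. j \<notin> N \<longrightarrow> fp j as \<noteq> Some False) \<and>
           reduct_true L q N tp fp s \<and> reduct_true L q N tp fp s' \<longrightarrow> s = s'))"

text \<open>Terms and formulas proper, that is, without holes.\<close>

abbreviation is_term :: "('a, 'f, 'r, 'q) pt_lang \<Rightarrow> ('f, 'r, 'q) trm \<Rightarrow> bool" where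
  "is_term L \<equiv> wf_trm L [] [] {}"

abbreviation is_formula :: "('a, 'f, 'r, 'q) pt_lang \<Rightarrow> ('f, 'r, 'q) fm \<Rightarrow> bool" where
  "is_formula L \<equiv> wf_fm L [] [] {}"

abbreviation closed_term :: "('a, 'f, 'r, 'q) pt_lang \<Rightarrow> ('f, 'r, 'q) trm \<Rightarrow> bool" where
  "closed_term L t \<equiv> is_term L t \<and> fv_trm t = {}"

definition trm_val :: "('a, 'f, 'r, 'q) pt_lang \<Rightarrow> (nat \<Rightarrow> 'a) \<Rightarrow> ('f, 'r, 'q) trm \<Rightarrow> 'a option" where
  "trm_val L = tval L (qlo_val L) {} (\<lambda>_ _. None) (\<lambda>_ _. None)"

definition fm_val :: "('a, 'f, 'r, 'q) pt_lang \<Rightarrow> (nat \<Rightarrow> 'a) \<Rightarrow> ('f, 'r, 'q) fm \<Rightarrow> bool option" where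
  "fm_val L = fval L (qlo_val L) {} (\<lambda>_ _. None) (\<lambda>_ _. None)"

text \<open>The environment is irrelevant for closed terms.\<close>

definition referent :: "('a, 'f, 'r, 'q) pt_lang \<Rightarrow> ('f, 'r, 'q) trm \<Rightarrow> 'a option" where
  "referent L t = trm_val L (\<lambda>_. undefined) t"


section \<open>Classical and list-compatible languages\<close>

definition strongly_negatable :: "('a, 'f, 'r, 'q) pt_lang \<Rightarrow> 'r rsym \<Rightarrow> bool" where
  "strongly_negatable L R \<longleftrightarrow>
     R \<in> neg_rels L \<and> (\<forall>as. length as = arity L R \<longrightarrow> sat L R as \<or> fails L R as)"

definition classical :: "('a, 'f, 'r, 'q) pt_lang \<Rightarrow> bool" where
  "classical L \<longleftrightarrow> has_all L \<and> has_ex L \<and>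
     (\<forall>R. is_rsym L R \<and> R \<noteq> RDown \<longrightarrow> strongly_negatable L R)"

text \<open>The formula \<open>\<phi>(x\<^sub>0, \<dots>, x\<^sub>k\<^sub>-\<^sub>1)\<close> is true where \<open>P\<close> holds, and false everywhere else.\<close>

definition expresses :: "('a, 'f, 'r, 'q) pt_lang \<Rightarrow> nat \<Rightarrow> ('f, 'r, 'q) fm \<Rightarrow> ((nat \<Rightarrow> 'a) \<Rightarrow> bool) \<Rightarrow> bool"
  where
  "expresses L k \<phi> P \<longleftrightarrow>
     is_formula L \<phi> \<and> fv_fm \<phi> \<subseteq> {..<k} \<and> (\<forall>\<sigma>. fm_val L \<sigma> \<phi> = Some (P \<sigma>))"

text \<open>The term \<open>t(x\<^sub>0, \<dots>, x\<^sub>k\<^sub>-\<^sub>1)\<close> denotes the arithmetical function \<open>f\<close> on (the images of) numbers.\<close>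

definition computes :: "('a, 'f, 'r, 'q) pt_lang \<Rightarrow> (nat \<Rightarrow> 'a) \<Rightarrow> nat \<Rightarrow> ('f, 'r, 'q) trm \<Rightarrow>
    ((nat \<Rightarrow> nat) \<Rightarrow> nat) \<Rightarrow> bool" where
  "computes L num k t f \<longleftrightarrow>
     is_term L t \<and> fv_trm t \<subseteq> {..<k} \<and> (\<forall>e. trm_val L (\<lambda>i. num (e i)) t = Some (num (f e)))"

text \<open>
  Schematic terms and formulas with one unary hole \<open>\<phi>(x)\<close> for a negatable formula, and their
  values when \<open>\<phi>(x)\<close> is the (everywhere determinate) predicate \<open>P\<close>.
\<close>

abbreviation scheme_trm :: "('a, 'f, 'r, 'q) pt_lang \<Rightarrow> ('f, 'r, 'q) trm \<Rightarrow> bool" where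
  "scheme_trm L \<equiv> wf_trm L [] [1] {0}"

abbreviation scheme_fm :: "('a, 'f, 'r, 'q) pt_lang \<Rightarrow> ('f, 'r, 'q) fm \<Rightarrow> bool" where
  "scheme_fm L \<equiv> wf_fm L [] [1] {0}"

definition scheme_trm_val :: "('a, 'f, 'r, 'q) pt_lang \<Rightarrow> ('a \<Rightarrow> bool) \<Rightarrow> (nat \<Rightarrow> 'a) \<Rightarrow>
    ('f, 'r, 'q) trm \<Rightarrow> 'a option" where
  "scheme_trm_val L P = tval L (qlo_val L) {0} (\<lambda>_ _. None) (\<lambda>_ as. Some (P (hd as)))"

definition scheme_fm_val :: "('a, 'f, 'r, 'q) pt_lang \<Rightarrow> ('a \<Rightarrow> bool) \<Rightarrow> (nat \<Rightarrow> 'a) \<Rightarrow>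
    ('f, 'r, 'q) fm \<Rightarrow> bool option" where
  "scheme_fm_val L P = fval L (qlo_val L) {0} (\<lambda>_ _. None) (\<lambda>_ as. Some (P (hd as)))"

text \<open>
  \<open>num\<close> embeds the natural numbers into the domain of discourse.  Each of the primitives of
  gradualist number theory has to be reproduced by a term, formula or scheme of \<open>L\<close>; the
  operator \<open>fst{n : \<phi>(n)}\<close> and the quantifiers are applicable to arbitrary (negatable,
  determinate) formulas \<open>\<phi>\<close> of \<open>L\<close>.  A true unbounded existential statement has to come out
  true, but a false one need not come out false.
\<close>

definition reproduces_number_theory :: "('a, 'f, 'r, 'q) pt_lang \<Rightarrow> (nat \<Rightarrow> 'a) \<Rightarrow> bool" where
  "reproduces_number_theory L num \<longleftrightarrow>
     inj num \<and>
     (\<exists>\<phi>. expresses L 1 \<phi> (\<lambda>\<sigma>. \<sigma> 0 \<in> range num)) \<and>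
     (\<exists>t. computes L num 0 t (\<lambda>_. 0)) \<and>
     (\<exists>t. computes L num 0 t (\<lambda>_. 1)) \<and>
     (\<exists>t. computes L num 2 t (\<lambda>e. e 0 + e 1)) \<and>
     (\<exists>t. computes L num 2 t (\<lambda>e. e 0 * e 1)) \<and>
     (\<exists>t. computes L num 2 t (\<lambda>e. e 0 ^ e 1)) \<and>
     (\<exists>\<phi>. expresses L 2 \<phi> (\<lambda>\<sigma>. \<exists>m n. \<sigma> 0 = num m \<and> \<sigma> 1 = num n \<and> m < n)) \<and>
     (\<exists>A. scheme_fm L A \<and> fv_fm A \<subseteq> {0} \<and>
        (\<forall>P \<sigma> m. \<sigma> 0 = num m \<longrightarrow> scheme_fm_val L P \<sigma> A = Some (\<forall>n<m. P (num n)))) \<and>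
     (\<exists>A. scheme_fm L A \<and> fv_fm A \<subseteq> {0} \<and>
        (\<forall>P \<sigma> m. \<sigma> 0 = num m \<longrightarrow> scheme_fm_val L P \<sigma> A = Some (\<exists>n<m. P (num n)))) \<and>
     (\<exists>A. scheme_fm L A \<and> fv_fm A = {} \<and>
        (\<forall>P \<sigma>. scheme_fm_val L P \<sigma> A = Some True \<longleftrightarrow> (\<exists>n. P (num n)))) \<and>
     (\<exists>t. scheme_trm L t \<and> fv_trm t = {} \<and>
        (\<forall>P \<sigma>. scheme_trm_val L P \<sigma> t =
           (if \<exists>n. P (num n) then Some (num (LEAST n. P (num n))) else None)))"

text \<open>Positions in lists are counted from 1.\<close>

definition has_lists :: "('a, 'f, 'r, 'q) pt_lang \<Rightarrow> (nat \<Rightarrow> 'a) \<Rightarrow> bool" where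
  "has_lists L num \<longleftrightarrow>
     (\<exists>enc :: 'a list \<Rightarrow> 'a. inj enc \<and>
        (\<exists>\<phi>. expresses L 1 \<phi> (\<lambda>\<sigma>. \<sigma> 0 \<in> range enc)) \<and>
        (\<exists>\<phi>. expresses L 3 \<phi> (\<lambda>\<sigma>. \<exists>as i. \<sigma> 0 = enc as \<and> \<sigma> 1 = num i \<and>
                1 \<le> i \<and> i \<le> length as \<and> \<sigma> 2 = as ! (i - 1))) \<and>
        (\<exists>\<phi>. expresses L 2 \<phi> (\<lambda>\<sigma>. \<exists>as. \<sigma> 0 = enc as \<and> \<sigma> 1 = num (length as))))"

definition list_compatible :: "('a, 'f, 'r, 'q) pt_lang \<Rightarrow> (nat \<Rightarrow> 'a) \<Rightarrow> bool" where
  "list_compatible L num \<longleftrightarrow> reproduces_number_theory L num \<and> has_lists L num"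

definition representable :: "('a, 'f, 'r, 'q) pt_lang \<Rightarrow> (nat \<Rightarrow> 'a) \<Rightarrow> nat \<Rightarrow> nat set" where
  "representable L num n =
     {m. \<exists>t. closed_term L t \<and> trm_length t \<le> n \<and> referent L t = Some (num m)}"


section \<open>Explicitly given families of terms\<close>

text \<open>
  The total recursive functions.  They take lists as arguments, where missing arguments are
  read as 0, so that no arities are needed.
\<close>

inductive recursive :: "(nat list \<Rightarrow> nat) \<Rightarrow> bool" where
  rec_zero: "recursive (\<lambda>_. 0)"
| rec_succ: "recursive (\<lambda>xs. Suc (case xs of [] \<Rightarrow> 0 | x # _ \<Rightarrow> x))"
| rec_proj: "recursive (\<lambda>xs. if i < length xs then xs ! i else 0)"
| rec_comp: "recursive g \<Longrightarrow> \<forall>f\<in>set fs. recursive f \<Longrightarrow> recursive (\<lambda>xs. g (map (\<lambda>f. f xs) fs))"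
| rec_prim: "recursive f \<Longrightarrow> recursive g \<Longrightarrow>
    recursive (\<lambda>xs. rec_nat (f (tl xs)) (\<lambda>m r. g (m # r # tl xs)) (case xs of [] \<Rightarrow> 0 | x # _ \<Rightarrow> x))"
| rec_min: "recursive f \<Longrightarrow> \<forall>xs. \<exists>y. f (y # xs) = 0 \<Longrightarrow> recursive (\<lambda>xs. LEAST y. f (y # xs) = 0)"

fun rsym_code :: "('r \<Rightarrow> nat) \<Rightarrow> 'r rsym \<Rightarrow> nat" where
  "rsym_code cr REq = 0"
| "rsym_code cr RDown = 1"
| "rsym_code cr (RPrim r) = cr r + 2"

fun sym_code :: "('f \<Rightarrow> nat) \<Rightarrow> ('r \<Rightarrow> nat) \<Rightarrow> ('q \<Rightarrow> nat) \<Rightarrow> ('f, 'r, 'q) sym \<Rightarrow> nat" where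
  "sym_code cf cr cq (SVar x) = prod_encode (0, x)"
| "sym_code cf cr cq (SFun f) = prod_encode (1, cf f)"
| "sym_code cf cr cq (SQlo q) = prod_encode (2, cq q)"
| "sym_code cf cr cq (SRel R) = prod_encode (3, rsym_code cr R)"
| "sym_code cf cr cq (STPar i) = prod_encode (4, i)"
| "sym_code cf cr cq (SFPar j) = prod_encode (5, j)"
| "sym_code cf cr cq SNot = prod_encode (6, 0)"
| "sym_code cf cr cq SAnd = prod_encode (6, 1)"
| "sym_code cf cr cq SOr = prod_encode (6, 2)"
| "sym_code cf cr cq SAll = prod_encode (6, 3)"
| "sym_code cf cr cq SEx = prod_encode (6, 4)"
| "sym_code cf cr cq SBound = prod_encode (6, 5)"

text \<open>
  A family of terms is explicit if the symbol sequence of its \<open>n\<close>-th member can be computed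
  from \<open>n\<close>, for any numbering of the (finitely many) primitive symbols.
\<close>

definition explicit :: "('a, 'f, 'r, 'q) pt_lang \<Rightarrow> (nat \<Rightarrow> ('f, 'r, 'q) trm) \<Rightarrow> bool" where
  "explicit L \<Phi> \<longleftrightarrow>
     (\<forall>cf cr cq. inj_on cf (funs L) \<and> inj_on cr (rels L) \<and> inj_on cq (qlos L) \<longrightarrow>
        (\<exists>h. recursive h \<and>
           (\<forall>n. h [n] = list_encode (map (sym_code cf cr cq) (symbols (\<Phi> n))))))"

end

theory Submission
  imports Defs
begin

text \<open>
  Weak Kleene semantics makes the referents of terms and the truth values of formulas a positive
  inductive definition: the absence of a value never has to be asserted, and for QLOs the
  uniqueness condition allows to replace \<open>\<exists>!s. \<Theta>\<close> by \<open>\<exists>s. \<Theta>\<close>.  With terms and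
  environments coded by lists, one step of this definition has the form
  \<open>x \<in> T' \<longleftrightarrow> (\<exists>c. A x c \<and> (\<forall>y. B x c y \<longrightarrow> y \<in> T))\<close> with \<open>A\<close> and \<open>B\<close> expressible in \<open>L\<close>.
  As \<open>T\<close> occurs only once on the right, \<open>k\<close> iterations are expressed by a formula of length \<open>O(k)\<close>,
  and \<open>O(n)\<close> iterations evaluate all terms of length at most \<open>n\<close>.  Up to renaming of variables there
  are only finitely many of these, so the largest number they represent is the least number that
  none of them exceeds, and this is named by the operator \<open>fst\<close>.
\<close>

text \<open>By diagonalization no single determinate formula of \<open>L\<close> evaluates all terms
  of \<open>L\<close>, so the depth of evaluation has to be cut off and has to grow with
  \<open>n\<close>. The danger is length: a rule with two premises mentions the previous stage
  twice, and a literal unfolding of \<open>k\<close> stages is exponential in \<open>k\<close>. The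
  lists of \<open>L\<close> avert this: one choice \<open>c\<close> packs all witnesses of a step,
  and one universal quantifier runs over all premises that the choice calls for. Falsity is the
  delicate value. For compound formulas it requires every instance to be determinate and the formula
  to be negatable, so determinacy (value 2) and negatability (\<open>jNeg\<close>) become judgements
  of their own. A QLO is not eliminated by substitution into its reduct, which could multiply its
  arguments at every nesting. The reduct is evaluated with the arguments kept in a frame, and
  \<open>eval_rate\<close> is the resulting number of rounds per symbol. Classicality supplies both
  quantifiers and a dual for the formulas built here. The dual is needed in earnest:
  \<open>fst\<close> is applied to the negation of being exceeded, and the length of that negation
  has to be linear as well.\<close>

lemma trm_fm_induct [case_names Var Fun Qlo TPar Atom FPar And Or BAll BEx All Ex]:
  fixes P :: "('f, 'r, 'q) trm \<Rightarrow> bool" and R :: "('f, 'r, 'q) fm \<Rightarrow> bool"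
  assumes "\<And>x. P (Var x)"
    and "\<And>f ts. (\<And>t. t \<in> set ts \<Longrightarrow> P t) \<Longrightarrow> P (Fun f ts)"
    and "\<And>q xs ts \<phi>s. (\<And>t. t \<in> set ts \<Longrightarrow> P t) \<Longrightarrow> (\<And>\<phi>. \<phi> \<in> set \<phi>s \<Longrightarrow> R \<phi>) \<Longrightarrow> P (Qlo q xs ts \<phi>s)"
    and "\<And>i ts. (\<And>t. t \<in> set ts \<Longrightarrow> P t) \<Longrightarrow> P (TPar i ts)"
    and "\<And>b A ts. (\<And>t. t \<in> set ts \<Longrightarrow> P t) \<Longrightarrow> R (Atom b A ts)"
    and "\<And>b j ts. (\<And>t. t \<in> set ts \<Longrightarrow> P t) \<Longrightarrow> R (FPar b j ts)"
    and "\<And>\<phi> \<psi>. R \<phi> \<Longrightarrow> R \<psi> \<Longrightarrow> R (And \<phi> \<psi>)"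
    and "\<And>\<phi> \<psi>. R \<phi> \<Longrightarrow> R \<psi> \<Longrightarrow> R (Or \<phi> \<psi>)"
    and "\<And>x t \<phi>. P t \<Longrightarrow> R \<phi> \<Longrightarrow> R (BAll x t \<phi>)"
    and "\<And>x t \<phi>. P t \<Longrightarrow> R \<phi> \<Longrightarrow> R (BEx x t \<phi>)"
    and "\<And>x \<phi>. R \<phi> \<Longrightarrow> R (All x \<phi>)"
    and "\<And>x \<phi>. R \<phi> \<Longrightarrow> R (Ex x \<phi>)"
  shows "P t" and "R \<phi>"
  using assms by (induct t and \<phi>) auto

lemma those_eq_Some_iff: "those xs = Some ys \<longleftrightarrow> xs = map Some ys"
  by (induct xs arbitrary: ys) (auto split: option.splits)

lemma those_map_Some [simp]: "those (map (\<lambda>x. Some (f x)) xs) = Some (map f xs)"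
  by (induct xs) auto

lemmas fm_induct = trm_fm_induct(2)[where P = "\<lambda>_. True", simplified,
  case_names Atom FPar And Or BAll BEx All Ex]

lemma finite_fv:
  fixes t :: "('f, 'r, 'q) trm" and \<phi> :: "('f, 'r, 'q) fm"
  shows "finite (fv_trm t)" "finite (fv_fm \<phi>)"
  by (induct t and \<phi> rule: trm_fm_induct) auto

subsection \<open>Dependence on the environment and on the holes\<close>

text \<open>The semantics obtains the holes from \<open>!\<close> on a list, which is arbitrary
  outside the declared indices. Hence only declared indices and argument lists of the declared
  length may be compared.\<close>

definition agree :: "nat list \<Rightarrow> (nat \<Rightarrow> 'a list \<Rightarrow> 'b) \<Rightarrow> (nat \<Rightarrow> 'a list \<Rightarrow> 'b) \<Rightarrow> bool" where
  "agree ar p p' \<longleftrightarrow> (\<forall>i as. i < length ar \<and> length as = ar ! i \<longrightarrow> p i as = p' i as)"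

lemma agree_Nil [simp]: "agree [] p p'"
  by (simp add: agree_def)

lemma assign_cong:
  assumes "length as = length xs" "\<And>y. y \<in> A - set xs \<Longrightarrow> \<sigma> y = \<tau> y" "y \<in> A"
  shows "assign \<sigma> xs as y = assign \<tau> xs as y"
proof (cases "map_of (zip xs as) y")
  case None
  then have "y \<notin> set xs" using assms(1) by (simp add: map_of_zip_is_None)
  with assms(2)[of y] assms(3) have "\<sigma> y = \<tau> y" by simp
  with None show ?thesis by (simp add: assign_def)
qed (simp add: assign_def)

text \<open>A QLO receives its arguments as functions, not as values. A congruence of values can
  therefore hold only if the interpretation does not look at these functions outside the declared
  arities.\<close>

definition qlo_local :: "('a, 'f, 'r, 'q) pt_lang \<Rightarrow> ('a, 'q) qlo_interp \<Rightarrow> bool" where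
  "qlo_local L Q \<longleftrightarrow> (\<forall>q\<in>qlos L. \<forall>N tp tp' fp fp'.
     agree (replicate (qlo_terms L q) (qlo_vars L q)) tp tp' \<and>
     agree (replicate (qlo_forms L q) (qlo_vars L q)) fp fp' \<longrightarrow> Q q N tp fp = Q q N tp' fp')"

text \<open>The language \<open>L'\<close> only governs well-formedness; it is \<open>L\<close>, or \<open>L\<close> without its QLOs.\<close>

lemma val_cong:
  assumes Q: "qlo_local L' Q"
  shows "wf_trm L' ta fa M t \<Longrightarrow> agree ta tp tp' \<Longrightarrow> agree fa fp fp' \<Longrightarrow>
      (\<And>x. x \<in> fv_trm t \<Longrightarrow> \<sigma> x = \<tau> x) \<Longrightarrow>
      tval L Q N tp fp \<sigma> t = tval L Q N tp' fp' \<tau> t"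
    and "wf_fm L' ta fa M \<phi> \<Longrightarrow> agree ta tp tp' \<Longrightarrow> agree fa fp fp' \<Longrightarrow>
      (\<And>x. x \<in> fv_fm \<phi> \<Longrightarrow> \<sigma> x = \<tau> x) \<Longrightarrow>
      fval L Q N tp fp \<sigma> \<phi> = fval L Q N tp' fp' \<tau> \<phi>"
proof (induct t and \<phi> arbitrary: \<sigma> \<tau> and \<sigma> \<tau> rule: trm_fm_induct)
  case (Fun f ts)
  from Fun(2-) have "map (tval L Q N tp fp \<sigma>) ts = map (tval L Q N tp' fp' \<tau>) ts"
    by (intro map_cong refl Fun(1)) auto
  then show ?case by (simp del: map_eq_conv)
next
  case (TPar i ts)
  from TPar(2-) have *: "map (tval L Q N tp fp \<sigma>) ts = map (tval L Q N tp' fp' \<tau>) ts"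
    by (intro map_cong refl TPar(1)) auto
  show ?case
  proof (cases "those (map (tval L Q N tp fp \<sigma>) ts)")
    case (Some as)
    then have "map (tval L Q N tp fp \<sigma>) ts = map Some as" by (simp only: those_eq_Some_iff)
    then have "length as = length ts" by (metis length_map)
    then show ?thesis using Some * TPar by (simp add: agree_def del: map_eq_conv)
  qed (use * in \<open>simp del: map_eq_conv\<close>)
next
  case (Atom b A ts)
  from Atom(2-) have "map (tval L Q N tp fp \<sigma>) ts = map (tval L Q N tp' fp' \<tau>) ts"
    by (intro map_cong refl Atom(1)) auto
  then show ?case by (simp del: map_eq_conv)
next
  case (FPar b j ts)
  from FPar(2-) have *: "map (tval L Q N tp fp \<sigma>) ts = map (tval L Q N tp' fp' \<tau>) ts"
    by (intro map_cong refl FPar(1)) auto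
  show ?case
  proof (cases "those (map (tval L Q N tp fp \<sigma>) ts)")
    case (Some as)
    then have "map (tval L Q N tp fp \<sigma>) ts = map Some as" by (simp only: those_eq_Some_iff)
    then have "length as = length ts" by (metis length_map)
    then show ?thesis using Some * FPar by (simp add: agree_def del: map_eq_conv)
  qed (use * in \<open>simp del: map_eq_conv\<close>)
next
  case (Qlo q xs ts \<phi>s)
  let ?A = "(\<Union>t\<in>set ts. fv_trm t) \<union> (\<Union>\<phi>\<in>set \<phi>s. fv_fm \<phi>)"
  \<comment> \<open>A list \<open>as\<close> of the wrong length may leave a bound variable to the
    outer environment, where \<open>\<sigma>\<close> and \<open>\<tau>\<close> can differ. Locality
    of \<open>Q\<close> makes the right length the only relevant one.\<close>
  have eq: "assign \<sigma> xs as y = assign \<tau> xs as y" if "length as = length xs" "y \<in> ?A" for as y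
    using assign_cong[OF that(1) _ that(2), of \<sigma> \<tau>] Qlo by simp
  have t: "tval L Q N tp fp (assign \<sigma> xs as) t = tval L Q N tp' fp' (assign \<tau> xs as) t"
    if "t \<in> set ts" "length as = length xs" for t as
    using that Qlo(3-5) by (intro Qlo(1) eq) auto
  have f: "fval L Q N tp fp (assign \<sigma> xs as) \<phi> = fval L Q N tp' fp' (assign \<tau> xs as) \<phi>"
    if "\<phi> \<in> set \<phi>s" "length as = length xs" for \<phi> as
    using that Qlo(3-5) by (intro Qlo(2) eq) auto
  show ?case
    using Q Qlo(3) unfolding qlo_local_def
    by (auto simp: agree_def t f intro!: Q[unfolded qlo_local_def, rule_format])
next
  case (BAll x t \<phi>)
  have "fval L Q N tp fp (\<sigma>(x := d)) \<phi> = fval L Q N tp' fp' (\<tau>(x := d)) \<phi>" for d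
    using BAll(3-6) by (intro BAll(2)) auto
  then show ?case using BAll by simp
next
  case (BEx x t \<phi>)
  have "fval L Q N tp fp (\<sigma>(x := d)) \<phi> = fval L Q N tp' fp' (\<tau>(x := d)) \<phi>" for d
    using BEx(3-6) by (intro BEx(2)) auto
  then show ?case using BEx by simp
next
  case (All x \<phi>)
  have "fval L Q N tp fp (\<sigma>(x := d)) \<phi> = fval L Q N tp' fp' (\<tau>(x := d)) \<phi>" for d
    using All(2-5) by (intro All(1)) auto
  then show ?case by simp
next
  case (Ex x \<phi>)
  have "fval L Q N tp fp (\<sigma>(x := d)) \<phi> = fval L Q N tp' fp' (\<tau>(x := d)) \<phi>" for d
    using Ex(2-5) by (intro Ex(1)) auto
  then show ?case by simp
next
  case (And \<phi> \<psi>)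
  have "fval L Q N tp fp \<sigma> \<phi> = fval L Q N tp' fp' \<tau> \<phi>"
    and "fval L Q N tp fp \<sigma> \<psi> = fval L Q N tp' fp' \<tau> \<psi>"
    using And(3-6) by (auto intro!: And(1,2))
  then show ?case by simp
next
  case (Or \<phi> \<psi>)
  have "fval L Q N tp fp \<sigma> \<phi> = fval L Q N tp' fp' \<tau> \<phi>"
    and "fval L Q N tp fp \<sigma> \<psi> = fval L Q N tp' fp' \<tau> \<psi>"
    using Or(3-6) by (auto intro!: Or(1,2))
  then show ?case by simp
qed auto

text \<open>Vacuous, and therefore applicable to reducts, which are evaluated under a dummy
  interpretation of the QLOs.\<close>

lemma qlo_local_no_qlos: "qlo_local (L\<lparr>qlos := {}\<rparr>) Q"
  by (simp add: qlo_local_def)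

lemma reduct_true_cong:
  assumes "pt_language L" "q \<in> qlos L"
    and "agree (replicate (qlo_terms L q) (qlo_vars L q)) tp tp'"
    and "agree (replicate (qlo_forms L q) (qlo_vars L q)) fp fp'"
  shows "reduct_true L q N tp fp = reduct_true L q N tp' fp'"
proof
  fix s
  have "wf_fm (L\<lparr>qlos := {}\<rparr>) (replicate (qlo_terms L q) (qlo_vars L q))
          (replicate (qlo_forms L q) (qlo_vars L q)) (qlo_neg L q) (reduct L q)"
    using assms(1,2) by (simp add: pt_language_def)
  from val_cong(2)[OF qlo_local_no_qlos this assms(3,4)]
  show "reduct_true L q N tp fp s = reduct_true L q N tp' fp' s"
    by (simp add: reduct_true_def)
qed

text \<open>\<open>qlo_val\<close> looks at its arguments only through \<open>reduct_true\<close>,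
  and a well-formed reduct uses its holes only at their declared arities.\<close>

lemma qlo_local_qlo_val:
  assumes "pt_language L"
  shows "qlo_local L (qlo_val L)"
  unfolding qlo_local_def qlo_val_def using reduct_true_cong[OF assms] by metis

subsection \<open>Renaming of variables\<close>

text \<open>Bound variables are renamed together with the free ones, so for injective
  \<open>\<pi>\<close> no freshness condition arises.\<close>

fun ren_trm :: "(nat \<Rightarrow> nat) \<Rightarrow> ('f, 'r, 'q) trm \<Rightarrow> ('f, 'r, 'q) trm"
  and ren_fm :: "(nat \<Rightarrow> nat) \<Rightarrow> ('f, 'r, 'q) fm \<Rightarrow> ('f, 'r, 'q) fm" where
  "ren_trm \<pi> (Var x) = Var (\<pi> x)"
| "ren_trm \<pi> (Fun f ts) = Fun f (map (ren_trm \<pi>) ts)"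
| "ren_trm \<pi> (Qlo q xs ts \<phi>s) = Qlo q (map \<pi> xs) (map (ren_trm \<pi>) ts) (map (ren_fm \<pi>) \<phi>s)"
| "ren_trm \<pi> (TPar i ts) = TPar i (map (ren_trm \<pi>) ts)"
| "ren_fm \<pi> (Atom b R ts) = Atom b R (map (ren_trm \<pi>) ts)"
| "ren_fm \<pi> (FPar b j ts) = FPar b j (map (ren_trm \<pi>) ts)"
| "ren_fm \<pi> (And \<phi> \<psi>) = And (ren_fm \<pi> \<phi>) (ren_fm \<pi> \<psi>)"
| "ren_fm \<pi> (Or \<phi> \<psi>) = Or (ren_fm \<pi> \<phi>) (ren_fm \<pi> \<psi>)"
| "ren_fm \<pi> (BAll x t \<phi>) = BAll (\<pi> x) (ren_trm \<pi> t) (ren_fm \<pi> \<phi>)"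
| "ren_fm \<pi> (BEx x t \<phi>) = BEx (\<pi> x) (ren_trm \<pi> t) (ren_fm \<pi> \<phi>)"
| "ren_fm \<pi> (All x \<phi>) = All (\<pi> x) (ren_fm \<pi> \<phi>)"
| "ren_fm \<pi> (Ex x \<phi>) = Ex (\<pi> x) (ren_fm \<pi> \<phi>)"

lemma negatable_ren [simp]: "negatable L N (ren_fm \<pi> \<phi>) = negatable L N \<phi>"
  by (induct \<phi> rule: fm_induct) auto

lemma wf_ren:
  fixes t :: "('f, 'r, 'q) trm" and \<phi> :: "('f, 'r, 'q) fm"
  assumes "inj \<pi>"
  shows "wf_trm L ta fa N (ren_trm \<pi> t) = wf_trm L ta fa N t"
    and "wf_fm L ta fa N (ren_fm \<pi> \<phi>) = wf_fm L ta fa N \<phi>"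
  by (induct t and \<phi> rule: trm_fm_induct)
     (auto simp: distinct_map inj_on_subset[OF assms])

lemma fv_ren:
  fixes t :: "('f, 'r, 'q) trm" and \<phi> :: "('f, 'r, 'q) fm"
  assumes "inj \<pi>"
  shows "fv_trm (ren_trm \<pi> t) = \<pi> ` fv_trm t" and "fv_fm (ren_fm \<pi> \<phi>) = \<pi> ` fv_fm \<phi>"
  by (induct t and \<phi> rule: trm_fm_induct)
     (auto simp: image_Un image_UN image_set_diff[OF assms])

lemma assign_ren:
  assumes "inj \<pi>"
  shows "assign \<sigma> (map \<pi> xs) as \<circ> \<pi> = assign (\<sigma> \<circ> \<pi>) xs as"
proof
  fix y
  have "map_of (zip (map \<pi> xs) as) (\<pi> y) = map_of (zip xs as) y"
    by (induct xs as rule: list_induct2') (auto simp: inj_eq[OF assms])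
  then show "(assign \<sigma> (map \<pi> xs) as \<circ> \<pi>) y = assign (\<sigma> \<circ> \<pi>) xs as y"
    by (cases "map_of (zip xs as) y") (simp_all add: assign_def)
qed

lemma val_ren:
  fixes L :: "('a, 'f, 'r, 'q) pt_lang" and t :: "('f, 'r, 'q) trm" and \<phi> :: "('f, 'r, 'q) fm"
  assumes "inj \<pi>"
  shows "tval L Q N tp fp \<sigma> (ren_trm \<pi> t) = tval L Q N tp fp (\<sigma> \<circ> \<pi>) t"
    and "fval L Q N tp fp \<sigma> (ren_fm \<pi> \<phi>) = fval L Q N tp fp (\<sigma> \<circ> \<pi>) \<phi>"
proof -
  have upd: "\<sigma>(\<pi> x := d) \<circ> \<pi> = (\<sigma> \<circ> \<pi>)(x := d)" for \<sigma> :: "nat \<Rightarrow> 'a" and x d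
    by (auto simp: fun_eq_iff inj_eq[OF assms])
  show "tval L Q N tp fp \<sigma> (ren_trm \<pi> t) = tval L Q N tp fp (\<sigma> \<circ> \<pi>) t"
    and "fval L Q N tp fp \<sigma> (ren_fm \<pi> \<phi>) = fval L Q N tp fp (\<sigma> \<circ> \<pi>) \<phi>"
  proof (induct t and \<phi> arbitrary: \<sigma> and \<sigma> rule: trm_fm_induct)
    case (Qlo q xs ts \<phi>s)
    have "(\<lambda>i as. map (tval L Q N tp fp (assign \<sigma> (map \<pi> xs) as)) (map (ren_trm \<pi>) ts) ! i)
        = (\<lambda>i as. map (tval L Q N tp fp (assign (\<sigma> \<circ> \<pi>) xs as)) ts ! i)"
      by (intro ext arg_cong[where f = "\<lambda>l. l ! _"]) (simp add: Qlo(1) assign_ren[OF assms, unfolded comp_def] comp_def)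
    moreover have "(\<lambda>i as. map (fval L Q N tp fp (assign \<sigma> (map \<pi> xs) as)) (map (ren_fm \<pi>) \<phi>s) ! i)
        = (\<lambda>i as. map (fval L Q N tp fp (assign (\<sigma> \<circ> \<pi>) xs as)) \<phi>s ! i)"
      by (intro ext arg_cong[where f = "\<lambda>l. l ! _"]) (simp add: Qlo(2) assign_ren[OF assms, unfolded comp_def] comp_def)
    moreover have "{j. j < length (map (ren_fm \<pi>) \<phi>s) \<and> negatable L N (map (ren_fm \<pi>) \<phi>s ! j)}
        = {j. j < length \<phi>s \<and> negatable L N (\<phi>s ! j)}" by auto
    ultimately show ?case by (simp only: tval.simps ren_trm.simps)
  next
    case (Fun f ts)
    then have "map (tval L Q N tp fp \<sigma>) (map (ren_trm \<pi>) ts) = map (tval L Q N tp fp (\<sigma> \<circ> \<pi>)) ts" by (simp add: comp_def)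
    then show ?case by (simp only: tval.simps ren_trm.simps)
  next
    case (TPar f ts)
    then have "map (tval L Q N tp fp \<sigma>) (map (ren_trm \<pi>) ts) = map (tval L Q N tp fp (\<sigma> \<circ> \<pi>)) ts" by (simp add: comp_def)
    then show ?case by (simp only: tval.simps ren_trm.simps)
  next
    case (Atom b A ts)
    then have "map (tval L Q N tp fp \<sigma>) (map (ren_trm \<pi>) ts) = map (tval L Q N tp fp (\<sigma> \<circ> \<pi>)) ts" by (simp add: comp_def)
    then show ?case by (simp only: fval.simps ren_fm.simps)
  next
    case (FPar b j ts)
    then have "map (tval L Q N tp fp \<sigma>) (map (ren_trm \<pi>) ts) = map (tval L Q N tp fp (\<sigma> \<circ> \<pi>)) ts" by (simp add: comp_def)
    then show ?case by (simp only: fval.simps ren_fm.simps)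
  qed (simp_all add: upd)
qed

subsection \<open>De Morgan duals\<close>

fun neg :: "('f, 'r, 'q) fm \<Rightarrow> ('f, 'r, 'q) fm" where
  "neg (Atom b R ts) = Atom (\<not> b) R ts"
| "neg (FPar b j ts) = FPar (\<not> b) j ts"
| "neg (And \<phi> \<psi>) = Or (neg \<phi>) (neg \<psi>)"
| "neg (Or \<phi> \<psi>) = And (neg \<phi>) (neg \<psi>)"
| "neg (BAll x t \<phi>) = BEx x t (neg \<phi>)"
| "neg (BEx x t \<phi>) = BAll x t (neg \<phi>)"
| "neg (All x \<phi>) = Ex x (neg \<phi>)"
| "neg (Ex x \<phi>) = All x (neg \<phi>)"

lemma fv_neg [simp]: "fv_fm (neg \<phi>) = fv_fm \<phi>"
  by (induct \<phi> rule: fm_induct) auto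

lemma wf_neg:
  "wf_fm L ta fa N \<phi> \<Longrightarrow> negatable L N \<phi> \<Longrightarrow> wf_fm L ta fa N (neg \<phi>) \<and> negatable L N (neg \<phi>)"
  by (induct \<phi> rule: fm_induct) auto

lemma map_option_Not_eq_iff [simp]: "map_option Not u = Some b \<longleftrightarrow> u = Some (\<not> b)"
  by (cases u) auto

lemma kleene2_Not:
  "kleene2 (\<or>) (map_option Not u) (map_option Not v) = map_option Not (kleene2 (\<and>) u v)"
  "kleene2 (\<and>) (map_option Not u) (map_option Not v) = map_option Not (kleene2 (\<or>) u v)"
  by (auto simp: kleene2_def split: option.splits)

lemma kleene_all_ex_iff:
  "kleene_all (f ` A) = (if \<exists>d\<in>A. f d = None then None else Some (\<forall>d\<in>A. f d \<noteq> Some False))"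
  "kleene_ex (f ` A) = (if \<exists>d\<in>A. f d = None then None else Some (\<exists>d\<in>A. f d = Some True))"
  by (simp_all add: kleene_all_def kleene_ex_def image_iff eq_commute)

lemma kleene_Not:
  "kleene_ex ((\<lambda>d. map_option Not (f d)) ` A) = map_option Not (kleene_all (f ` A))"
  "kleene_all ((\<lambda>d. map_option Not (f d)) ` A) = map_option Not (kleene_ex (f ` A))"
  unfolding kleene_all_ex_iff map_option_is_None map_option_Not_eq_iff by (simp_all del: map_option_eq_Some)

lemma never_false_unless_True [simp]: "never_false_unless True v = v"
  by (simp add: never_false_unless_def)

text \<open>For negatable formulas \<open>never_false_unless\<close> does nothing on either side,
  and what remains is the duality of the weak Kleene tables.\<close>

lemma fval_neg:
  "wf_fm L ta fa N \<phi> \<Longrightarrow> negatable L N \<phi> \<Longrightarrow>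
     fval L Q N tp fp \<sigma> (neg \<phi>) = map_option Not (fval L Q N tp fp \<sigma> \<phi>)"
proof (induct \<phi> arbitrary: \<sigma> rule: fm_induct)
  case (Atom b R ts)
  then show ?case by (cases "those (map (tval L Q N tp fp \<sigma>) ts)") auto
next
  case (FPar b j ts)
  then show ?case
    by (cases "those (map (tval L Q N tp fp \<sigma>) ts)") (auto simp: option.map_comp comp_def option.map_ident)
next
  case (BAll x t \<phi>)
  \<comment> \<open>The dual body has to be negatable again, so that the truncation of falsity
    disappears on the dual side too.\<close>
  moreover from BAll have "negatable L N (neg \<phi>)" using wf_neg[of L ta fa N \<phi>] by auto
  ultimately show ?case by (cases "tval L Q N tp fp \<sigma> t") (simp_all add: kleene_Not)
next
  case (BEx x t \<phi>)
  moreover from BEx have "negatable L N (neg \<phi>)" using wf_neg[of L ta fa N \<phi>] by auto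
  ultimately show ?case by (cases "tval L Q N tp fp \<sigma> t") (simp_all add: kleene_Not)
next
  case (All x \<phi>)
  moreover from All have "negatable L N (neg \<phi>)" using wf_neg[of L ta fa N \<phi>] by auto
  ultimately show ?case by (simp add: kleene_Not)
next
  case (Ex x \<phi>)
  moreover from Ex have "negatable L N (neg \<phi>)" using wf_neg[of L ta fa N \<phi>] by auto
  ultimately show ?case by (simp add: kleene_Not)
next
  case (And \<phi> \<psi>)
  moreover from And have "negatable L N (neg \<phi>)" "negatable L N (neg \<psi>)"
    using wf_neg[of L ta fa N \<phi>] wf_neg[of L ta fa N \<psi>] by auto
  ultimately show ?case by (simp add: kleene2_Not)
next
  case (Or \<phi> \<psi>)
  moreover from Or have "negatable L N (neg \<phi>)" "negatable L N (neg \<psi>)"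
    using wf_neg[of L ta fa N \<phi>] wf_neg[of L ta fa N \<psi>] by auto
  ultimately show ?case by (simp add: kleene2_Not)
qed

text \<open>Each clause of the semantics lets falsity through only under the negatability condition
  of that clause; for holes the second hypothesis takes over this role.\<close>

lemma negatable_if_false:
  assumes "fval L Q N tp fp \<sigma> \<phi> = Some False" "\<And>j as. j \<notin> N \<Longrightarrow> fp j as \<noteq> Some False"
  shows "negatable L N \<phi>"
  using assms
  by (cases \<phi>) (auto simp: never_false_unless_def bind_eq_Some_conv split: if_splits)

subsection \<open>Definable predicates of environments\<close>

locale classical_language =
  fixes L :: "('a, 'f, 'r, 'q) pt_lang"
  assumes pt: "pt_language L" and classical: "classical L"
begin

text \<open>Definability by a formula that is determinate everywhere and negatable. It speaks of
  whole environments instead of tuples, so the closure rules carry no arities; bounds on the free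
  variables are restored by \<open>definable_expresses\<close>.\<close>

definition definable :: "((nat \<Rightarrow> 'a) \<Rightarrow> bool) \<Rightarrow> bool" where
  "definable P \<longleftrightarrow> (\<exists>\<phi>. is_formula L \<phi> \<and> negatable L {} \<phi> \<and> (\<forall>\<sigma>. fm_val L \<sigma> \<phi> = Some (P \<sigma>)))"

lemma has_quantifiers [simp]: "has_all L" "has_ex L"
  using classical by (simp_all add: classical_def)

lemma neg_relsI: "is_rsym L R \<Longrightarrow> R \<noteq> RDown \<Longrightarrow> R \<in> neg_rels L"
  using classical by (simp add: classical_def strongly_negatable_def)

lemma fails_iff: "is_rsym L R \<Longrightarrow> R \<noteq> RDown \<Longrightarrow> length as = arity L R \<Longrightarrow> fails L R as \<longleftrightarrow> \<not> sat L R as"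
proof -
  assume a: "is_rsym L R" "R \<noteq> RDown" "length as = arity L R"
  have "\<not> (sat L R as \<and> fails L R as)"
    using pt a(2) by (cases R) (auto simp: pt_language_def)
  with a classical show ?thesis by (auto simp: classical_def strongly_negatable_def)
qed

lemma REq_neg [simp]: "REq \<in> neg_rels L"
  by (rule neg_relsI) auto

lemma fm_val_cong:
  "is_formula L \<phi> \<Longrightarrow> (\<And>x. x \<in> fv_fm \<phi> \<Longrightarrow> \<sigma> x = \<tau> x) \<Longrightarrow> fm_val L \<sigma> \<phi> = fm_val L \<tau> \<phi>"
  unfolding fm_val_def by (rule val_cong(2)[OF qlo_local_qlo_val[OF pt]]) auto

lemma fm_val_And:
  "negatable L {} \<phi> \<Longrightarrow> negatable L {} \<psi> \<Longrightarrow> fm_val L \<sigma> \<phi> = Some p \<Longrightarrow> fm_val L \<sigma> \<psi> = Some q \<Longrightarrow>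
     fm_val L \<sigma> (And \<phi> \<psi>) = Some (p \<and> q)"
  by (simp add: fm_val_def kleene2_def)

lemma fm_val_Or:
  "negatable L {} \<phi> \<Longrightarrow> negatable L {} \<psi> \<Longrightarrow> fm_val L \<sigma> \<phi> = Some p \<Longrightarrow> fm_val L \<sigma> \<psi> = Some q \<Longrightarrow>
     fm_val L \<sigma> (Or \<phi> \<psi>) = Some (p \<or> q)"
  by (simp add: fm_val_def kleene2_def)

lemma fm_val_Ex:
  "negatable L {} \<phi> \<Longrightarrow> (\<And>d. fm_val L (\<sigma>(x := d)) \<phi> = Some (P d)) \<Longrightarrow>
     fm_val L \<sigma> (Ex x \<phi>) = Some (\<exists>d. P d)"
  by (auto simp: fm_val_def kleene_all_ex_iff)

lemma fm_val_All:
  "negatable L {} \<phi> \<Longrightarrow> (\<And>d. fm_val L (\<sigma>(x := d)) \<phi> = Some (P d)) \<Longrightarrow>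
     fm_val L \<sigma> (All x \<phi>) = Some (\<forall>d. P d)"
  by (auto simp: fm_val_def kleene_all_ex_iff)

lemma fm_val_neg:
  "is_formula L \<phi> \<Longrightarrow> negatable L {} \<phi> \<Longrightarrow> fm_val L \<sigma> \<phi> = Some p \<Longrightarrow> fm_val L \<sigma> (neg \<phi>) = Some (\<not> p)"
  by (simp add: fm_val_def fval_neg)

lemma fm_val_Eq:
  "trm_val L \<sigma> s = Some a \<Longrightarrow> trm_val L \<sigma> t = Some b \<Longrightarrow> fm_val L \<sigma> (Atom True REq [s, t]) = Some (a = b)"
  by (simp add: fm_val_def trm_val_def)

lemma trm_val_Var [simp]: "trm_val L \<sigma> (Var x) = Some (\<sigma> x)"
  by (simp add: trm_val_def)

lemma D_conj:
  assumes "definable P" "definable P'"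
  shows "definable (\<lambda>\<sigma>. P \<sigma> \<and> P' \<sigma>)"
proof -
  obtain \<phi> \<psi> where "is_formula L \<phi>" "negatable L {} \<phi>" "\<And>\<sigma>. fm_val L \<sigma> \<phi> = Some (P \<sigma>)"
    "is_formula L \<psi>" "negatable L {} \<psi>" "\<And>\<sigma>. fm_val L \<sigma> \<psi> = Some (P' \<sigma>)"
    using assms unfolding definable_def by blast
  then show ?thesis
    unfolding definable_def by (intro exI[of _ "And \<phi> \<psi>"]) (simp add: fm_val_And)
qed

lemma D_not:
  assumes "definable P"
  shows "definable (\<lambda>\<sigma>. \<not> P \<sigma>)"
proof -
  obtain \<phi> where "is_formula L \<phi>" "negatable L {} \<phi>" "\<And>\<sigma>. fm_val L \<sigma> \<phi> = Some (P \<sigma>)"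
    using assms unfolding definable_def by blast
  then show ?thesis
    unfolding definable_def by (intro exI[of _ "neg \<phi>"]) (simp add: fm_val_neg wf_neg)
qed

lemma D_disj:
  assumes "definable P" "definable P'"
  shows "definable (\<lambda>\<sigma>. P \<sigma> \<or> P' \<sigma>)"
proof -
  have "definable (\<lambda>\<sigma>. \<not> (\<not> P \<sigma> \<and> \<not> P' \<sigma>))"
    by (rule D_not, rule D_conj; rule D_not, rule assms)
  then show ?thesis by simp
qed

lemma D_imp:
  assumes "definable P" "definable P'"
  shows "definable (\<lambda>\<sigma>. P \<sigma> \<longrightarrow> P' \<sigma>)"
  unfolding imp_conv_disj by (rule D_disj, rule D_not) (rule assms)+

lemma D_var_eq: "definable (\<lambda>\<sigma>. \<sigma> i = \<sigma> j)"
  unfolding definable_def by (intro exI[of _ "Atom True REq [Var i, Var j]"]) (simp add: fm_val_Eq)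

lemma D_const: "definable (\<lambda>\<sigma>. c)"
  by (cases c) (use D_var_eq[of 0 0] D_not[OF D_var_eq[of 0 0]] in simp_all)

lemma D_ex_upd:
  assumes "definable P"
  shows "definable (\<lambda>\<sigma>. \<exists>d. P (\<sigma>(x := d)))"
proof -
  obtain \<phi> where "is_formula L \<phi>" "negatable L {} \<phi>" "\<And>\<sigma>. fm_val L \<sigma> \<phi> = Some (P \<sigma>)"
    using assms unfolding definable_def by blast
  then show ?thesis
    unfolding definable_def by (intro exI[of _ "Ex x \<phi>"]) (simp add: fm_val_Ex[where P = "\<lambda>d. P (_(x := d))"])
qed

text \<open>A formula has finitely many free variables. The bound \<open>M\<close> provides fresh
  variables although \<open>definable\<close> forgets the formula.\<close>

lemma definable_finite_support:
  assumes "definable P"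
  obtains M where "\<And>\<sigma> \<tau>. (\<And>i. i < M \<Longrightarrow> \<sigma> i = \<tau> i) \<Longrightarrow> P \<sigma> = P \<tau>"
proof -
  obtain \<phi> where \<phi>: "is_formula L \<phi>" "\<And>\<sigma>. fm_val L \<sigma> \<phi> = Some (P \<sigma>)"
    using assms unfolding definable_def by blast
  obtain M where M: "\<forall>i\<in>fv_fm \<phi>. i < M"
    using finite_fv(2)[of \<phi>] finite_nat_set_iff_bounded by blast
  show ?thesis
  proof (rule that[of M])
    fix \<sigma> \<tau> :: "nat \<Rightarrow> 'a"
    assume "\<And>i. i < M \<Longrightarrow> \<sigma> i = \<tau> i"
    then have "fm_val L \<sigma> \<phi> = fm_val L \<tau> \<phi>" using M by (intro fm_val_cong[OF \<phi>(1)]) auto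
    then show "P \<sigma> = P \<tau>" by (simp add: \<phi>(2))
  qed
qed

lemma D_ren_inj:
  assumes "definable P" "inj \<pi>"
  shows "definable (\<lambda>\<sigma>. P (\<sigma> \<circ> \<pi>))"
proof -
  obtain \<phi> where "is_formula L \<phi>" "negatable L {} \<phi>" "\<And>\<sigma>. fm_val L \<sigma> \<phi> = Some (P \<sigma>)"
    using assms unfolding definable_def by blast
  then show ?thesis
    unfolding definable_def
    by (intro exI[of _ "ren_fm \<pi> \<phi>"]) (simp add: wf_ren[OF assms(2)] fm_val_def val_ren[OF assms(2)])
qed

text \<open>
  A renaming need not be injective: the variables are first moved out of the way, and then
  identified with their targets by existential quantifiers.
\<close>

lemma D_rename:
  assumes "definable P"
  shows "definable (\<lambda>\<sigma>. P (\<lambda>i. \<sigma> (\<rho> i)))"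
proof -
  obtain M where M: "\<And>\<sigma> \<tau>. (\<And>i. i < M \<Longrightarrow> \<sigma> i = \<tau> i) \<Longrightarrow> P \<sigma> = P \<tau>"
    using definable_finite_support[OF assms] by blast
  obtain K where K: "\<And>i. i < M \<Longrightarrow> \<rho> i < K"
    using finite_nat_set_iff_bounded[of "\<rho> ` {..<M}"] by auto
  \<comment> \<open>Invariant: the first \<open>m\<close> variables already read their targets, the
    others still read their shifted copies. \<open>K\<close> lies above all targets of variables
    below \<open>M\<close>, so copies and targets do not interfere.\<close>
  have "definable (\<lambda>\<sigma>. P (\<lambda>i. if i < m then \<sigma> (\<rho> i) else \<sigma> (K + i)))" if "m \<le> M" for m
    using that
  proof (induct m)
    case 0
    then show ?case using D_ren_inj[OF assms, of "\<lambda>i. K + i"] by (simp add: inj_def comp_def)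
  next
    case (Suc m)
    then have "definable (\<lambda>\<sigma>. \<exists>d. (\<sigma>(K + m := d)) (K + m) = (\<sigma>(K + m := d)) (\<rho> m) \<and>
        P (\<lambda>i. if i < m then (\<sigma>(K + m := d)) (\<rho> i) else (\<sigma>(K + m := d)) (K + i)))"
      by (intro D_conj D_var_eq D_ex_upd[of "\<lambda>\<sigma>. \<sigma> (K + m) = \<sigma> (\<rho> m) \<and>
        P (\<lambda>i. if i < m then \<sigma> (\<rho> i) else \<sigma> (K + i))"]) simp
    also have "(\<lambda>\<sigma>. \<exists>d. (\<sigma>(K + m := d)) (K + m) = (\<sigma>(K + m := d)) (\<rho> m) \<and>
        P (\<lambda>i. if i < m then (\<sigma>(K + m := d)) (\<rho> i) else (\<sigma>(K + m := d)) (K + i)))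
      = (\<lambda>\<sigma>. P (\<lambda>i. if i < Suc m then \<sigma> (\<rho> i) else \<sigma> (K + i)))"
    proof
      fix \<sigma> :: "nat \<Rightarrow> 'a"
      have ne: "\<rho> i \<noteq> K + m" if "i < M" for i using K[OF that] by simp
      have "(\<lambda>i. if i < m then (\<sigma>(K + m := \<sigma> (\<rho> m))) (\<rho> i) else (\<sigma>(K + m := \<sigma> (\<rho> m))) (K + i))
        = (\<lambda>i. if i < Suc m then \<sigma> (\<rho> i) else \<sigma> (K + i))"
        using ne Suc(2) by (auto simp: fun_eq_iff less_Suc_eq)
      then show "(\<exists>d. (\<sigma>(K + m := d)) (K + m) = (\<sigma>(K + m := d)) (\<rho> m) \<and>
        P (\<lambda>i. if i < m then (\<sigma>(K + m := d)) (\<rho> i) else (\<sigma>(K + m := d)) (K + i)))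
        = P (\<lambda>i. if i < Suc m then \<sigma> (\<rho> i) else \<sigma> (K + i))"
        using ne[of m] Suc(2) by simp
    qed
    finally show ?case .
  qed
  from this[of M] have "definable (\<lambda>\<sigma>. P (\<lambda>i. if i < M then \<sigma> (\<rho> i) else \<sigma> (K + i)))" by simp
  also have "(\<lambda>\<sigma>. P (\<lambda>i. if i < M then \<sigma> (\<rho> i) else \<sigma> (K + i))) = (\<lambda>\<sigma>. P (\<lambda>i. \<sigma> (\<rho> i)))"
    by (intro ext M) simp
  finally show ?thesis .
qed

text \<open>De Bruijn style: the body reads the witness at variable 0 and the old environment one
  place further up. In the actual formula a variable beyond the support of the body hosts the
  witness.\<close>

lemma D_ex:
  assumes "definable (\<lambda>\<sigma>. P (\<lambda>i. \<sigma> (Suc i)) (\<sigma> 0))"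
  shows "definable (\<lambda>\<sigma>. \<exists>d. P \<sigma> d)"
proof -
  define R where "R = (\<lambda>\<sigma>. P (\<lambda>i. \<sigma> (Suc i)) (\<sigma> 0))"
  obtain M where M: "\<And>\<sigma> \<tau>. (\<And>i. i < M \<Longrightarrow> \<sigma> i = \<tau> i) \<Longrightarrow> R \<sigma> = R \<tau>"
    using definable_finite_support[OF assms[folded R_def]] by blast
  let ?\<rho> = "case_nat M (\<lambda>i. i)"
  have "definable (\<lambda>\<sigma>. \<exists>d. R (\<lambda>i. (\<sigma>(M := d)) (?\<rho> i)))"
    by (rule D_ex_upd[of "\<lambda>\<sigma>. R (\<lambda>i. \<sigma> (?\<rho> i))"], rule D_rename[OF assms[folded R_def]])
  also have "(\<lambda>\<sigma>. \<exists>d. R (\<lambda>i. (\<sigma>(M := d)) (?\<rho> i))) = (\<lambda>\<sigma>. \<exists>d. P \<sigma> d)"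
  proof
    fix \<sigma> :: "nat \<Rightarrow> 'a"
    have "R (\<lambda>i. (\<sigma>(M := d)) (?\<rho> i)) = R (case_nat d \<sigma>)" for d
      by (rule M) (auto split: nat.split)
    then show "(\<exists>d. R (\<lambda>i. (\<sigma>(M := d)) (?\<rho> i))) = (\<exists>d. P \<sigma> d)" by (simp add: R_def)
  qed
  finally show ?thesis .
qed

lemma D_all:
  assumes "definable (\<lambda>\<sigma>. P (\<lambda>i. \<sigma> (Suc i)) (\<sigma> 0))"
  shows "definable (\<lambda>\<sigma>. \<forall>d. P \<sigma> d)"
proof -
  have "definable (\<lambda>\<sigma>. \<not> (\<exists>d. \<not> P \<sigma> d))"
    by (rule D_not, rule D_ex, rule D_not, rule assms)
  then show ?thesis by simp
qed

text \<open>Serves for the finitely many primitive symbols, over which \<open>L\<close> itself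
  cannot quantify.\<close>

lemma D_finite_bex:
  assumes "finite A" "\<And>x. x \<in> A \<Longrightarrow> definable (P x)"
  shows "definable (\<lambda>\<sigma>. \<exists>x\<in>A. P x \<sigma>)"
  using assms by (induct A) (auto intro: D_const D_disj)

lemma D_ex_list:
  assumes "definable (\<lambda>\<sigma>. P (map \<sigma> [0..<n]) (\<lambda>i. \<sigma> (i + n)))"
  shows "definable (\<lambda>\<sigma>. \<exists>vs. length vs = n \<and> P vs \<sigma>)"
  using assms
proof (induct n arbitrary: P)
  case 0
  then show ?case by simp
next
  case (Suc n)
  \<comment> \<open>The body expects the list at 0 to \<open>n\<close>. The induction hypothesis
    binds its last \<open>n\<close> entries at 0 to \<open>n - 1\<close>, so the head is sent to
    place \<open>n\<close> and the other entries move down by one.\<close>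
  define \<rho> where "\<rho> i = (if i = 0 then n else if i \<le> n then i - 1 else i)" for i
  have \<rho>: "map (\<lambda>i. \<sigma> (\<rho> i)) [0..<Suc n] = \<sigma> n # map \<sigma> [0..<n]"
    "(\<lambda>i. \<sigma> (\<rho> (i + Suc n))) = (\<lambda>i. \<sigma> (Suc i + n))" for \<sigma> :: "nat \<Rightarrow> 'a"
  proof -
    have "map (\<lambda>i. \<sigma> (\<rho> i)) [0..<Suc n] = \<sigma> n # map (\<lambda>i. \<sigma> (\<rho> (Suc i))) [0..<n]"
      by (subst map_upt_Suc) (simp add: \<rho>_def)
    then show "map (\<lambda>i. \<sigma> (\<rho> i)) [0..<Suc n] = \<sigma> n # map \<sigma> [0..<n]" by (simp add: \<rho>_def)
  qed (auto simp: \<rho>_def)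
  from D_rename[OF Suc(2), of \<rho>] have "definable (\<lambda>\<sigma>. P (\<sigma> n # map \<sigma> [0..<n]) (\<lambda>i. \<sigma> (Suc i + n)))"
    unfolding \<rho> by simp
  then have "definable (\<lambda>\<sigma>. \<exists>vs. length vs = n \<and> P (\<sigma> 0 # vs) (\<lambda>i. \<sigma> (Suc i)))"
    using Suc(1)[of "\<lambda>vs \<sigma>. P (\<sigma> 0 # vs) (\<lambda>i. \<sigma> (Suc i))"] by simp
  then have "definable (\<lambda>\<sigma>. \<exists>d vs. length vs = n \<and> P (d # vs) \<sigma>)"
    by (rule D_ex[of "\<lambda>\<sigma> d. \<exists>vs. length vs = n \<and> P (d # vs) \<sigma>"])
  moreover have "(\<lambda>\<sigma>. \<exists>d vs. length vs = n \<and> P (d # vs) \<sigma>) = (\<lambda>\<sigma>. \<exists>vs. length vs = Suc n \<and> P vs \<sigma>)"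
    by (auto simp: length_Suc_conv fun_eq_iff)
  ultimately show ?case by simp
qed

text \<open>\<open>expresses\<close> does not demand negatability. But a formula that is not
  negatable is never false, so a predicate expressed by it is constantly true.\<close>

lemma expresses_definable:
  assumes "expresses L k \<phi> P"
  shows "definable P"
proof (cases "negatable L {} \<phi>")
  case True
  then show ?thesis using assms by (auto simp: definable_def expresses_def)
next
  case False
  have "P \<sigma>" for \<sigma>
    using assms False negatable_if_false[of L "qlo_val L" "{}" "\<lambda>_ _. None" "\<lambda>_ _. None" \<sigma> \<phi>]
    unfolding expresses_def fm_val_def by (cases "P \<sigma>") auto
  then have "P = (\<lambda>_. True)" by auto
  then show ?thesis by (simp add: D_const)
qed

text \<open>Superfluous free variables of the defining formula are removed by quantifying over them.\<close>

lemma definable_expresses: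
  assumes "definable P" "\<And>\<sigma> \<tau>. (\<And>i. i < k \<Longrightarrow> \<sigma> i = \<tau> i) \<Longrightarrow> P \<sigma> = P \<tau>"
  obtains \<phi> where "expresses L k \<phi> P" "negatable L {} \<phi>"
proof -
  obtain \<phi> where \<phi>: "is_formula L \<phi>" "negatable L {} \<phi>" "\<And>\<sigma>. fm_val L \<sigma> \<phi> = Some (P \<sigma>)"
    using assms unfolding definable_def by blast
  have "\<exists>\<psi>. is_formula L \<psi> \<and> negatable L {} \<psi> \<and> (\<forall>\<sigma>. fm_val L \<sigma> \<psi> = Some (P \<sigma>)) \<and> fv_fm \<psi> = fv_fm \<phi> - V"
    if "finite V" "V \<inter> {..<k} = {}" for V
    using that
  proof (induct V)
    case empty
    then show ?case using \<phi> by auto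
  next
    case (insert x V)
    then obtain \<psi> where \<psi>: "is_formula L \<psi>" "negatable L {} \<psi>" "\<And>\<sigma>. fm_val L \<sigma> \<psi> = Some (P \<sigma>)"
      "fv_fm \<psi> = fv_fm \<phi> - V" by auto
    have "P (\<sigma>(x := d)) = P \<sigma>" for \<sigma> d using insert(4) by (intro assms(2)) auto
    then have "fm_val L \<sigma> (Ex x \<psi>) = Some (P \<sigma>)" for \<sigma>
      using fm_val_Ex[OF \<psi>(2), of \<sigma> x "\<lambda>_. P \<sigma>"] \<psi>(3) by simp
    then show ?case using \<psi> by (intro exI[of _ "Ex x \<psi>"]) auto
  qed
  from this[of "fv_fm \<phi> - {..<k}"] finite_fv(2)[of \<phi>]
  obtain \<psi> where "is_formula L \<psi>" "negatable L {} \<psi>" "\<forall>\<sigma>. fm_val L \<sigma> \<psi> = Some (P \<sigma>)"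
    "fv_fm \<psi> = fv_fm \<phi> - (fv_fm \<phi> - {..<k})" by blast
  then show ?thesis using that[of \<psi>] unfolding expresses_def by blast
qed

subsection \<open>Definable functions and relations\<close>

text \<open>Definability by the graph, because \<open>f\<close> need not be given by a term. The
  value is read at variable 0, ahead of the arguments.\<close>

definition fun_definable :: "((nat \<Rightarrow> 'a) \<Rightarrow> 'a) \<Rightarrow> bool" where
  "fun_definable f \<longleftrightarrow> definable (\<lambda>\<sigma>. \<sigma> 0 = f (\<lambda>i. \<sigma> (Suc i)))"

lemma DF_at: "fun_definable f \<Longrightarrow> definable (\<lambda>\<sigma>. \<sigma> k = f (\<lambda>i. \<sigma> (\<rho> i)))"
  using D_rename[of "\<lambda>\<sigma>. \<sigma> 0 = f (\<lambda>i. \<sigma> (Suc i))" "case_nat k \<rho>"] by (simp add: fun_definable_def)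

lemma DF_var: "fun_definable (\<lambda>\<sigma>. \<sigma> i)"
  unfolding fun_definable_def by (rule D_var_eq)

lemma DF_const: "definable (\<lambda>\<sigma>. \<sigma> 0 = c) \<Longrightarrow> fun_definable (\<lambda>\<sigma>. c)"
  by (simp add: fun_definable_def)

abbreviation "definable1 R \<equiv> definable (\<lambda>\<sigma>. R (\<sigma> 0))"
abbreviation "definable2 R \<equiv> definable (\<lambda>\<sigma>. R (\<sigma> 0) (\<sigma> 1))"
abbreviation "definable3 R \<equiv> definable (\<lambda>\<sigma>. R (\<sigma> 0) (\<sigma> 1) (\<sigma> 2))"
abbreviation "definable4 R \<equiv> definable (\<lambda>\<sigma>. R (\<sigma> 0) (\<sigma> 1) (\<sigma> 2) (\<sigma> 3))"
abbreviation "definable5 R \<equiv> definable (\<lambda>\<sigma>. R (\<sigma> 0) (\<sigma> 1) (\<sigma> 2) (\<sigma> 3) (\<sigma> 4))"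
abbreviation "definable6 R \<equiv> definable (\<lambda>\<sigma>. R (\<sigma> 0) (\<sigma> 1) (\<sigma> 2) (\<sigma> 3) (\<sigma> 4) (\<sigma> 5))"

text \<open>Composition through graphs: the values of \<open>fs\<close> are quantified as a block of
  leading variables, each tied to its function by the graph, and \<open>R\<close> is applied to the
  block.\<close>

lemma D_app_list:
  assumes "definable (\<lambda>\<sigma>. R (map \<sigma> [0..<length fs]))" "\<And>f. f \<in> set fs \<Longrightarrow> fun_definable f"
  shows "definable (\<lambda>\<sigma>. R (map (\<lambda>f. f \<sigma>) fs))"
proof -
  let ?n = "length fs"
  have "definable (\<lambda>\<sigma>. \<exists>k\<in>{..<?n}. \<sigma> k \<noteq> (fs ! k) (\<lambda>i. \<sigma> (i + ?n)))"
  proof (rule D_finite_bex)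
    fix k assume "k \<in> {..<?n}"
    then have "fun_definable (fs ! k)" by (simp add: assms(2))
    from DF_at[OF this] have "definable (\<lambda>\<sigma>. \<sigma> k = (fs ! k) (\<lambda>i. \<sigma> (i + ?n)))" .
    then show "definable (\<lambda>\<sigma>. \<sigma> k \<noteq> (fs ! k) (\<lambda>i. \<sigma> (i + ?n)))" by (rule D_not)
  qed simp
  then have "definable (\<lambda>\<sigma>. \<not> (\<exists>k\<in>{..<?n}. \<sigma> k \<noteq> (fs ! k) (\<lambda>i. \<sigma> (i + ?n))))" by (rule D_not)
  moreover have "\<not> (\<exists>k\<in>{..<?n}. \<sigma> k \<noteq> (fs ! k) (\<lambda>i. \<sigma> (i + ?n))) \<longleftrightarrow>
      map \<sigma> [0..<?n] = map (\<lambda>f. f (\<lambda>i. \<sigma> (i + ?n))) fs" for \<sigma> :: "nat \<Rightarrow> 'a"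
    unfolding list_eq_iff_nth_eq by auto
  ultimately have "definable (\<lambda>\<sigma>. map \<sigma> [0..<?n] = map (\<lambda>f. f (\<lambda>i. \<sigma> (i + ?n))) fs)"
    by (simp only:)
  from D_ex_list[where P = "\<lambda>vs \<sigma>. vs = map (\<lambda>f. f \<sigma>) fs \<and> R vs", OF D_conj[OF this assms(1)]]
  have "definable (\<lambda>\<sigma>. \<exists>vs. length vs = ?n \<and> vs = map (\<lambda>f. f \<sigma>) fs \<and> R vs)" .
  moreover have "(\<exists>vs. length vs = ?n \<and> vs = map (\<lambda>f. f \<sigma>) fs \<and> R vs) = R (map (\<lambda>f. f \<sigma>) fs)"
    for \<sigma> :: "nat \<Rightarrow> 'a" by auto
  ultimately show ?thesis by (simp only:)
qed

lemma D_app1: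
  "definable1 R \<Longrightarrow> fun_definable f \<Longrightarrow>
     definable (\<lambda>\<sigma>. R (f \<sigma>))"
  using D_app_list[of "\<lambda>xs. R (xs ! 0)" "[f]"]
  by (auto simp: numeral_eq_Suc)

lemma D_app2:
  "definable2 R \<Longrightarrow> fun_definable f \<Longrightarrow> fun_definable g \<Longrightarrow>
     definable (\<lambda>\<sigma>. R (f \<sigma>) (g \<sigma>))"
  using D_app_list[of "\<lambda>xs. R (xs ! 0) (xs ! 1)" "[f, g]"]
  by (auto simp: numeral_eq_Suc)

lemma D_app3:
  "definable3 R \<Longrightarrow> fun_definable f \<Longrightarrow> fun_definable g \<Longrightarrow> fun_definable h \<Longrightarrow>
     definable (\<lambda>\<sigma>. R (f \<sigma>) (g \<sigma>) (h \<sigma>))"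
  using D_app_list[of "\<lambda>xs. R (xs ! 0) (xs ! 1) (xs ! 2)" "[f, g, h]"]
  by (auto simp: numeral_eq_Suc)

lemma D_app4:
  "definable4 R \<Longrightarrow> fun_definable f \<Longrightarrow> fun_definable g \<Longrightarrow> fun_definable h \<Longrightarrow> fun_definable k \<Longrightarrow>
     definable (\<lambda>\<sigma>. R (f \<sigma>) (g \<sigma>) (h \<sigma>) (k \<sigma>))"
  using D_app_list[of "\<lambda>xs. R (xs ! 0) (xs ! 1) (xs ! 2) (xs ! 3)" "[f, g, h, k]"]
  by (auto simp: numeral_eq_Suc)

lemma D_app5:
  "definable5 R \<Longrightarrow> fun_definable f \<Longrightarrow> fun_definable g \<Longrightarrow> fun_definable h \<Longrightarrow> fun_definable k \<Longrightarrow> fun_definable l \<Longrightarrow>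
     definable (\<lambda>\<sigma>. R (f \<sigma>) (g \<sigma>) (h \<sigma>) (k \<sigma>) (l \<sigma>))"
  using D_app_list[of "\<lambda>xs. R (xs ! 0) (xs ! 1) (xs ! 2) (xs ! 3) (xs ! 4)" "[f, g, h, k, l]"]
  by (auto simp: numeral_eq_Suc)

lemma D_app6:
  "definable6 R \<Longrightarrow> fun_definable f \<Longrightarrow> fun_definable g \<Longrightarrow> fun_definable h \<Longrightarrow> fun_definable k \<Longrightarrow> fun_definable l \<Longrightarrow> fun_definable m \<Longrightarrow>
     definable (\<lambda>\<sigma>. R (f \<sigma>) (g \<sigma>) (h \<sigma>) (k \<sigma>) (l \<sigma>) (m \<sigma>))"
  using D_app_list[of "\<lambda>xs. R (xs ! 0) (xs ! 1) (xs ! 2) (xs ! 3) (xs ! 4) (xs ! 5)" "[f, g, h, k, l, m]"]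
  by (auto simp: numeral_eq_Suc)

lemma D_eq: "fun_definable f \<Longrightarrow> fun_definable g \<Longrightarrow> definable (\<lambda>\<sigma>. f \<sigma> = g \<sigma>)"
  using D_app2[of "(=)" f g] D_var_eq[of 0 1] by simp

text \<open>The existence relation need not be negatable, but it holds of every value, so its
  predicate is constantly true. All other relations are decided by their atom.\<close>

lemma D_sat:
  assumes "is_rsym L R"
  shows "definable (\<lambda>\<sigma>. sat L R (map \<sigma> [0..<arity L R]))"
proof (cases "R = RDown")
  case True
  then show ?thesis by (simp add: D_const)
next
  case False
  let ?\<phi> = "Atom True R (map Var [0..<arity L R])"
  have "fm_val L \<sigma> ?\<phi> = Some (sat L R (map \<sigma> [0..<arity L R]))" for \<sigma>
    using fails_iff[OF assms False, of "map \<sigma> [0..<arity L R]"] neg_relsI[OF assms False]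
    by (simp add: fm_val_def comp_def)
  then show ?thesis
    unfolding definable_def using assms neg_relsI[OF assms False]
    by (intro exI[of _ ?\<phi>]) simp
qed

lemma D_fun_val:
  assumes "f \<in> funs L"
  shows "definable (\<lambda>\<sigma>. \<sigma> (fun_arity L f) = fun_val L f (map \<sigma> [0..<fun_arity L f]))"
proof -
  let ?n = "fun_arity L f"
  let ?t = "Fun f (map Var [0..<?n])"
  have "trm_val L \<sigma> ?t = Some (fun_val L f (map \<sigma> [0..<?n]))" for \<sigma>
    by (simp add: trm_val_def comp_def)
  then have "fm_val L \<sigma> (Atom True REq [Var ?n, ?t]) = Some (\<sigma> ?n = fun_val L f (map \<sigma> [0..<?n]))" for \<sigma>
    by (intro fm_val_Eq) simp_all
  then show ?thesis
    unfolding definable_def using assms by (intro exI[of _ "Atom True REq [Var ?n, ?t]"]) simp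
qed

end

subsection \<open>Uniformly given families of words\<close>

text \<open>Products of constant words and \<open>n\<close>-th powers of constant words. This shape
  is what iterated formulas have in Polish notation, and it yields linear length and computability
  from \<open>n\<close> at once.\<close>

inductive uniform :: "(nat \<Rightarrow> 's list) \<Rightarrow> bool" where
  uniform_Nil: "uniform (\<lambda>n. [])"
| uniform_Cons: "uniform w \<Longrightarrow> uniform (\<lambda>n. x # w n)"
| uniform_power: "uniform w \<Longrightarrow> uniform (\<lambda>n. concat (replicate n p) @ w n)"

lemma uniform_append: "uniform u \<Longrightarrow> uniform w \<Longrightarrow> uniform (\<lambda>n. u n @ w n)"
  by (induct rule: uniform.induct) (auto intro: uniform.intros)

lemma uniform_const: "uniform (\<lambda>n. u)"
  by (induct u) (auto intro: uniform.intros)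

lemma uniform_concat:
  "(\<And>t. t \<in> set ts \<Longrightarrow> uniform (\<lambda>n. f n t)) \<Longrightarrow> uniform (\<lambda>n. concat (map (f n) ts))"
  by (induct ts) (auto intro: uniform_Nil uniform_append)

lemma uniform_power_mult:
  assumes "uniform w"
  shows "uniform (\<lambda>n. concat (replicate (c * n) p) @ w n)"
proof -
  have "concat (replicate (c * n) p) = concat (replicate n (concat (replicate c p)))" for n
    by (induct n) (simp_all add: replicate_add)
  then show ?thesis using uniform_power[OF assms] by simp
qed

lemma uniform_length: "uniform w \<Longrightarrow> \<exists>a b. \<forall>n. length (w n) \<le> a + b * n"
proof (induct rule: uniform.induct)
  case (uniform_Cons w x)
  then obtain a b where "\<forall>n. length (w n) \<le> a + b * n" by blast
  then show ?case by (intro exI[of _ "Suc a"] exI[of _ b]) simp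
next
  case (uniform_power w p)
  then obtain a b where ab: "\<forall>n. length (w n) \<le> a + b * n" by blast
  have "length (concat (replicate n p)) = length p * n" for n by (induct n) simp_all
  with ab show ?case by (intro exI[of _ a] exI[of _ "length p + b"]) (simp add: algebra_simps)
qed auto

lemma uniform_bigo:
  assumes "uniform w"
  shows "(\<lambda>n. real (length (w n))) \<in> O(\<lambda>n. real n)"
proof -
  obtain a b where ab: "\<And>n. length (w n) \<le> a + b * n" using uniform_length[OF assms] by blast
  \<comment> \<open>The additive constant is absorbed from \<open>n = 1\<close> on, which is enough
    for an asymptotic bound.\<close>
  have "length (w n) \<le> (a + b) * n" if "n \<ge> 1" for n
  proof -
    have "a * 1 \<le> a * n" using that by (rule mult_le_mono2)
    with ab[of n] show ?thesis unfolding distrib_right by linarith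
  qed
  then have "\<forall>n\<ge>1. norm (real (length (w n))) \<le> real (a + b) * norm (real n)"
    by (metis norm_of_nat of_nat_le_iff of_nat_mult)
  then show ?thesis by (intro bigoI[of _ "real (a + b)"]) (auto simp: eventually_at_top_linorder)
qed

section \<open>Recursiveness of uniformly given words\<close>

lemma recursive_comp1: "recursive g \<Longrightarrow> recursive f \<Longrightarrow> recursive (\<lambda>xs. g [f xs])"
  using rec_comp[of g "[f]"] by simp

lemma recursive_comp2: "recursive g \<Longrightarrow> recursive f \<Longrightarrow> recursive f' \<Longrightarrow> recursive (\<lambda>xs. g [f xs, f' xs])"
  using rec_comp[of g "[f, f']"] by simp

lemma recursive_Suc: "recursive f \<Longrightarrow> recursive (\<lambda>xs. Suc (f xs))"
  using recursive_comp1[OF rec_succ] by simp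

lemma recursive_const: "recursive (\<lambda>_. k)"
  by (induct k) (auto intro: rec_zero recursive_Suc)

lemma recursive_add: "\<exists>h. recursive h \<and> (\<forall>x y. h [x, y] = x + y)"
proof (intro exI conjI allI)
  show "recursive (\<lambda>xs. rec_nat ((\<lambda>xs. if 0 < length xs then xs ! 0 else 0) (tl xs))
      (\<lambda>m r. (\<lambda>xs. Suc ((\<lambda>xs. if 1 < length xs then xs ! 1 else 0) xs)) (m # r # tl xs))
      (case xs of [] \<Rightarrow> 0 | x # _ \<Rightarrow> x))"
    by (intro rec_prim recursive_Suc rec_proj)
  show "rec_nat ((\<lambda>xs. if 0 < length xs then xs ! 0 else 0) (tl [x, y]))
      (\<lambda>m r. (\<lambda>xs. Suc ((\<lambda>xs. if 1 < length xs then xs ! 1 else 0) xs)) (m # r # tl [x, y]))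
      (case [x, y] of [] \<Rightarrow> 0 | x # _ \<Rightarrow> x) = x + y" for x y :: nat
    by (induct x) simp_all
qed

lemma recursive_triangle: "\<exists>h. recursive h \<and> (\<forall>x. h [x] = triangle x)"
proof -
  obtain a where a: "recursive a" "\<And>x y. a [x, y] = x + y" using recursive_add by blast
  let ?p = "\<lambda>i xs. if i < length xs then xs ! i else (0 :: nat)"
  let ?g = "\<lambda>xs. a [?p 1 xs, Suc (?p 0 xs)]"
  have "recursive (\<lambda>xs. rec_nat ((\<lambda>_. 0) (tl xs)) (\<lambda>m r. ?g (m # r # tl xs)) (case xs of [] \<Rightarrow> 0 | x # _ \<Rightarrow> x))"
    by (intro rec_prim[of "\<lambda>_. 0" ?g] rec_zero recursive_comp2[OF a(1)] recursive_Suc rec_proj)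
  moreover have "rec_nat 0 (\<lambda>m r. ?g (m # r # tl [x])) x = triangle x" for x
    by (induct x) (simp_all add: a(2))
  ultimately show ?thesis by (intro exI conjI) auto
qed

text \<open>By the Cantor formula \<open>prod_encode (x, y) = triangle (x + y) + x\<close>.\<close>

lemma recursive_prod_encode: "\<exists>h. recursive h \<and> (\<forall>x y. h [x, y] = prod_encode (x, y))"
proof -
  obtain a where a: "recursive a" "\<And>x y. a [x, y] = x + y" using recursive_add by blast
  obtain t where t: "recursive t" "\<And>x. t [x] = triangle x" using recursive_triangle by blast
  let ?p = "\<lambda>xs. if 0 < length xs then xs ! 0 else (0 :: nat)"
  have "recursive (\<lambda>xs. a [t [a xs], ?p xs])"
    by (intro recursive_comp2[OF a(1)] recursive_comp1[OF t(1)] a(1) rec_proj)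
  then show ?thesis by (intro exI conjI) (assumption, simp add: a t prod_encode_def)
qed

text \<open>Concatenation on the left as a function of the code of the remaining word, so that codes
  are built without ever being decoded.\<close>

definition prepend :: "nat list \<Rightarrow> nat \<Rightarrow> nat" where
  "prepend u c = foldr (\<lambda>x c. Suc (prod_encode (x, c))) u c"

lemma list_encode_append: "list_encode (u @ w) = prepend u (list_encode w)"
  by (induct u) (simp_all add: prepend_def)

lemma recursive_prepend: "\<exists>h. recursive h \<and> (\<forall>c. h [c] = prepend u c)"
proof (induct u)
  case Nil
  show ?case using rec_proj[of 0] by (intro exI[of _ "\<lambda>xs. if 0 < length xs then xs ! 0 else 0"]) (simp add: prepend_def)
next
  case (Cons x u)
  then obtain h where h: "recursive h" "\<And>c. h [c] = prepend u c" by blast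
  obtain e where e: "recursive e" "\<And>x y. e [x, y] = prod_encode (x, y)" using recursive_prod_encode by blast
  have "recursive (\<lambda>xs. Suc (e [x, h xs]))"
    by (intro recursive_Suc recursive_comp2[OF e(1)] recursive_const h(1))
  then show ?case by (intro exI conjI) (assumption, simp add: h e prepend_def)
qed

lemma recursive_prepend_power: "\<exists>h. recursive h \<and> (\<forall>n c. h [n, c] = (prepend u ^^ n) c)"
proof -
  obtain h where h: "recursive h" "\<And>c. h [c] = prepend u c" using recursive_prepend by blast
  let ?p = "\<lambda>i xs. if i < length xs then xs ! i else (0 :: nat)"
  let ?g = "\<lambda>xs. h [?p 1 xs]"
  have "recursive (\<lambda>xs. rec_nat (?p 0 (tl xs)) (\<lambda>m r. ?g (m # r # tl xs)) (case xs of [] \<Rightarrow> 0 | x # _ \<Rightarrow> x))"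
    by (intro rec_prim[of "?p 0" ?g] recursive_comp1[OF h(1)] rec_proj)
  moreover have "rec_nat (?p 0 (tl [n, c])) (\<lambda>m r. ?g (m # r # tl [n, c])) n = (prepend u ^^ n) c" for n c
    by (induct n) (simp_all add: h)
  ultimately show ?thesis by (intro exI conjI) auto
qed

text \<open>Follows the construction of \<open>uniform\<close>: a fixed symbol in front costs one
  pairing, a power of \<open>p\<close> is an \<open>n\<close>-fold iteration of prepending
  \<open>p\<close>, hence a primitive recursion.\<close>

lemma uniform_recursive: "uniform w \<Longrightarrow> \<exists>h. recursive h \<and> (\<forall>n. h [n] = list_encode (map c (w n)))"
proof (induct rule: uniform.induct)
  case uniform_Nil
  show ?case using rec_zero by (intro exI[of _ "\<lambda>_. 0"]) simp
next
  case (uniform_Cons w x)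
  then obtain h where h: "recursive h" "\<And>n. h [n] = list_encode (map c (w n))" by blast
  obtain e where e: "recursive e" "\<And>x y. e [x, y] = prod_encode (x, y)" using recursive_prod_encode by blast
  have "recursive (\<lambda>xs. Suc (e [c x, h xs]))"
    by (intro recursive_Suc recursive_comp2[OF e(1)] recursive_const h(1))
  then show ?case by (intro exI conjI) (assumption, simp add: h e)
next
  case (uniform_power w p)
  then obtain h where h: "recursive h" "\<And>n. h [n] = list_encode (map c (w n))" by blast
  obtain g where g: "recursive g" "\<And>n a. g [n, a] = (prepend (map c p) ^^ n) a"
    using recursive_prepend_power by blast
  have "recursive (\<lambda>xs. g [if 0 < length xs then xs ! 0 else 0, h xs])"
    by (intro recursive_comp2[OF g(1)] rec_proj h(1))
  moreover have "list_encode (map c (concat (replicate n p) @ w n)) = (prepend (map c p) ^^ n) (list_encode (map c (w n)))"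
    for n
  proof -
    have "list_encode (map c (concat (replicate m p) @ v)) = (prepend (map c p) ^^ m) (list_encode (map c v))" for m v
      by (induct m) (simp_all add: list_encode_append del: map_concat map_replicate)
    then show ?thesis .
  qed
  ultimately show ?case by (intro exI conjI) (auto simp: h g)
qed

subsection \<open>Finiteness of the set of representable numbers\<close>

fun ren_sym :: "(nat \<Rightarrow> nat) \<Rightarrow> ('f, 'r, 'q) sym \<Rightarrow> ('f, 'r, 'q) sym" where
  "ren_sym \<pi> (SVar x) = SVar (\<pi> x)"
| "ren_sym \<pi> s = s"

lemma symbols_ren:
  fixes t :: "('f, 'r, 'q) trm" and \<phi> :: "('f, 'r, 'q) fm"
  shows "symbols (ren_trm \<pi> t) = map (ren_sym \<pi>) (symbols t)"
    and "symbols_fm (ren_fm \<pi> \<phi>) = map (ren_sym \<pi>) (symbols_fm \<phi>)"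
  by (induct t and \<phi> rule: trm_fm_induct) (simp_all add: map_concat comp_def cong: map_cong)

lemma fv_symbols:
  fixes t :: "('f, 'r, 'q) trm" and \<phi> :: "('f, 'r, 'q) fm"
  shows "x \<in> fv_trm t \<Longrightarrow> SVar x \<in> set (symbols t)"
    and "x \<in> fv_fm \<phi> \<Longrightarrow> SVar x \<in> set (symbols_fm \<phi>)"
proof (induct t and \<phi> rule: trm_fm_induct)
  case (Qlo q xs ts \<phi>s)
  then show ?case by (simp; blast)
qed auto

lemma SVar_ren: "SVar x \<in> ren_sym \<pi> ` S \<longleftrightarrow> (\<exists>y. SVar y \<in> S \<and> x = \<pi> y)"
proof
  assume "SVar x \<in> ren_sym \<pi> ` S"
  then obtain s where "s \<in> S" "SVar x = ren_sym \<pi> s" by auto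
  then show "\<exists>y. SVar y \<in> S \<and> x = \<pi> y" by (cases s) auto
qed force

lemma symbols_nonempty: "symbols t \<noteq> []" "symbols_fm \<phi> \<noteq> []"
  by (cases t; simp) (cases \<phi>; simp)

text \<open>Every argument contributes at least one symbol, so a bound on the length also bounds the
  number of arguments.\<close>

lemma length_le_length_concat: "(\<And>t. t \<in> set ts \<Longrightarrow> f t \<noteq> []) \<Longrightarrow> length ts \<le> length (concat (map f ts))"
proof (induct ts)
  case (Cons t ts)
  then have "length (f t) \<ge> 1" by (simp add: Suc_le_eq)
  with Cons show ?case by fastforce
qed simp

lemma length_le_concat: "t \<in> set ts \<Longrightarrow> length (f t) \<le> length (concat (map f ts))"
  by (induct ts) auto

text \<open>Terms and formulas are counted together, since formulas occur inside QLO terms. With a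
  finite stock \<open>X\<close> of variables every symbol comes from a finite set, and the arguments
  are covered by the induction hypothesis.\<close>

lemma finite_bounded_terms:
  fixes L :: "('a, 'f, 'r, 'q) pt_lang" and X :: "nat set"
  assumes "pt_language L" "finite X"
  shows "finite {t. is_term L t \<and> length (symbols t) \<le> k \<and> (\<forall>x. SVar x \<in> set (symbols t) \<longrightarrow> x \<in> X)} \<and>
    finite {\<phi>. is_formula L \<phi> \<and> length (symbols_fm \<phi>) \<le> k \<and> (\<forall>x. SVar x \<in> set (symbols_fm \<phi>) \<longrightarrow> x \<in> X)}"
proof (induct k)
  case 0
  then show ?case by (simp add: symbols_nonempty)
next
  case (Suc k)
  define A where "A = {t. is_term L t \<and> length (symbols t) \<le> k \<and> (\<forall>x. SVar x \<in> set (symbols t) \<longrightarrow> x \<in> X)}"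
  define B where "B = {\<phi>. is_formula L \<phi> \<and> length (symbols_fm \<phi>) \<le> k \<and> (\<forall>x. SVar x \<in> set (symbols_fm \<phi>) \<longrightarrow> x \<in> X)}"
  define As where "As = {ts. set ts \<subseteq> A \<and> length ts \<le> k}"
  define Bs where "Bs = {\<phi>s. set \<phi>s \<subseteq> B \<and> length \<phi>s \<le> k}"
  define Xs where "Xs = {xs. set xs \<subseteq> X \<and> length xs \<le> k}"
  define R where "R = insert REq (insert RDown (RPrim ` rels L))"
  have fin: "finite A" "finite B" "finite (funs L)" "finite (qlos L)" "finite R"
    using Suc assms(1) by (simp_all add: A_def B_def R_def pt_language_def)
  then have fin': "finite As" "finite Bs" "finite Xs"
    unfolding As_def Bs_def Xs_def using assms(2) by (simp_all add: finite_lists_length_le)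
  have As: "ts \<in> As" if "\<forall>t\<in>set ts. is_term L t" "length (concat (map symbols ts)) \<le> k"
    "\<forall>x. SVar x \<in> set (concat (map symbols ts)) \<longrightarrow> x \<in> X" for ts
  proof -
    have "length ts \<le> k"
      using length_le_length_concat[of ts symbols] symbols_nonempty(1) that(2) by (metis le_trans)
    moreover have "length (symbols t) \<le> k" if "t \<in> set ts" for t
      using length_le_concat[OF that, of symbols] \<open>length (concat (map symbols ts)) \<le> k\<close> by simp
    moreover have "\<forall>x. SVar x \<in> set (symbols t) \<longrightarrow> x \<in> X" if "t \<in> set ts" for t
      using that \<open>\<forall>x. SVar x \<in> set (concat (map symbols ts)) \<longrightarrow> x \<in> X\<close> by auto
    ultimately show ?thesis using that(1) unfolding As_def A_def by blast
  qed
  have Bs: "\<phi>s \<in> Bs" if "\<forall>\<phi>\<in>set \<phi>s. is_formula L \<phi>" "length (concat (map symbols_fm \<phi>s)) \<le> k"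
    "\<forall>x. SVar x \<in> set (concat (map symbols_fm \<phi>s)) \<longrightarrow> x \<in> X" for \<phi>s
  proof -
    have "length \<phi>s \<le> k"
      using length_le_length_concat[of \<phi>s symbols_fm] symbols_nonempty(2) that(2) by (metis le_trans)
    moreover have "length (symbols_fm \<phi>) \<le> k" if "\<phi> \<in> set \<phi>s" for \<phi>
      using length_le_concat[OF that, of symbols_fm] \<open>length (concat (map symbols_fm \<phi>s)) \<le> k\<close> by simp
    moreover have "\<forall>x. SVar x \<in> set (symbols_fm \<phi>) \<longrightarrow> x \<in> X" if "\<phi> \<in> set \<phi>s" for \<phi>
      using that \<open>\<forall>x. SVar x \<in> set (concat (map symbols_fm \<phi>s)) \<longrightarrow> x \<in> X\<close> by auto
    ultimately show ?thesis using that(1) unfolding Bs_def B_def by blast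
  qed
  \<comment> \<open>Head symbols applied to arguments of smaller length. Holes are missing because
    proper terms and formulas have none.\<close>
  let ?A = "Var ` X \<union> (\<lambda>(f, ts). Fun f ts) ` (funs L \<times> As) \<union>
    (\<lambda>(q, xs, ts, \<phi>s). Qlo q xs ts \<phi>s) ` (qlos L \<times> Xs \<times> As \<times> Bs)"
  let ?B = "(\<lambda>(b, R, ts). Atom b R ts) ` (UNIV \<times> R \<times> As) \<union>
    (\<lambda>(\<phi>, \<psi>). And \<phi> \<psi>) ` (B \<times> B) \<union> (\<lambda>(\<phi>, \<psi>). Or \<phi> \<psi>) ` (B \<times> B) \<union>
    (\<lambda>(x, t, \<phi>). BAll x t \<phi>) ` (X \<times> A \<times> B) \<union> (\<lambda>(x, t, \<phi>). BEx x t \<phi>) ` (X \<times> A \<times> B) \<union>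
    (\<lambda>(x, \<phi>). All x \<phi>) ` (X \<times> B) \<union> (\<lambda>(x, \<phi>). Ex x \<phi>) ` (X \<times> B)"
  have "t \<in> ?A" if "is_term L t" "length (symbols t) \<le> Suc k" "\<forall>x. SVar x \<in> set (symbols t) \<longrightarrow> x \<in> X" for t
  proof (cases t)
    case (Var x)
    then show ?thesis using that by simp
  next
    case (Fun f ts)
    have "ts \<in> As" by (rule As) (use that Fun in simp_all)
    then have "(\<lambda>(f, ts). Fun f ts) (f, ts) \<in> ?A" using that(1) Fun by - (rule UnI1, rule UnI2, rule imageI, simp)
    then show ?thesis using Fun by simp
  next
    case (Qlo q xs ts \<phi>s)
    have "ts \<in> As" by (rule As) (use that Qlo in simp_all)
    moreover have "\<phi>s \<in> Bs" by (rule Bs) (use that Qlo in simp_all)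
    moreover have "xs \<in> Xs" using that(2,3) Qlo by (auto simp: Xs_def)
    ultimately have "(\<lambda>(q, xs, ts, \<phi>s). Qlo q xs ts \<phi>s) (q, xs, ts, \<phi>s) \<in> ?A"
      using that(1) Qlo by - (rule UnI2, rule imageI, simp)
    then show ?thesis using Qlo by simp
  qed (use that in simp)
  then have "{t. is_term L t \<and> length (symbols t) \<le> Suc k \<and> (\<forall>x. SVar x \<in> set (symbols t) \<longrightarrow> x \<in> X)} \<subseteq> ?A"
    by blast
  moreover have "\<phi> \<in> ?B" if "is_formula L \<phi>" "length (symbols_fm \<phi>) \<le> Suc k"
    "\<forall>x. SVar x \<in> set (symbols_fm \<phi>) \<longrightarrow> x \<in> X" for \<phi>
  proof (cases \<phi>)
    case (Atom b r ts)
    have "ts \<in> As" by (rule As) (use that Atom in \<open>simp_all split: if_splits\<close>)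
    moreover have "r \<in> R" using that Atom by (cases r) (auto simp: R_def)
    ultimately have "(\<lambda>(b, R, ts). Atom b R ts) (b, r, ts) \<in> ?B" by - (rule UnI1, rule UnI1, rule UnI1, rule UnI1, rule UnI1, rule UnI1, rule imageI, simp)
    then show ?thesis using Atom by simp
  next
    case (FPar b j ts)
    then show ?thesis using that by simp
  next
    case (And \<phi>1 \<phi>2)
    then have "\<phi>1 \<in> B" "\<phi>2 \<in> B" using that by (auto simp: A_def B_def)
    then have "(\<lambda>(\<phi>, \<psi>). And \<phi> \<psi>) (\<phi>1, \<phi>2) \<in> ?B" by - (rule UnI1, rule UnI1, rule UnI1, rule UnI1, rule UnI1, rule UnI2, rule imageI, simp)
    then show ?thesis using And by simp
  next
    case (Or \<phi>1 \<phi>2)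
    then have "\<phi>1 \<in> B" "\<phi>2 \<in> B" using that by (auto simp: A_def B_def)
    then have "(\<lambda>(\<phi>, \<psi>). Or \<phi> \<psi>) (\<phi>1, \<phi>2) \<in> ?B" by - (rule UnI1, rule UnI1, rule UnI1, rule UnI1, rule UnI2, rule imageI, simp)
    then show ?thesis using Or by simp
  next
    case (BAll x t \<psi>)
    then have "x \<in> X" "t \<in> A" "\<psi> \<in> B" using that by (auto simp: A_def B_def)
    then have "(\<lambda>(x, t, \<phi>). BAll x t \<phi>) (x, t, \<psi>) \<in> ?B" by - (rule UnI1, rule UnI1, rule UnI1, rule UnI2, rule imageI, simp)
    then show ?thesis using BAll by simp
  next
    case (BEx x t \<psi>)
    then have "x \<in> X" "t \<in> A" "\<psi> \<in> B" using that by (auto simp: A_def B_def)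
    then have "(\<lambda>(x, t, \<phi>). BEx x t \<phi>) (x, t, \<psi>) \<in> ?B" by - (rule UnI1, rule UnI1, rule UnI2, rule imageI, simp)
    then show ?thesis using BEx by simp
  next
    case (All x \<psi>)
    then have "x \<in> X" "\<psi> \<in> B" using that by (auto simp: A_def B_def)
    then have "(\<lambda>(x, \<phi>). All x \<phi>) (x, \<psi>) \<in> ?B" by - (rule UnI1, rule UnI2, rule imageI, simp)
    then show ?thesis using All by simp
  next
    case (Ex x \<psi>)
    then have "x \<in> X" "\<psi> \<in> B" using that by (auto simp: A_def B_def)
    then have "(\<lambda>(x, \<phi>). Ex x \<phi>) (x, \<psi>) \<in> ?B" by - (rule UnI2, rule imageI, simp)
    then show ?thesis using Ex by simp
  qed
  then have "{\<phi>. is_formula L \<phi> \<and> length (symbols_fm \<phi>) \<le> Suc k \<and> (\<forall>x. SVar x \<in> set (symbols_fm \<phi>) \<longrightarrow> x \<in> X)} \<subseteq> ?B"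
    by blast
  moreover have "finite ?A" "finite ?B" using fin fin' assms(2) by simp_all
  ultimately show ?case by (intro conjI) (rule finite_subset, assumption, assumption)+
qed

text \<open>The renaming has to be injective on all variables, as the lemmas on renaming require;
  those outside \<open>V\<close> are shifted above \<open>n\<close> to keep clear of the images of
  \<open>V\<close>.\<close>

lemma ex_inj_into_lessThan:
  assumes "finite V" "card V \<le> n"
  shows "\<exists>\<pi> :: nat \<Rightarrow> nat. inj \<pi> \<and> \<pi> ` V \<subseteq> {..<n}"
proof -
  obtain f where f: "inj_on f V" "f ` V = {0..<card V}"
    using ex_bij_betw_finite_nat[OF assms(1)] by (auto simp: bij_betw_def)
  let ?\<pi> = "\<lambda>x. if x \<in> V then f x else x + n"
  have lt: "f x < n" if "x \<in> V" for x
  proof -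
    have "f x \<in> {0..<card V}" using that f(2) by blast
    then show ?thesis using assms(2) by simp
  qed
  have "inj ?\<pi>"
  proof (rule injI)
    fix x y assume "?\<pi> x = ?\<pi> y"
    then show "x = y"
      using lt[of x] lt[of y] inj_onD[OF f(1), of x y] by (cases "x \<in> V"; cases "y \<in> V") simp_all
  qed
  moreover have "?\<pi> ` V \<subseteq> {..<n}" using lt by auto
  ultimately show ?thesis by blast
qed

lemma finite_representable:
  assumes "pt_language L" "inj num"
  shows "finite (representable L num n)"
proof -
  let ?S = "{t. is_term L t \<and> length (symbols t) \<le> n \<and> (\<forall>x. SVar x \<in> set (symbols t) \<longrightarrow> x \<in> {..<n})}"
  have "num ` representable L num n \<subseteq> the ` referent L ` ?S"
  proof
    fix a assume "a \<in> num ` representable L num n"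
    then obtain t where t: "closed_term L t" "trm_length t \<le> n" "referent L t = Some a"
      by (auto simp: representable_def)
    let ?V = "{x. SVar x \<in> set (symbols t)}"
    \<comment> \<open>There are at most as many variables as symbols, hence at most
      \<open>n\<close>.\<close>
    have "?V \<subseteq> (\<lambda>s. case s of SVar x \<Rightarrow> x | _ \<Rightarrow> 0) ` set (symbols t)" by force
    then have "finite ?V" "card ?V \<le> length (symbols t)"
      by (auto intro: finite_subset order_trans[OF card_mono order_trans[OF card_image_le card_length]])
    with t(2) obtain \<pi> where \<pi>: "inj \<pi>" "\<pi> ` ?V \<subseteq> {..<n}"
      using ex_inj_into_lessThan[of ?V n] by (auto simp: trm_length_def)
    have "ren_trm \<pi> t \<in> ?S"
      using t(1,2) \<pi> wf_ren(1)[OF \<pi>(1), of L "[]" "[]" "{}" t] by (auto simp: symbols_ren trm_length_def SVar_ren)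
    \<comment> \<open>The constant environment of \<open>referent\<close> does not change under
      composition with \<open>\<pi>\<close>.\<close>
    moreover have "referent L (ren_trm \<pi> t) = Some a"
      using t(3) by (simp add: referent_def trm_val_def val_ren[OF \<pi>(1)] comp_def)
    ultimately show "a \<in> the ` referent L ` ?S" by (metis (no_types, lifting) image_eqI option.sel)
  qed
  moreover have "finite ?S" using finite_bounded_terms[OF assms(1), of "{..<n}" n] by blast
  ultimately have "finite (num ` representable L num n)" by (meson finite_imageI finite_subset)
  then show ?thesis using assms(2) by (meson finite_imageD inj_on_subset subset_UNIV)
qed

subsection \<open>Instances of schemes\<close>

text \<open>The argument of the hole is not substituted into \<open>\<chi>\<close> but equated with
  a variable \<open>z\<close> bound in front of it. So one fixed formula is inserted everywhere, and
  no capture-avoiding substitution is needed. Negated holes receive \<open>\<chi>'\<close>, intended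
  to be the dual of \<open>\<chi>\<close>.\<close>

fun fill_trm :: "nat \<Rightarrow> ('f, 'r, 'q) fm \<Rightarrow> ('f, 'r, 'q) fm \<Rightarrow> ('f, 'r, 'q) trm \<Rightarrow> ('f, 'r, 'q) trm"
  and fill_fm :: "nat \<Rightarrow> ('f, 'r, 'q) fm \<Rightarrow> ('f, 'r, 'q) fm \<Rightarrow> ('f, 'r, 'q) fm \<Rightarrow> ('f, 'r, 'q) fm" where
  "fill_trm z \<chi> \<chi>' (Var x) = Var x"
| "fill_trm z \<chi> \<chi>' (Fun f ts) = Fun f (map (fill_trm z \<chi> \<chi>') ts)"
| "fill_trm z \<chi> \<chi>' (Qlo q xs ts \<phi>s) = Qlo q xs (map (fill_trm z \<chi> \<chi>') ts) (map (fill_fm z \<chi> \<chi>') \<phi>s)"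
| "fill_trm z \<chi> \<chi>' (TPar i ts) = TPar i (map (fill_trm z \<chi> \<chi>') ts)"
| "fill_fm z \<chi> \<chi>' (Atom b R ts) = Atom b R (map (fill_trm z \<chi> \<chi>') ts)"
| "fill_fm z \<chi> \<chi>' (FPar b j ts) =
     Ex z (And (Atom True REq (Var z # map (fill_trm z \<chi> \<chi>') ts)) (if b then \<chi> else \<chi>'))"
| "fill_fm z \<chi> \<chi>' (And \<phi> \<psi>) = And (fill_fm z \<chi> \<chi>' \<phi>) (fill_fm z \<chi> \<chi>' \<psi>)"
| "fill_fm z \<chi> \<chi>' (Or \<phi> \<psi>) = Or (fill_fm z \<chi> \<chi>' \<phi>) (fill_fm z \<chi> \<chi>' \<psi>)"
| "fill_fm z \<chi> \<chi>' (BAll x t \<phi>) = BAll x (fill_trm z \<chi> \<chi>' t) (fill_fm z \<chi> \<chi>' \<phi>)"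
| "fill_fm z \<chi> \<chi>' (BEx x t \<phi>) = BEx x (fill_trm z \<chi> \<chi>' t) (fill_fm z \<chi> \<chi>' \<phi>)"
| "fill_fm z \<chi> \<chi>' (All x \<phi>) = All x (fill_fm z \<chi> \<chi>' \<phi>)"
| "fill_fm z \<chi> \<chi>' (Ex x \<phi>) = Ex x (fill_fm z \<chi> \<chi>' \<phi>)"

text \<open>The scheme is fixed while \<open>n\<close> varies, so a fixed number of copies of the
  inserted formulas is surrounded by constant words.\<close>

lemma uniform_fill:
  fixes t :: "('f, 'r, 'q) trm" and \<phi> :: "('f, 'r, 'q) fm"
  assumes "uniform (\<lambda>n. symbols_fm (\<chi> n))" "uniform (\<lambda>n. symbols_fm (\<chi>' n))"
  shows "uniform (\<lambda>n. symbols (fill_trm z (\<chi> n) (\<chi>' n) t))"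
    and "uniform (\<lambda>n. symbols_fm (fill_fm z (\<chi> n) (\<chi>' n) \<phi>))"
proof (induct t and \<phi> rule: trm_fm_induct)
  case (Qlo q xs ts \<phi>s)
  then show ?case
    by (auto simp: comp_def intro!: uniform_Cons uniform_append uniform_const uniform_concat)
next
  case (Atom b A ts)
  then show ?case
    by (auto simp: comp_def intro!: uniform_Cons uniform_append uniform_const uniform_concat)
next
  case (FPar b j ts)
  then show ?case using assms
    by (cases b) (auto simp: comp_def intro!: uniform_Cons uniform_append uniform_concat)
qed (auto simp: comp_def intro!: uniform_Cons uniform_append uniform_const uniform_concat uniform_Nil)

context classical_language
begin

text \<open>An equivalence is required, since a QLO is interpreted relative to the exact set of its
  negatable arguments. A filled hole is always negatable, and so is the hole 0 of a scheme.\<close>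

lemma negatable_fill:
  assumes "negatable L {} \<chi>" "negatable L {} \<chi>'"
  shows "wf_fm L [] [1] {0} \<phi> \<Longrightarrow> negatable L {} (fill_fm z \<chi> \<chi>' \<phi>) \<longleftrightarrow> negatable L {0} \<phi>"
  using assms by (induct \<phi> rule: fm_induct) auto

lemma wf_fill:
  assumes "negatable L {} \<chi>" "negatable L {} \<chi>'" "is_formula L \<chi>" "is_formula L \<chi>'"
  shows "wf_trm L [] [1] {0} t \<Longrightarrow> is_term L (fill_trm z \<chi> \<chi>' t)"
    and "wf_fm L [] [1] {0} \<phi> \<Longrightarrow> is_formula L (fill_fm z \<chi> \<chi>' \<phi>)"
proof (induct t and \<phi> rule: trm_fm_induct)
  case (Qlo q xs ts \<phi>s)
  then show ?case by (auto simp: negatable_fill[OF assms(1,2)])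
qed (use assms in auto)

lemma fv_fill:
  fixes t :: "('f, 'r, 'q) trm" and \<phi> :: "('f, 'r, 'q) fm"
  assumes "fv_fm \<chi> \<subseteq> {z}" "fv_fm \<chi>' \<subseteq> {z}"
  shows "fv_trm (fill_trm z \<chi> \<chi>' t) \<subseteq> fv_trm t"
    and "fv_fm (fill_fm z \<chi> \<chi>' \<phi>) \<subseteq> fv_fm \<phi>"
proof (induct t and \<phi> rule: trm_fm_induct)
  case (FPar b j ts)
  then show ?case using assms by (cases b) (simp; blast)+
qed (simp; blast)+

text \<open>The variable \<open>z\<close> has to be fresh, so that it is not captured in the arguments of the hole.\<close>

lemma val_fill:
  fixes t :: "('f, 'r, 'q) trm" and \<phi> :: "('f, 'r, 'q) fm"
  assumes "negatable L {} \<chi>" "negatable L {} \<chi>'"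
    and "\<And>\<sigma>. fm_val L \<sigma> \<chi> = Some (P (\<sigma> z))" "\<And>\<sigma>. fm_val L \<sigma> \<chi>' = Some (\<not> P (\<sigma> z))"
  shows "wf_trm L [] [1] {0} t \<Longrightarrow> SVar z \<notin> set (symbols t) \<Longrightarrow>
      trm_val L \<sigma> (fill_trm z \<chi> \<chi>' t) = scheme_trm_val L P \<sigma> t"
    and "wf_fm L [] [1] {0} \<phi> \<Longrightarrow> SVar z \<notin> set (symbols_fm \<phi>) \<Longrightarrow>
      fm_val L \<sigma> (fill_fm z \<chi> \<chi>' \<phi>) = scheme_fm_val L P \<sigma> \<phi>"
proof (induct t and \<phi> arbitrary: \<sigma> and \<sigma> rule: trm_fm_induct)
  case (Var x)
  show ?case by (simp add: scheme_trm_val_def)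
next
  case (Fun f ts)
  then have "map (trm_val L \<sigma>) (map (fill_trm z \<chi> \<chi>') ts) = map (scheme_trm_val L P \<sigma>) ts" by simp
  then show ?case by (simp only: fill_trm.simps tval.simps trm_val_def scheme_trm_val_def)
next
  case (TPar i ts)
  then show ?case by simp
next
  case (Qlo q xs ts \<phi>s)
  have "map (trm_val L \<sigma>) (map (fill_trm z \<chi> \<chi>') ts) = map (scheme_trm_val L P \<sigma>) ts" for \<sigma>
    using Qlo by simp
  moreover have "map (fm_val L \<sigma>) (map (fill_fm z \<chi> \<chi>') \<phi>s) = map (scheme_fm_val L P \<sigma>) \<phi>s" for \<sigma>
    using Qlo by simp
  moreover have "{j. j < length (map (fill_fm z \<chi> \<chi>') \<phi>s) \<and> negatable L {} (map (fill_fm z \<chi> \<chi>') \<phi>s ! j)}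
      = {j. j < length \<phi>s \<and> negatable L {0} (\<phi>s ! j)}"
    using Qlo(3) negatable_fill[OF assms(1,2)] by auto
  ultimately show ?case
    by (simp only: fill_trm.simps tval.simps trm_val_def scheme_trm_val_def fm_val_def scheme_fm_val_def)
next
  case (Atom b A ts)
  then have "map (trm_val L \<sigma>) (map (fill_trm z \<chi> \<chi>') ts) = map (scheme_trm_val L P \<sigma>) ts" by simp
  then show ?case
    by (simp only: fill_fm.simps fval.simps trm_val_def scheme_trm_val_def fm_val_def scheme_fm_val_def)
next
  case (FPar b j ts)
  then obtain s where s: "ts = [s]" "wf_trm L [] [1] {0} s" "SVar z \<notin> set (symbols s)"
    by (auto simp: length_Suc_conv split: if_splits)
  \<comment> \<open>Freshness of \<open>z\<close> enters here: binding it does not affect the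
    argument of the hole.\<close>
  have v: "trm_val L (\<sigma>(z := d)) (fill_trm z \<chi> \<chi>' s) = scheme_trm_val L P \<sigma> s" for d
  proof -
    have "trm_val L (\<sigma>(z := d)) (fill_trm z \<chi> \<chi>' s) = scheme_trm_val L P (\<sigma>(z := d)) s"
      using FPar(1) s by simp
    also have "\<dots> = scheme_trm_val L P \<sigma> s"
      unfolding scheme_trm_val_def
      using s fv_symbols(1)[of z s] by (intro val_cong(1)[OF qlo_local_qlo_val[OF pt] s(2)]) (auto simp: agree_def)
    finally show ?thesis .
  qed
  let ?\<chi> = "if b then \<chi> else \<chi>'"
  have c: "fm_val L \<sigma> ?\<chi> = Some (P (\<sigma> z) = b)" "negatable L {} ?\<chi>" for \<sigma> using assms by (cases b; simp)+
  show ?case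
  proof (cases "scheme_trm_val L P \<sigma> s")
    \<comment> \<open>An argument without referent makes every instance of the inserted existential
      indeterminate. Hence the existential is indeterminate too, exactly like the hole.\<close>
    case None
    then have "fm_val L (\<sigma>(z := d)) (And (Atom True REq [Var z, fill_trm z \<chi> \<chi>' s]) ?\<chi>) = None" for d
      using v[of d] by (simp add: fm_val_def trm_val_def kleene2_def never_false_unless_def)
    then have "fm_val L \<sigma> (fill_fm z \<chi> \<chi>' (FPar b j ts)) = None"
      by (simp add: s fm_val_def kleene_ex_def never_false_unless_def)
    moreover have "scheme_fm_val L P \<sigma> (FPar b j ts) = None"
      using None by (simp add: s scheme_fm_val_def scheme_trm_val_def)
    ultimately show ?thesis by simp
  next
    case (Some a)
    have "fm_val L (\<sigma>(z := d)) (And (Atom True REq [Var z, fill_trm z \<chi> \<chi>' s]) ?\<chi>) = Some (d = a \<and> P d = b)" for d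
      using v[of d] Some c by (intro fm_val_And fm_val_Eq) simp_all
    then have "fm_val L \<sigma> (fill_fm z \<chi> \<chi>' (FPar b j ts)) = Some (P a = b)"
      using fm_val_Ex[of "And (Atom True REq [Var z, fill_trm z \<chi> \<chi>' s]) ?\<chi>" \<sigma> z "\<lambda>d. d = a \<and> P d = b"] c(2)
      by (simp add: s)
    moreover have "scheme_fm_val L P \<sigma> (FPar b j ts) = Some (P a = b)"
      using Some by (simp add: s scheme_fm_val_def scheme_trm_val_def)
    ultimately show ?thesis by simp
  qed
next
  case (And \<phi> \<psi>)
  then show ?case using negatable_fill[OF assms(1,2)] by (simp add: fm_val_def scheme_fm_val_def)
next
  case (Or \<phi> \<psi>)
  then show ?case using negatable_fill[OF assms(1,2)] by (simp add: fm_val_def scheme_fm_val_def)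
next
  case (BAll x t \<phi>)
  then show ?case using negatable_fill[OF assms(1,2)]
    by (simp add: fm_val_def scheme_fm_val_def trm_val_def scheme_trm_val_def)
next
  case (BEx x t \<phi>)
  then show ?case using negatable_fill[OF assms(1,2)]
    by (simp add: fm_val_def scheme_fm_val_def trm_val_def scheme_trm_val_def)
next
  case (All x \<phi>)
  then show ?case using negatable_fill[OF assms(1,2)] by (simp add: fm_val_def scheme_fm_val_def)
next
  case (Ex x \<phi>)
  then show ?case using negatable_fill[OF assms(1,2)] by (simp add: fm_val_def scheme_fm_val_def)
qed

end

subsection \<open>Numbers and lists in the domain of discourse\<close>

locale list_language = classical_language L
  for L :: "('a, 'f, 'r, 'q) pt_lang" +
  fixes num :: "nat \<Rightarrow> 'a" and enc :: "'a list \<Rightarrow> 'a"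
  assumes inj_num: "inj num" and inj_enc: "inj enc"
    and D_is_number': "definable (\<lambda>\<sigma>. \<sigma> 0 \<in> range num)"
    and D_lt': "definable (\<lambda>\<sigma>. \<exists>m n. \<sigma> 0 = num m \<and> \<sigma> 1 = num n \<and> m < n)"
    and D_nth': "definable (\<lambda>\<sigma>. \<exists>as i. \<sigma> 0 = enc as \<and> \<sigma> 1 = num i \<and>
                1 \<le> i \<and> i \<le> length as \<and> \<sigma> 2 = as ! (i - 1))"
    and D_len': "definable (\<lambda>\<sigma>. \<exists>as. \<sigma> 0 = enc as \<and> \<sigma> 1 = num (length as))"
begin

lemma num_eq [simp]: "num m = num n \<longleftrightarrow> m = n"
  using inj_num by (auto dest: injD)

lemma enc_eq [simp]: "enc xs = enc ys \<longleftrightarrow> xs = ys"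
  using inj_enc by (auto dest: injD)

text \<open>The relations of this group are two-valued on the whole domain and false off the numbers
  and lists, so indeterminacy never enters the definable part.\<close>

definition "is_number x \<longleftrightarrow> (\<exists>n. x = num n)"
definition "lt_rel x y \<longleftrightarrow> (\<exists>m n. x = num m \<and> y = num n \<and> m < n)"
definition "suc_rel x y \<longleftrightarrow> (\<exists>n. x = num n \<and> y = num (Suc n))"
text \<open>The shift by \<open>Suc\<close> reconciles the positions of \<open>L\<close>, counted
  from 1, with \<open>!\<close>.\<close>

definition "nth_rel l x v \<longleftrightarrow> (\<exists>as i. l = enc as \<and> x = num (Suc i) \<and> i < length as \<and> v = as ! i)"
definition "len_rel l x \<longleftrightarrow> (\<exists>as. l = enc as \<and> x = num (length as))"
definition "cons_rel a l r \<longleftrightarrow> (\<exists>as. l = enc as \<and> r = enc (a # as))"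

lemma is_number_num [simp]: "is_number (num n)"
  by (simp add: is_number_def)

lemma lt_rel_num [simp]: "lt_rel (num m) (num n) \<longleftrightarrow> m < n"
  by (simp add: lt_rel_def)

lemma suc_rel_num [simp]: "suc_rel (num n) y \<longleftrightarrow> y = num (Suc n)"
  by (simp add: suc_rel_def)

lemma nth_rel_enc [simp]: "nth_rel (enc as) (num (Suc i)) v \<longleftrightarrow> i < length as \<and> v = as ! i"
  by (simp add: nth_rel_def)

lemma len_rel_enc [simp]: "len_rel (enc as) y \<longleftrightarrow> y = num (length as)"
  by (simp add: len_rel_def)

lemma cons_rel_enc [simp]: "cons_rel a (enc as) r \<longleftrightarrow> r = enc (a # as)"
  by (simp add: cons_rel_def)

text \<open>Closure rules by which the definability of a relation is read off from the syntax of its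
  definition.\<close>

named_theorems def_intro

lemmas [def_intro] = D_conj D_disj D_not D_imp D_ex D_all D_eq DF_var

lemma D_is_number [def_intro]: "fun_definable f \<Longrightarrow> definable (\<lambda>\<sigma>. is_number (f \<sigma>))"
  using D_is_number' D_app1[of is_number f] by (simp add: is_number_def image_iff)

lemma D_lt [def_intro]: "fun_definable f \<Longrightarrow> fun_definable g \<Longrightarrow> definable (\<lambda>\<sigma>. lt_rel (f \<sigma>) (g \<sigma>))"
  using D_lt' D_app2[of lt_rel f g] by (simp add: lt_rel_def)

lemma D_nth [def_intro]:
  "fun_definable f \<Longrightarrow> fun_definable g \<Longrightarrow> fun_definable h \<Longrightarrow> definable (\<lambda>\<sigma>. nth_rel (f \<sigma>) (g \<sigma>) (h \<sigma>))"
proof (rule D_app3[of nth_rel])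
  have "nth_rel l x v \<longleftrightarrow> (\<exists>as i. l = enc as \<and> x = num i \<and> 1 \<le> i \<and> i \<le> length as \<and> v = as ! (i - 1))"
    for l x v
  proof
    assume "nth_rel l x v"
    then obtain as i where "l = enc as" "x = num (Suc i)" "i < length as" "v = as ! i"
      by (auto simp: nth_rel_def)
    then show "\<exists>as i. l = enc as \<and> x = num i \<and> 1 \<le> i \<and> i \<le> length as \<and> v = as ! (i - 1)"
      by (intro exI[of _ as] exI[of _ "Suc i"]) simp
  next
    assume "\<exists>as i. l = enc as \<and> x = num i \<and> 1 \<le> i \<and> i \<le> length as \<and> v = as ! (i - 1)"
    then obtain as i where "l = enc as" "x = num i" "1 \<le> i" "i \<le> length as" "v = as ! (i - 1)" by auto
    then show "nth_rel l x v"
      unfolding nth_rel_def by (intro exI[of _ as] exI[of _ "i - 1"]) simp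
  qed
  then show "definable3 nth_rel" using D_nth' by simp
qed

lemma D_len [def_intro]: "fun_definable f \<Longrightarrow> fun_definable g \<Longrightarrow> definable (\<lambda>\<sigma>. len_rel (f \<sigma>) (g \<sigma>))"
  using D_len' D_app2[of len_rel f g] by (simp add: len_rel_def)

text \<open>The successor is the next element of the order. Off the numbers both sides fail because
  \<open>lt_rel\<close> does.\<close>

lemma suc_rel_iff: "suc_rel x y \<longleftrightarrow> lt_rel x y \<and> \<not> (\<exists>z. lt_rel x z \<and> lt_rel z y)"
proof
  assume "suc_rel x y"
  then show "lt_rel x y \<and> \<not> (\<exists>z. lt_rel x z \<and> lt_rel z y)"
    by (auto simp: suc_rel_def lt_rel_def)
next
  assume a: "lt_rel x y \<and> \<not> (\<exists>z. lt_rel x z \<and> lt_rel z y)"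
  then obtain m n where mn: "x = num m" "y = num n" "m < n" by (auto simp: lt_rel_def)
  with a have "\<not> lt_rel (num m) (num (Suc m)) \<or> \<not> lt_rel (num (Suc m)) (num n)" by blast
  with mn have "n = Suc m" by simp
  with mn show "suc_rel x y" by simp
qed

lemma D_suc [def_intro]: "fun_definable f \<Longrightarrow> fun_definable g \<Longrightarrow> definable (\<lambda>\<sigma>. suc_rel (f \<sigma>) (g \<sigma>))"
proof (rule D_app2[of suc_rel])
  show "definable2 suc_rel" unfolding suc_rel_iff by (intro def_intro)
qed

text \<open>Zero is the least number, and each further numeral is pinned down by the successor
  relation. These constants serve as tags in codes.\<close>

lemma DF_num [def_intro]: "fun_definable (\<lambda>\<sigma>. num k)"
proof (rule DF_const, induct k)
  case 0
  have "x = num 0 \<longleftrightarrow> is_number x \<and> (\<forall>y. \<not> lt_rel y x)" for x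
    by (auto simp: is_number_def lt_rel_def)
  moreover have "definable (\<lambda>\<sigma>. is_number (\<sigma> 0) \<and> (\<forall>y. \<not> lt_rel y (\<sigma> 0)))"
    by (intro def_intro)
  ultimately show ?case by simp
next
  case (Suc k)
  have "x = num (Suc k) \<longleftrightarrow> (\<exists>y. y = num k \<and> suc_rel y x)" for x by auto
  moreover have "definable (\<lambda>\<sigma>. \<exists>y. y = num k \<and> suc_rel y (\<sigma> 0))"
    by (intro def_intro DF_const[OF Suc])
  ultimately show ?case by simp
qed

lemma DF_enc_Nil [def_intro]: "fun_definable (\<lambda>\<sigma>. enc [])"
proof (rule DF_const)
  have "x = enc [] \<longleftrightarrow> len_rel x (num 0)" for x by (auto simp: len_rel_def)
  moreover have "definable (\<lambda>\<sigma>. len_rel (\<sigma> 0) (num 0))" by (intro def_intro)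
  ultimately show "definable (\<lambda>\<sigma>. \<sigma> 0 = enc [])" by simp
qed

text \<open>A list is determined by its length and entries: the longer one has one entry more,
  starts with \<open>a\<close>, and repeats the entries of \<open>l\<close> one position
  later.\<close>

lemma cons_rel_iff:
  "cons_rel a l r \<longleftrightarrow> (\<exists>n n'. len_rel l n \<and> suc_rel n n' \<and> len_rel r n' \<and> nth_rel r (num 1) a \<and>
     (\<forall>i i' v. nth_rel l i v \<and> suc_rel i i' \<longrightarrow> nth_rel r i' v))" (is "_ \<longleftrightarrow> ?R")
proof
  assume "cons_rel a l r"
  then show ?R by (force simp: cons_rel_def nth_rel_def)
next
  assume ?R
  then obtain as bs where *: "l = enc as" "r = enc bs" "length bs = Suc (length as)" "bs ! 0 = a"
    and n: "\<And>i i' v. nth_rel l i v \<and> suc_rel i i' \<Longrightarrow> nth_rel r i' v"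
    by (auto simp: len_rel_def nth_rel_def)
  have "bs ! Suc i = as ! i" if "i < length as" for i
    using n[of "num (Suc i)" "as ! i" "num (Suc (Suc i))"] that * by simp
  with *(3,4) have "bs = a # as" by (auto simp: list_eq_iff_nth_eq nth_Cons split: nat.split)
  with * show "cons_rel a l r" by simp
qed

lemma D_cons [def_intro]:
  "fun_definable f \<Longrightarrow> fun_definable g \<Longrightarrow> fun_definable h \<Longrightarrow> definable (\<lambda>\<sigma>. cons_rel (f \<sigma>) (g \<sigma>) (h \<sigma>))"
proof (rule D_app3[of cons_rel])
  show "definable3 cons_rel" unfolding cons_rel_iff by (intro def_intro)
qed

lemma DF_enc_Cons [def_intro]:
  assumes "fun_definable f" "fun_definable (\<lambda>\<sigma>. enc (l \<sigma>))"
  shows "fun_definable (\<lambda>\<sigma>. enc (f \<sigma> # l \<sigma>))"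
proof -
  have "definable (\<lambda>\<sigma>. \<exists>t a. t = enc (l (\<lambda>i. \<sigma> (Suc i))) \<and> a = f (\<lambda>i. \<sigma> (Suc i)) \<and> cons_rel a t (\<sigma> 0))"
    by (intro D_ex D_conj DF_at[OF assms(1)] DF_at[OF assms(2)] D_cons DF_var)
  then show ?thesis by (simp add: fun_definable_def)
qed

lemma DF_enc_map_var: "fun_definable (\<lambda>\<sigma>. enc (map (\<lambda>i. \<sigma> (g i)) is))"
  by (induct "is") (auto intro: DF_enc_Nil DF_enc_Cons DF_var)

lemma DF_enc_map_const:
  "(\<And>x. x \<in> set xs \<Longrightarrow> fun_definable (\<lambda>\<sigma>. c x)) \<Longrightarrow> fun_definable (\<lambda>\<sigma>. enc (map c xs))"
  by (induct xs) (auto intro: DF_enc_Nil DF_enc_Cons)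

subsection \<open>Positive operators with a single occurrence of their argument\<close>

text \<open>\<open>A\<close> selects the admissible choices and \<open>B\<close> the premises that a
  choice demands. Both are independent of \<open>T\<close>, whose only occurrence is the final one;
  this is what keeps iteration linear.\<close>

definition op_definable :: "((nat \<Rightarrow> 'a) \<Rightarrow> ('a \<Rightarrow> bool) \<Rightarrow> bool) \<Rightarrow> bool" where
  "op_definable G \<longleftrightarrow> (\<exists>A B. definable A \<and> definable B \<and>
     (\<forall>\<sigma> T. G \<sigma> T \<longleftrightarrow> (\<exists>c. A (case_nat c \<sigma>) \<and> (\<forall>y. B (case_nat y (case_nat c \<sigma>)) \<longrightarrow> T y))))"

named_theorems op_intro

lemma case_nat_eta:
  "case_nat (\<sigma> 0) (\<lambda>i. \<sigma> (Suc i)) = \<sigma>"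
  "case_nat (\<sigma> 0) (case_nat (\<sigma> (Suc 0)) (\<lambda>i. \<sigma> (Suc (Suc i)))) = \<sigma>"
  by (rule ext, simp split: nat.split)+

text \<open>Trades extended environments for curried predicates, the form in which the closure rules
  for quantifiers apply.\<close>

lemma op_definableE:
  assumes "op_definable G"
  obtains A B where "definable (\<lambda>\<sigma>. A (\<lambda>i. \<sigma> (Suc i)) (\<sigma> 0))"
    "definable (\<lambda>\<sigma>. B (\<lambda>i. \<sigma> (Suc (Suc i))) (\<sigma> (Suc 0)) (\<sigma> 0))"
    "\<And>\<sigma> T. G \<sigma> T \<longleftrightarrow> (\<exists>c. A \<sigma> c \<and> (\<forall>y. B \<sigma> c y \<longrightarrow> T y))"
proof -
  obtain A B where "definable A" "definable B"
    "\<And>\<sigma> T. G \<sigma> T \<longleftrightarrow> (\<exists>c. A (case_nat c \<sigma>) \<and> (\<forall>y. B (case_nat y (case_nat c \<sigma>)) \<longrightarrow> T y))"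
    using assms unfolding op_definable_def by blast
  then show ?thesis
    using that[of "\<lambda>\<sigma> c. A (case_nat c \<sigma>)" "\<lambda>\<sigma> c y. B (case_nat y (case_nat c \<sigma>))"] by (simp add: case_nat_eta)
qed

lemma op_definableI:
  assumes "definable (\<lambda>\<sigma>. A (\<lambda>i. \<sigma> (Suc i)) (\<sigma> 0))"
    "definable (\<lambda>\<sigma>. B (\<lambda>i. \<sigma> (Suc (Suc i))) (\<sigma> (Suc 0)) (\<sigma> 0))"
    "\<And>\<sigma> T. G \<sigma> T \<longleftrightarrow> (\<exists>c. A \<sigma> c \<and> (\<forall>y. B \<sigma> c y \<longrightarrow> T y))"
  shows "op_definable G"
  unfolding op_definable_def
  by (rule exI[of _ "\<lambda>\<sigma>. A (\<lambda>i. \<sigma> (Suc i)) (\<sigma> 0)"],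
      rule exI[of _ "\<lambda>\<sigma>. B (\<lambda>i. \<sigma> (Suc (Suc i))) (\<sigma> (Suc 0)) (\<sigma> 0)"]) (simp add: assms)

lemma Op_base:
  assumes "definable P"
  shows "op_definable (\<lambda>\<sigma> T. P \<sigma>)"
  by (rule op_definableI[of "\<lambda>\<sigma> c. P \<sigma>" "\<lambda>\<sigma> c y. False"]) (rule D_rename[OF assms] D_const | simp)+

lemma Op_all [op_intro]:
  assumes "definable (\<lambda>\<sigma>. R (\<lambda>i. \<sigma> (Suc i)) (\<sigma> 0))"
  shows "op_definable (\<lambda>\<sigma> T. \<forall>y. R \<sigma> y \<longrightarrow> T y)"
proof (rule op_definableI[of "\<lambda>\<sigma> c. True" "\<lambda>\<sigma> c y. R \<sigma> y"])
  show "definable (\<lambda>\<sigma>. R (\<lambda>i. \<sigma> (Suc (Suc i))) (\<sigma> 0))"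
    using D_rename[OF assms, of "case_nat 0 (\<lambda>i. Suc (Suc i))"] by simp
qed (simp_all add: D_const)

lemma Op_mem [op_intro]:
  assumes "fun_definable f"
  shows "op_definable (\<lambda>\<sigma> T. T (f \<sigma>))"
proof -
  have "definable (\<lambda>\<sigma>. \<sigma> 0 = f (\<lambda>i. \<sigma> (Suc i)))" using assms by (simp add: fun_definable_def)
  then have "op_definable (\<lambda>\<sigma> T. \<forall>y. y = f \<sigma> \<longrightarrow> T y)" by (rule Op_all)
  then show ?thesis by simp
qed

text \<open>The two choices are packed into one list of length 2 and their premises are pooled, so
  the two occurrences of \<open>T\<close> merge into one.\<close>

lemma Op_conj [op_intro]:
  assumes "op_definable G" "op_definable H"
  shows "op_definable (\<lambda>\<sigma> T. G \<sigma> T \<and> H \<sigma> T)"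
proof -
  obtain A B where G: "definable (\<lambda>\<sigma>. A (\<lambda>i. \<sigma> (Suc i)) (\<sigma> 0))"
    "definable (\<lambda>\<sigma>. B (\<lambda>i. \<sigma> (Suc (Suc i))) (\<sigma> (Suc 0)) (\<sigma> 0))"
    "\<And>\<sigma> T. G \<sigma> T \<longleftrightarrow> (\<exists>c. A \<sigma> c \<and> (\<forall>y. B \<sigma> c y \<longrightarrow> T y))"
    using op_definableE[OF assms(1)] by blast
  obtain A' B' where H: "definable (\<lambda>\<sigma>. A' (\<lambda>i. \<sigma> (Suc i)) (\<sigma> 0))"
    "definable (\<lambda>\<sigma>. B' (\<lambda>i. \<sigma> (Suc (Suc i))) (\<sigma> (Suc 0)) (\<sigma> 0))"
    "\<And>\<sigma> T. H \<sigma> T \<longleftrightarrow> (\<exists>c. A' \<sigma> c \<and> (\<forall>y. B' \<sigma> c y \<longrightarrow> T y))"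
    using op_definableE[OF assms(2)] by blast
  \<comment> \<open>The variables are moved to the places they have under the quantifiers for
    \<open>c1\<close> and \<open>c2\<close>; similarly for \<open>B\<close> below.\<close>
  have A: "definable (\<lambda>\<sigma>. A (\<lambda>i. \<sigma> (Suc (Suc (Suc i)))) (\<sigma> (Suc 0)))"
    "definable (\<lambda>\<sigma>. A' (\<lambda>i. \<sigma> (Suc (Suc (Suc i)))) (\<sigma> 0))"
    using D_rename[OF G(1), of "case_nat (Suc 0) (\<lambda>i. Suc (Suc (Suc i)))"]
      D_rename[OF H(1), of "case_nat 0 (\<lambda>i. Suc (Suc (Suc i)))"] by simp_all
  have B: "definable (\<lambda>\<sigma>. B (\<lambda>i. \<sigma> (Suc (Suc (Suc (Suc i))))) (\<sigma> (Suc 0)) (\<sigma> (Suc (Suc 0))))"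
    "definable (\<lambda>\<sigma>. B' (\<lambda>i. \<sigma> (Suc (Suc (Suc (Suc i))))) (\<sigma> 0) (\<sigma> (Suc (Suc 0))))"
    using D_rename[OF G(2), of "case_nat (Suc (Suc 0)) (case_nat (Suc 0) (\<lambda>i. Suc (Suc (Suc (Suc i)))))"]
      D_rename[OF H(2), of "case_nat (Suc (Suc 0)) (case_nat 0 (\<lambda>i. Suc (Suc (Suc (Suc i)))))"]
    by simp_all
  show ?thesis
  proof (rule op_definableI[of "\<lambda>\<sigma> c. \<exists>c1 c2. c = enc [c1, c2] \<and> A \<sigma> c1 \<and> A' \<sigma> c2"
      "\<lambda>\<sigma> c y. \<exists>c1 c2. c = enc [c1, c2] \<and> (B \<sigma> c1 y \<or> B' \<sigma> c2 y)"])
    show "definable (\<lambda>\<sigma>. \<exists>c1 c2. \<sigma> 0 = enc [c1, c2] \<and> A (\<lambda>i. \<sigma> (Suc i)) c1 \<and> A' (\<lambda>i. \<sigma> (Suc i)) c2)"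
      by (intro D_ex D_conj D_eq DF_enc_Cons DF_enc_Nil DF_var A)
    show "definable (\<lambda>\<sigma>. \<exists>c1 c2. \<sigma> (Suc 0) = enc [c1, c2] \<and>
        (B (\<lambda>i. \<sigma> (Suc (Suc i))) c1 (\<sigma> 0) \<or> B' (\<lambda>i. \<sigma> (Suc (Suc i))) c2 (\<sigma> 0)))"
      by (intro D_ex D_conj D_disj D_eq DF_enc_Cons DF_enc_Nil DF_var B)
    show "(G \<sigma> T \<and> H \<sigma> T) = (\<exists>c. (\<exists>c1 c2. c = enc [c1, c2] \<and> A \<sigma> c1 \<and> A' \<sigma> c2) \<and>
        (\<forall>y. (\<exists>c1 c2. c = enc [c1, c2] \<and> (B \<sigma> c1 y \<or> B' \<sigma> c2 y)) \<longrightarrow> T y))" for \<sigma> T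
      unfolding G(3) H(3)
    proof (rule iffI, elim conjE exE)
      fix c c' assume "A \<sigma> c" "\<forall>y. B \<sigma> c y \<longrightarrow> T y" "A' \<sigma> c'" "\<forall>y. B' \<sigma> c' y \<longrightarrow> T y"
      then show "\<exists>c. (\<exists>c1 c2. c = enc [c1, c2] \<and> A \<sigma> c1 \<and> A' \<sigma> c2) \<and>
        (\<forall>y. (\<exists>c1 c2. c = enc [c1, c2] \<and> (B \<sigma> c1 y \<or> B' \<sigma> c2 y)) \<longrightarrow> T y)"
        by (intro exI[of _ "enc [c, c']"]) auto
    qed auto
  qed
qed

text \<open>The length of the choice tells the disjuncts apart: \<open>[c]\<close> stands for the
  left one, \<open>[c, c]\<close> for the right one, and only the premises of that disjunct are
  demanded.\<close>

lemma Op_disj [op_intro]: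
  assumes "op_definable G" "op_definable H"
  shows "op_definable (\<lambda>\<sigma> T. G \<sigma> T \<or> H \<sigma> T)"
proof -
  obtain A B where G: "definable (\<lambda>\<sigma>. A (\<lambda>i. \<sigma> (Suc i)) (\<sigma> 0))"
    "definable (\<lambda>\<sigma>. B (\<lambda>i. \<sigma> (Suc (Suc i))) (\<sigma> (Suc 0)) (\<sigma> 0))"
    "\<And>\<sigma> T. G \<sigma> T \<longleftrightarrow> (\<exists>c. A \<sigma> c \<and> (\<forall>y. B \<sigma> c y \<longrightarrow> T y))"
    using op_definableE[OF assms(1)] by blast
  obtain A' B' where H: "definable (\<lambda>\<sigma>. A' (\<lambda>i. \<sigma> (Suc i)) (\<sigma> 0))"
    "definable (\<lambda>\<sigma>. B' (\<lambda>i. \<sigma> (Suc (Suc i))) (\<sigma> (Suc 0)) (\<sigma> 0))"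
    "\<And>\<sigma> T. H \<sigma> T \<longleftrightarrow> (\<exists>c. A' \<sigma> c \<and> (\<forall>y. B' \<sigma> c y \<longrightarrow> T y))"
    using op_definableE[OF assms(2)] by blast
  have A: "definable (\<lambda>\<sigma>. A (\<lambda>i. \<sigma> (Suc (Suc i))) (\<sigma> 0))"
    "definable (\<lambda>\<sigma>. A' (\<lambda>i. \<sigma> (Suc (Suc i))) (\<sigma> 0))"
    using D_rename[OF G(1), of "case_nat 0 (\<lambda>i. Suc (Suc i))"]
      D_rename[OF H(1), of "case_nat 0 (\<lambda>i. Suc (Suc i))"] by simp_all
  have B: "definable (\<lambda>\<sigma>. B (\<lambda>i. \<sigma> (Suc (Suc (Suc i)))) (\<sigma> 0) (\<sigma> (Suc 0)))"
    "definable (\<lambda>\<sigma>. B' (\<lambda>i. \<sigma> (Suc (Suc (Suc i)))) (\<sigma> 0) (\<sigma> (Suc 0)))"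
    using D_rename[OF G(2), of "case_nat (Suc 0) (case_nat 0 (\<lambda>i. Suc (Suc (Suc i))))"]
      D_rename[OF H(2), of "case_nat (Suc 0) (case_nat 0 (\<lambda>i. Suc (Suc (Suc i))))"]
    by simp_all
  show ?thesis
  proof (rule op_definableI[of "\<lambda>\<sigma> c. \<exists>c1. c = enc [c1] \<and> A \<sigma> c1 \<or> c = enc [c1, c1] \<and> A' \<sigma> c1"
      "\<lambda>\<sigma> c y. \<exists>c1. c = enc [c1] \<and> B \<sigma> c1 y \<or> c = enc [c1, c1] \<and> B' \<sigma> c1 y"])
    show "definable (\<lambda>\<sigma>. \<exists>c1. \<sigma> 0 = enc [c1] \<and> A (\<lambda>i. \<sigma> (Suc i)) c1 \<or>
        \<sigma> 0 = enc [c1, c1] \<and> A' (\<lambda>i. \<sigma> (Suc i)) c1)"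
      by (intro D_ex D_conj D_disj D_eq DF_enc_Cons DF_enc_Nil DF_var A)
    show "definable (\<lambda>\<sigma>. \<exists>c1. \<sigma> (Suc 0) = enc [c1] \<and> B (\<lambda>i. \<sigma> (Suc (Suc i))) c1 (\<sigma> 0) \<or>
        \<sigma> (Suc 0) = enc [c1, c1] \<and> B' (\<lambda>i. \<sigma> (Suc (Suc i))) c1 (\<sigma> 0))"
      by (intro D_ex D_conj D_disj D_eq DF_enc_Cons DF_enc_Nil DF_var B)
    show "(G \<sigma> T \<or> H \<sigma> T) = (\<exists>c. (\<exists>c1. c = enc [c1] \<and> A \<sigma> c1 \<or> c = enc [c1, c1] \<and> A' \<sigma> c1) \<and>
        (\<forall>y. (\<exists>c1. c = enc [c1] \<and> B \<sigma> c1 y \<or> c = enc [c1, c1] \<and> B' \<sigma> c1 y) \<longrightarrow> T y))" for \<sigma> T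
      unfolding G(3) H(3)
    proof (rule iffI, elim disjE exE conjE)
      fix c assume "A \<sigma> c" "\<forall>y. B \<sigma> c y \<longrightarrow> T y"
      then show "\<exists>c. (\<exists>c1. c = enc [c1] \<and> A \<sigma> c1 \<or> c = enc [c1, c1] \<and> A' \<sigma> c1) \<and>
        (\<forall>y. (\<exists>c1. c = enc [c1] \<and> B \<sigma> c1 y \<or> c = enc [c1, c1] \<and> B' \<sigma> c1 y) \<longrightarrow> T y)"
        by (intro exI[of _ "enc [c]"]) simp
    next
      fix c assume "A' \<sigma> c" "\<forall>y. B' \<sigma> c y \<longrightarrow> T y"
      then show "\<exists>c. (\<exists>c1. c = enc [c1] \<and> A \<sigma> c1 \<or> c = enc [c1, c1] \<and> A' \<sigma> c1) \<and>
        (\<forall>y. (\<exists>c1. c = enc [c1] \<and> B \<sigma> c1 y \<or> c = enc [c1, c1] \<and> B' \<sigma> c1 y) \<longrightarrow> T y)"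
        by (intro exI[of _ "enc [c, c]"]) simp
    qed auto
  qed
qed

text \<open>The witness becomes a component of the choice, so it is available when the premises are
  collected.\<close>

lemma Op_ex [op_intro]:
  assumes "op_definable (\<lambda>\<sigma>. G (\<lambda>i. \<sigma> (Suc i)) (\<sigma> 0))"
  shows "op_definable (\<lambda>\<sigma> T. \<exists>d. G \<sigma> d T)"
proof -
  obtain A B where G: "definable (\<lambda>\<sigma>. A (\<lambda>i. \<sigma> (Suc i)) (\<sigma> 0))"
    "definable (\<lambda>\<sigma>. B (\<lambda>i. \<sigma> (Suc (Suc i))) (\<sigma> (Suc 0)) (\<sigma> 0))"
    "\<And>\<sigma> T. G (\<lambda>i. \<sigma> (Suc i)) (\<sigma> 0) T \<longleftrightarrow> (\<exists>c. A \<sigma> c \<and> (\<forall>y. B \<sigma> c y \<longrightarrow> T y))"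
    using op_definableE[OF assms] by blast
  have G': "G \<sigma> d T \<longleftrightarrow> (\<exists>c. A (case_nat d \<sigma>) c \<and> (\<forall>y. B (case_nat d \<sigma>) c y \<longrightarrow> T y))" for \<sigma> d T
    using G(3)[of "case_nat d \<sigma>"] by simp
  have eta: "(\<lambda>i. \<sigma> (case i of 0 \<Rightarrow> j | Suc k \<Rightarrow> g k)) = case_nat (\<sigma> j) (\<lambda>i. \<sigma> (g i))"
    for \<sigma> :: "nat \<Rightarrow> 'a" and j g by (rule ext) (simp split: nat.split)
  have A: "definable (\<lambda>\<sigma>. A (case_nat (\<sigma> (Suc 0)) (\<lambda>i. \<sigma> (Suc (Suc (Suc i))))) (\<sigma> 0))"
    using D_rename[OF G(1), of "case_nat 0 (case_nat (Suc 0) (\<lambda>i. Suc (Suc (Suc i))))"]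
    by (simp add: eta)
  have B: "definable (\<lambda>\<sigma>. B (case_nat (\<sigma> (Suc 0)) (\<lambda>i. \<sigma> (Suc (Suc (Suc (Suc i)))))) (\<sigma> 0) (\<sigma> (Suc (Suc 0))))"
    using D_rename[OF G(2), of "case_nat (Suc (Suc 0)) (case_nat 0 (case_nat (Suc 0) (\<lambda>i. Suc (Suc (Suc (Suc i))))))"]
    by (simp add: eta)
  show ?thesis
  proof (rule op_definableI[of "\<lambda>\<sigma> c. \<exists>d c1. c = enc [d, c1] \<and> A (case_nat d \<sigma>) c1"
      "\<lambda>\<sigma> c y. \<exists>d c1. c = enc [d, c1] \<and> B (case_nat d \<sigma>) c1 y"])
    show "definable (\<lambda>\<sigma>. \<exists>d c1. \<sigma> 0 = enc [d, c1] \<and> A (case_nat d (\<lambda>i. \<sigma> (Suc i))) c1)"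
      by (intro D_ex D_conj D_eq DF_enc_Cons DF_enc_Nil DF_var A)
    show "definable (\<lambda>\<sigma>. \<exists>d c1. \<sigma> (Suc 0) = enc [d, c1] \<and> B (case_nat d (\<lambda>i. \<sigma> (Suc (Suc i)))) c1 (\<sigma> 0))"
      by (intro D_ex D_conj D_eq DF_enc_Cons DF_enc_Nil DF_var B)
    show "(\<exists>d. G \<sigma> d T) = (\<exists>c. (\<exists>d c1. c = enc [d, c1] \<and> A (case_nat d \<sigma>) c1) \<and>
        (\<forall>y. (\<exists>d c1. c = enc [d, c1] \<and> B (case_nat d \<sigma>) c1 y) \<longrightarrow> T y))" for \<sigma> T
      unfolding G'
    proof (rule iffI, elim conjE exE)
      fix d c assume "A (case_nat d \<sigma>) c" "\<forall>y. B (case_nat d \<sigma>) c y \<longrightarrow> T y"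
      then show "\<exists>c. (\<exists>d c1. c = enc [d, c1] \<and> A (case_nat d \<sigma>) c1) \<and>
        (\<forall>y. (\<exists>d c1. c = enc [d, c1] \<and> B (case_nat d \<sigma>) c1 y) \<longrightarrow> T y)"
        by (intro exI[of _ "enc [d, c]"]) auto
    next
      assume "\<exists>c. (\<exists>d c1. c = enc [d, c1] \<and> A (case_nat d \<sigma>) c1) \<and>
        (\<forall>y. (\<exists>d c1. c = enc [d, c1] \<and> B (case_nat d \<sigma>) c1 y) \<longrightarrow> T y)"
      then obtain d c1 where "A (case_nat d \<sigma>) c1" "\<forall>y. B (case_nat d \<sigma>) c1 y \<longrightarrow> T y" by auto
      then show "\<exists>d c. A (case_nat d \<sigma>) c \<and> (\<forall>y. B (case_nat d \<sigma>) c y \<longrightarrow> T y)" by blast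
    qed
  qed
qed

text \<open>
  Variable 0 is the argument, variable 1 the choice and variable 2 the premise; the formula for
  the previous iterate is used with the premise moved to variable 0.
\<close>

lemma iterate_expresses:
  assumes "op_definable (\<lambda>\<sigma> T. G T (\<sigma> 0))"
  obtains \<Psi> p w p' w' where
    "\<And>k. expresses L 1 (\<Psi> k) (\<lambda>\<sigma>. (G ^^ k) (\<lambda>_. False) (\<sigma> 0))"
    "\<And>k. negatable L {} (\<Psi> k)"
    "\<And>k. symbols_fm (\<Psi> k) = concat (replicate k p) @ w"
    "\<And>k. symbols_fm (neg (\<Psi> k)) = concat (replicate k p') @ w'"
proof -
  obtain A B where *: "definable A" "definable B"
    "\<And>\<sigma> T. G T (\<sigma> 0) \<longleftrightarrow> (\<exists>c. A (case_nat c \<sigma>) \<and> (\<forall>y. B (case_nat y (case_nat c \<sigma>)) \<longrightarrow> T y))"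
    using assms unfolding op_definable_def by blast
  \<comment> \<open>The operator depends on the argument alone, so all environment variables are
    collapsed to variable 0. Then \<open>A'\<close> needs two variables and \<open>B'\<close> three,
    however many \<open>A\<close> and \<open>B\<close> had.\<close>
  define A' where "A' \<sigma> = A (\<lambda>i. \<sigma> (case_nat 1 (\<lambda>_. 0) i))" for \<sigma> :: "nat \<Rightarrow> 'a"
  define B' where "B' \<sigma> = B (\<lambda>i. \<sigma> (case_nat 2 (case_nat 1 (\<lambda>_. 0)) i))" for \<sigma> :: "nat \<Rightarrow> 'a"
  have eta: "(\<lambda>i. \<sigma> (case i of 0 \<Rightarrow> j | Suc k \<Rightarrow> g k)) = case_nat (\<sigma> j) (\<lambda>i. \<sigma> (g i))"
    for \<sigma> :: "nat \<Rightarrow> 'a" and j g by (rule ext) (simp split: nat.split)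
  have G: "G T (\<sigma> 0) \<longleftrightarrow> (\<exists>c. A' (\<sigma>(1 := c)) \<and> (\<forall>y. \<not> B' (\<sigma>(1 := c, 2 := y)) \<or> T y))" for T \<sigma>
    using *(3)[of T "\<lambda>_. \<sigma> 0"] unfolding A'_def B'_def eta by simp
  have "definable A'" unfolding A'_def by (rule D_rename[OF *(1)])
  moreover have "A' \<sigma> = A' \<tau>" if "\<And>i. i < 2 \<Longrightarrow> \<sigma> i = \<tau> i" for \<sigma> \<tau>
    using that unfolding A'_def eta by simp
  ultimately obtain \<alpha> where \<alpha>: "expresses L 2 \<alpha> A'" "negatable L {} \<alpha>"
    using definable_expresses[of A' 2] by blast
  have "definable B'" unfolding B'_def by (rule D_rename[OF *(2)])
  moreover have "B' \<sigma> = B' \<tau>" if "\<And>i. i < 3 \<Longrightarrow> \<sigma> i = \<tau> i" for \<sigma> \<tau>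
    using that unfolding B'_def eta by simp
  ultimately obtain \<beta> where \<beta>: "expresses L 3 \<beta> B'" "negatable L {} \<beta>"
    using definable_expresses[of B' 3] by blast
  define F where "F \<psi> = Ex 1 (And \<alpha> (All 2 (Or (neg \<beta>) (Ex 0 (And (Atom True REq [Var 0, Var 2]) \<psi>)))))" for \<psi>
  define \<Psi> where "\<Psi> k = (F ^^ k) (Atom False REq [Var 0, Var 0])" for k
  \<comment> \<open>Polish notation has no closing brackets, and \<open>\<psi>\<close> stands last
    in \<open>F \<psi>\<close>. Each application of \<open>F\<close> therefore only adds this fixed
    prefix.\<close>
  define p where "p = [SEx, SVar 1, SAnd] @ symbols_fm \<alpha> @ [SAll, SVar 2, SOr] @ symbols_fm (neg \<beta>) @
    [SEx, SVar 0, SAnd, SRel REq, SVar 0, SVar 2]"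
  have \<beta>': "is_formula L (neg \<beta>)" "negatable L {} (neg \<beta>)" "fv_fm (neg \<beta>) \<subseteq> {..<3}"
    "\<And>\<sigma>. fm_val L \<sigma> (neg \<beta>) = Some (\<not> B' \<sigma>)"
    using \<beta> wf_neg[of L "[]" "[]" "{}" \<beta>] by (auto simp: expresses_def fm_val_neg)
  have F: "expresses L 1 (F \<psi>) (\<lambda>\<sigma>. G T (\<sigma> 0)) \<and> negatable L {} (F \<psi>)"
    if \<psi>: "expresses L 1 \<psi> (\<lambda>\<sigma>. T (\<sigma> 0))" "negatable L {} \<psi>" for \<psi> T
  proof -
    have 1: "fm_val L \<sigma> (Ex 0 (And (Atom True REq [Var 0, Var 2]) \<psi>)) = Some (T (\<sigma> 2))" for \<sigma>
    proof -
      have "fm_val L (\<sigma>(0 := d)) (And (Atom True REq [Var 0, Var 2]) \<psi>) = Some (d = \<sigma> 2 \<and> T d)" for d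
        using \<psi> by (intro fm_val_And) (auto simp: expresses_def fm_val_Eq)
      from fm_val_Ex[OF _ this] \<psi> show ?thesis by simp
    qed
    have 2: "fm_val L \<sigma> (Or (neg \<beta>) (Ex 0 (And (Atom True REq [Var 0, Var 2]) \<psi>))) = Some (\<not> B' \<sigma> \<or> T (\<sigma> 2))" for \<sigma>
      using \<psi> \<beta>' by (intro fm_val_Or 1) auto
    have 3: "fm_val L \<sigma> (All 2 (Or (neg \<beta>) (Ex 0 (And (Atom True REq [Var 0, Var 2]) \<psi>)))) =
        Some (\<forall>y. \<not> B' (\<sigma>(2 := y)) \<or> T y)" for \<sigma>
      using \<psi> \<beta>' by (intro fm_val_All) (auto simp: 2)
    have 4: "fm_val L \<sigma> (And \<alpha> (All 2 (Or (neg \<beta>) (Ex 0 (And (Atom True REq [Var 0, Var 2]) \<psi>))))) =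
        Some (A' \<sigma> \<and> (\<forall>y. \<not> B' (\<sigma>(2 := y)) \<or> T y))" for \<sigma>
      using \<psi> \<beta>' \<alpha> by (intro fm_val_And 3) (auto simp: expresses_def)
    have "fm_val L \<sigma> (F \<psi>) = Some (G T (\<sigma> 0))" for \<sigma>
      unfolding F_def G using \<psi> \<beta>' \<alpha> by (intro fm_val_Ex) (auto simp: 4)
    moreover have "fv_fm (F \<psi>) \<subseteq> {..<1}"
    proof -
      have "fv_fm \<alpha> \<subseteq> {0, 1}" "fv_fm \<beta> \<subseteq> {0, 1, 2}" "fv_fm \<psi> \<subseteq> {0}"
        using \<psi> \<beta>' \<alpha> by (force simp: expresses_def)+
      then show ?thesis by (auto simp: F_def)
    qed
    ultimately show ?thesis using \<psi> \<beta>' \<alpha> by (simp add: expresses_def F_def)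
  qed
  have "expresses L 1 (\<Psi> k) (\<lambda>\<sigma>. (G ^^ k) (\<lambda>_. False) (\<sigma> 0)) \<and> negatable L {} (\<Psi> k)" for k
  proof (induct k)
    case 0
    then show ?case by (simp add: \<Psi>_def expresses_def fm_val_def)
  next
    case (Suc k)
    with F[of "\<Psi> k" "(G ^^ k) (\<lambda>_. False)"] show ?case by (simp add: \<Psi>_def)
  qed
  moreover have "symbols_fm (\<Psi> k) = concat (replicate k p) @ [SNot, SRel REq, SVar 0, SVar 0]" for k
    by (induct k) (simp_all add: \<Psi>_def F_def p_def)
  \<comment> \<open>Dualizing keeps the order of the parts, so the dual is also a power of a fixed
    prefix. It cannot be skipped, as negated holes are filled with the dual formula.\<close>
  moreover define p' where "p' = [SAll, SVar 1, SOr] @ symbols_fm (neg \<alpha>) @ [SEx, SVar 2, SAnd] @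
    symbols_fm (neg (neg \<beta>)) @ [SAll, SVar 0, SOr, SNot, SRel REq, SVar 0, SVar 2]"
  have "symbols_fm (neg (\<Psi> k)) = concat (replicate k p') @ [SRel REq, SVar 0, SVar 0]" for k
    by (induct k) (simp_all add: \<Psi>_def F_def p'_def)
  ultimately show ?thesis using that by blast
qed

end

subsection \<open>Codes of terms and formulas\<close>

text \<open>These numberings serve the codes inside the domain of \<open>L\<close>. They are chosen
  once and are unrelated to the arbitrary numberings in \<open>explicit\<close>.\<close>

locale coded_language = list_language L num enc
  for L :: "('a, 'f, 'r, 'q) pt_lang" and num :: "nat \<Rightarrow> 'a" and enc :: "'a list \<Rightarrow> 'a" +
  fixes cf :: "'f \<Rightarrow> nat" and cr :: "'r \<Rightarrow> nat" and cq :: "'q \<Rightarrow> nat"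
  assumes inj_cf: "inj_on cf (funs L)" and inj_cr: "inj_on cr (rels L)" and inj_cq: "inj_on cq (qlos L)"
begin

definition bool_code :: "bool \<Rightarrow> 'a" where
  "bool_code b = num (if b then 1 else 0)"

lemma bool_code_simps [simp]:
  "bool_code b = bool_code c \<longleftrightarrow> b = c"
  "bool_code b = num 0 \<longleftrightarrow> \<not> b" "bool_code b = num (Suc 0) \<longleftrightarrow> b" "bool_code b \<noteq> num 2"
  "num 0 = bool_code b \<longleftrightarrow> \<not> b" "num (Suc 0) = bool_code b \<longleftrightarrow> b" "num 2 \<noteq> bool_code b"
  by (auto simp: bool_code_def)

text \<open>Tags 0 to 3 mark terms and 4 to 8 formulas. Dual connectives share a tag and differ in a
  Boolean, so one rule can treat both. Holes are numbered from 1 because they index lists of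
  \<open>L\<close>.\<close>

fun trm_code :: "('f, 'r, 'q) trm \<Rightarrow> 'a" and fm_code :: "('f, 'r, 'q) fm \<Rightarrow> 'a" where
  "trm_code (Var x) = enc [num 0, num x]"
| "trm_code (Fun f ts) = enc [num (Suc 0), num (cf f), enc (map trm_code ts)]"
| "trm_code (Qlo q xs ts \<phi>s) =
     enc [num 2, num (cq q), enc (map num xs), enc (map trm_code ts), enc (map fm_code \<phi>s)]"
| "trm_code (TPar i ts) = enc [num 3, num (Suc i), enc (map trm_code ts)]"
| "fm_code (Atom b R ts) = enc [num 4, bool_code b, num (rsym_code cr R), enc (map trm_code ts)]"
| "fm_code (FPar b j ts) = enc [num 5, bool_code b, num (Suc j), enc (map trm_code ts)]"
| "fm_code (And \<phi> \<psi>) = enc [num 6, bool_code True, fm_code \<phi>, fm_code \<psi>]"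
| "fm_code (Or \<phi> \<psi>) = enc [num 6, bool_code False, fm_code \<phi>, fm_code \<psi>]"
| "fm_code (BAll x t \<phi>) = enc [num 7, bool_code True, num x, trm_code t, fm_code \<phi>]"
| "fm_code (BEx x t \<phi>) = enc [num 7, bool_code False, num x, trm_code t, fm_code \<phi>]"
| "fm_code (All x \<phi>) = enc [num 8, bool_code True, num x, fm_code \<phi>]"
| "fm_code (Ex x \<phi>) = enc [num 8, bool_code False, num x, fm_code \<phi>]"

lemma DF_bool_code: "fun_definable (\<lambda>\<sigma>. bool_code b)"
  unfolding bool_code_def by (rule DF_num)

text \<open>Makes every fixed reduct available as a constant in the rule for QLOs.\<close>

lemma DF_code: "fun_definable (\<lambda>\<sigma>. trm_code t)" "fun_definable (\<lambda>\<sigma>. fm_code \<phi>)"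
  by (induct t and \<phi> rule: trm_fm_induct)
     (simp_all del: One_nat_def, (intro def_intro DF_enc_map_const DF_bool_code; simp add: DF_num)+)

abbreviation "rsyms \<equiv> {R. is_rsym L R}"

lemma finite_symbols: "finite (funs L)" "finite (qlos L)" "finite (rels L)"
  "q \<in> qlos L \<Longrightarrow> finite (qlo_neg L q)"
  using pt finite_subset[of "qlo_neg L q" "{..<qlo_forms L q}"] by (simp_all add: pt_language_def)

lemma finite_rsyms: "finite rsyms"
proof -
  have "rsyms \<subseteq> insert REq (insert RDown (RPrim ` rels L))"
  proof
    fix R assume "R \<in> rsyms"
    then show "R \<in> insert REq (insert RDown (RPrim ` rels L))" by (cases R) auto
  qed
  then show ?thesis by (rule finite_subset) (simp add: finite_symbols)
qed

lemma rsym_code_inj: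
  assumes "is_rsym L R" "is_rsym L R'" "rsym_code cr R = rsym_code cr R'"
  shows "R = R'"
  using assms inj_onD[OF inj_cr] by (cases R; cases R') auto

text \<open>
  An environment is coded as a list of blocks \<open>(xs, ws)\<close>, each assigning the values \<open>ws\<close> to the
  variables \<open>xs\<close>; earlier blocks take precedence.
\<close>

definition "lookup_rel e x v \<longleftrightarrow>
  (\<exists>i xs ws. nth_rel e i (enc [xs, ws]) \<and>
     (\<exists>p. nth_rel xs p x \<and> nth_rel ws p v \<and> (\<forall>p'. lt_rel p' p \<longrightarrow> \<not> nth_rel xs p' x)) \<and>
     (\<forall>j xs' ws'. lt_rel j i \<and> nth_rel e j (enc [xs', ws']) \<longrightarrow>
        \<not> (\<exists>p v'. nth_rel xs' p x \<and> nth_rel ws' p v')))"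

section \<open>Definable relations on codes that occur in the rules of evaluation\<close>

definition "flip_rel b v \<longleftrightarrow> b = num 0 \<and> v = num (Suc 0) \<or> b = num (Suc 0) \<and> v = num 0"
definition "bool_rel b \<longleftrightarrow> b = num 0 \<or> b = num (Suc 0)"
definition "sign_rel b v' v \<longleftrightarrow> b = num (Suc 0) \<and> v = v' \<and> bool_rel v \<or> b = num 0 \<and> flip_rel v' v"
definition "app_rel f w v \<longleftrightarrow> (\<exists>g\<in>funs L. f = num (cf g) \<and>
  (\<exists>vs. length vs = fun_arity L g \<and> w = enc vs \<and> v = fun_val L g vs))"
definition "reduct_rel q \<theta> \<longleftrightarrow> (\<exists>q'\<in>qlos L. q = num (cq q') \<and> \<theta> = fm_code (reduct L q'))"
text \<open>Failure is rendered as absence of satisfaction, which is definable and which strong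
  negatability permits. \<open>RDown\<close> is exempt, being never false.\<close>

definition "atom_rel b R w v \<longleftrightarrow> (\<exists>R'\<in>rsyms. R = num (rsym_code cr R') \<and>
  (\<exists>vs. length vs = arity L R' \<and> w = enc vs \<and>
     (sat L R' vs \<and> v = b \<and> bool_rel b \<or> R' \<noteq> RDown \<and> \<not> sat L R' vs \<and> flip_rel b v)))"
text \<open>The condition on the arity keeps the relation definable in a language without bounded
  quantifiers, where \<open>less_rel\<close> is unrestricted.\<close>

definition "below_rel d u \<longleftrightarrow> (\<exists>r\<in>rels L. (less_rel L = Some r \<and> rel_arity L r = 2) \<and> rel_sat L r [d, u])"
text \<open>Binary connectives are treated as quantifiers over their two components. The bound
  \<open>u\<close> matters only for bounded quantifiers.\<close>

definition "inst_rel e \<phi> u e' \<phi>' \<longleftrightarrow>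
  (\<exists>b \<psi> \<psi>'. \<phi> = enc [num 6, b, \<psi>, \<psi>'] \<and> e' = e \<and> (\<phi>' = \<psi> \<or> \<phi>' = \<psi>')) \<or>
  (\<exists>b x t d. \<phi> = enc [num 7, b, x, t, \<phi>'] \<and> below_rel d u \<and> cons_rel (enc [enc [x], enc [d]]) e e') \<or>
  (\<exists>b x d. \<phi> = enc [num 8, b, x, \<phi>'] \<and> cons_rel (enc [enc [x], enc [d]]) e e')"
definition "pol_rel \<phi> b \<longleftrightarrow> (\<exists>\<psi> \<psi>'. \<phi> = enc [num 6, b, \<psi>, \<psi>']) \<or>
  (\<exists>x t \<psi>. \<phi> = enc [num 7, b, x, t, \<psi>]) \<or> (\<exists>x \<psi>. \<phi> = enc [num 8, b, x, \<psi>])"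
definition "neg_atom_rel b R \<longleftrightarrow> b = num 0 \<or> (\<exists>R'\<in>rsyms. R = num (rsym_code cr R') \<and> R' \<in> neg_rels L)"
definition "bq_rel b \<longleftrightarrow> b = num (Suc 0) \<and> has_ball L \<or> b = num 0 \<and> has_bex L"
definition "bq_neg_rel b \<longleftrightarrow> b = num (Suc 0) \<and> has_bex L \<or> b = num 0 \<and> has_ball L"
definition "add_rel k x y \<longleftrightarrow> (\<exists>n. x = num n \<and> y = num (n + k))"
definition "scope_rel x B \<longleftrightarrow> (\<exists>i xs p. nth_rel B i xs \<and> nth_rel xs p x)"
definition "fun_wf_rel f ts \<longleftrightarrow> (\<exists>g\<in>funs L. f = num (cf g) \<and> len_rel ts (num (fun_arity L g)))"
text \<open>Distinctness of the bound variables is expressed by positions. The last conjunct charges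
  one symbol for the QLO and one for each variable it binds.\<close>

definition "qlo_wf_rel q xs ts \<phi>s l l' \<longleftrightarrow> (\<exists>q'\<in>qlos L. q = num (cq q') \<and>
  len_rel xs (num (qlo_vars L q')) \<and> (\<forall>p x. nth_rel xs p x \<longrightarrow> is_number x) \<and>
  (\<forall>p p' x. nth_rel xs p x \<and> nth_rel xs p' x \<longrightarrow> p = p') \<and>
  len_rel ts (num (qlo_terms L q')) \<and> len_rel \<phi>s (num (qlo_forms L q')) \<and>
  add_rel (Suc (qlo_vars L q')) l l')"
definition "atom_wf_rel b R ts l l' \<longleftrightarrow> (\<exists>R'\<in>rsyms. R = num (rsym_code cr R') \<and>
  len_rel ts (num (arity L R')) \<and>
  (b = num (Suc 0) \<and> add_rel (Suc 0) l l' \<or> b = num 0 \<and> R' \<in> neg_rels L \<and> add_rel 2 l l'))"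

lemma D_lookup [def_intro]:
  "fun_definable f \<Longrightarrow> fun_definable g \<Longrightarrow> fun_definable h \<Longrightarrow> definable (\<lambda>\<sigma>. lookup_rel (f \<sigma>) (g \<sigma>) (h \<sigma>))"
proof (rule D_app3[of lookup_rel])
  show "definable3 lookup_rel" unfolding lookup_rel_def by (intro def_intro)
qed

lemma D_flip [def_intro]:
  "fun_definable f \<Longrightarrow> fun_definable g \<Longrightarrow> definable (\<lambda>\<sigma>. flip_rel (f \<sigma>) (g \<sigma>))"
  unfolding flip_rel_def by (intro def_intro)

lemma D_bool [def_intro]: "fun_definable f \<Longrightarrow> definable (\<lambda>\<sigma>. bool_rel (f \<sigma>))"
  unfolding bool_rel_def by (intro def_intro)

lemma D_sign [def_intro]:
  "fun_definable f \<Longrightarrow> fun_definable g \<Longrightarrow> fun_definable h \<Longrightarrow> definable (\<lambda>\<sigma>. sign_rel (f \<sigma>) (g \<sigma>) (h \<sigma>))"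
  unfolding sign_rel_def by (intro def_intro)

lemma D_fun [def_intro]:
  "fun_definable f \<Longrightarrow> fun_definable g \<Longrightarrow> fun_definable h \<Longrightarrow> definable (\<lambda>\<sigma>. app_rel (f \<sigma>) (g \<sigma>) (h \<sigma>))"
proof (rule D_app3[of app_rel])
  have "definable (\<lambda>\<sigma>. \<exists>vs. length vs = fun_arity L g \<and> \<sigma> 1 = enc vs \<and> \<sigma> 2 = fun_val L g vs)"
    if "g \<in> funs L" for g
  proof (rule D_ex_list[where P = "\<lambda>vs \<sigma>. \<sigma> 1 = enc vs \<and> \<sigma> 2 = fun_val L g vs"], rule D_conj)
    let ?n = "fun_arity L g"
    show "definable (\<lambda>\<sigma>. \<sigma> (1 + ?n) = enc (map \<sigma> [0..<?n]))"
      using D_eq[OF DF_var DF_enc_map_var[of "\<lambda>i. i"]] by simp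
    show "definable (\<lambda>\<sigma>. \<sigma> (2 + ?n) = fun_val L g (map \<sigma> [0..<?n]))"
    proof -
      \<comment> \<open>The arguments stay at the leading \<open>?n\<close> places, and the value is
        read at variable 2, which lies \<open>?n\<close> places further up under the quantified
        list.\<close>
      let ?\<rho> = "\<lambda>i. if i < ?n then i else 2 + ?n"
      have "map (\<lambda>i. \<sigma> (?\<rho> i)) [0..<?n] = map \<sigma> [0..<?n]" for \<sigma> :: "nat \<Rightarrow> 'a" by simp
      then show ?thesis
        using D_rename[OF D_fun_val[OF that], of ?\<rho>] by (simp only: less_irrefl if_False)
    qed
  qed
  then show "definable3 app_rel"
    unfolding app_rel_def by (intro D_finite_bex finite_symbols D_conj D_eq DF_var DF_num)
qed

lemma D_reduct [def_intro]:
  "fun_definable f \<Longrightarrow> fun_definable g \<Longrightarrow> definable (\<lambda>\<sigma>. reduct_rel (f \<sigma>) (g \<sigma>))"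
  unfolding reduct_rel_def by (intro D_finite_bex finite_symbols D_conj D_eq DF_num DF_code)

lemma D_atom [def_intro]:
  "fun_definable f \<Longrightarrow> fun_definable g \<Longrightarrow> fun_definable h \<Longrightarrow> fun_definable k \<Longrightarrow>
     definable (\<lambda>\<sigma>. atom_rel (f \<sigma>) (g \<sigma>) (h \<sigma>) (k \<sigma>))"
proof (rule D_app4[of atom_rel])
  have "definable (\<lambda>\<sigma>. \<exists>vs. length vs = arity L R \<and> \<sigma> 2 = enc vs \<and>
     (sat L R vs \<and> \<sigma> 3 = \<sigma> 0 \<and> bool_rel (\<sigma> 0) \<or> R \<noteq> RDown \<and> \<not> sat L R vs \<and> flip_rel (\<sigma> 0) (\<sigma> 3)))"
    if "R \<in> rsyms" for R
  proof (rule D_ex_list[where P = "\<lambda>vs \<sigma>. \<sigma> 2 = enc vs \<and>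
     (sat L R vs \<and> \<sigma> 3 = \<sigma> 0 \<and> bool_rel (\<sigma> 0) \<or> R \<noteq> RDown \<and> \<not> sat L R vs \<and> flip_rel (\<sigma> 0) (\<sigma> 3))"])
    let ?n = "arity L R"
    have "definable (\<lambda>\<sigma>. \<sigma> (2 + ?n) = enc (map \<sigma> [0..<?n]))"
      using D_eq[OF DF_var DF_enc_map_var[of "\<lambda>i. i"]] by simp
    moreover have "definable (\<lambda>\<sigma>. sat L R (map \<sigma> [0..<?n]))" using that by (intro D_sat) simp
    ultimately show "definable (\<lambda>\<sigma>. \<sigma> (2 + ?n) = enc (map \<sigma> [0..<?n]) \<and>
       (sat L R (map \<sigma> [0..<?n]) \<and> \<sigma> (3 + ?n) = \<sigma> (0 + ?n) \<and> bool_rel (\<sigma> (0 + ?n)) \<or>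
        R \<noteq> RDown \<and> \<not> sat L R (map \<sigma> [0..<?n]) \<and> flip_rel (\<sigma> (0 + ?n)) (\<sigma> (3 + ?n))))"
      by (intro D_conj D_disj D_not[of "\<lambda>\<sigma>. sat L R (map \<sigma> [0..<?n])"] D_var_eq D_bool D_flip DF_var D_const)
  qed
  then show "definable4 atom_rel"
    unfolding atom_rel_def by (intro D_finite_bex finite_rsyms D_conj D_eq DF_var DF_num)
qed

lemma D_below [def_intro]:
  "fun_definable f \<Longrightarrow> fun_definable g \<Longrightarrow> definable (\<lambda>\<sigma>. below_rel (f \<sigma>) (g \<sigma>))"
proof (rule D_app2[of below_rel])
  have "definable (\<lambda>\<sigma>. (less_rel L = Some r \<and> rel_arity L r = 2) \<and> rel_sat L r [\<sigma> 0, \<sigma> 1])" if "r \<in> rels L" for r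
  proof (cases "less_rel L = Some r \<and> rel_arity L r = 2")
    case True
    then show ?thesis using D_sat[of "RPrim r"] that by (simp add: upt_rec[of _ 2] upt_rec[of _ "Suc (Suc 0)"])
  next
    case False
    then have "(\<lambda>\<sigma> :: nat \<Rightarrow> 'a. (less_rel L = Some r \<and> rel_arity L r = 2) \<and> rel_sat L r [\<sigma> 0, \<sigma> 1]) = (\<lambda>\<sigma>. False)"
      by blast
    then show ?thesis by (simp only: D_const)
  qed
  then show "definable2 below_rel" unfolding below_rel_def by (intro D_finite_bex finite_symbols)
qed

lemma D_inst [def_intro]:
  "fun_definable f \<Longrightarrow> fun_definable g \<Longrightarrow> fun_definable h \<Longrightarrow> fun_definable k \<Longrightarrow> fun_definable l \<Longrightarrow>
     definable (\<lambda>\<sigma>. inst_rel (f \<sigma>) (g \<sigma>) (h \<sigma>) (k \<sigma>) (l \<sigma>))"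
proof (rule D_app5[of inst_rel])
  show "definable5 inst_rel" unfolding inst_rel_def by (intro def_intro)
qed

lemma D_pol [def_intro]:
  "fun_definable f \<Longrightarrow> fun_definable g \<Longrightarrow> definable (\<lambda>\<sigma>. pol_rel (f \<sigma>) (g \<sigma>))"
proof (rule D_app2[of pol_rel])
  show "definable2 pol_rel" unfolding pol_rel_def by (intro def_intro)
qed

lemma D_neg_atom [def_intro]:
  "fun_definable f \<Longrightarrow> fun_definable g \<Longrightarrow> definable (\<lambda>\<sigma>. neg_atom_rel (f \<sigma>) (g \<sigma>))"
  unfolding neg_atom_rel_def by (intro D_disj D_finite_bex finite_rsyms D_conj D_eq DF_num D_const)

lemma D_bq [def_intro]: "fun_definable f \<Longrightarrow> definable (\<lambda>\<sigma>. bq_rel (f \<sigma>))"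
  unfolding bq_rel_def by (intro D_disj D_conj D_eq DF_num D_const)

lemma D_bq_neg [def_intro]: "fun_definable f \<Longrightarrow> definable (\<lambda>\<sigma>. bq_neg_rel (f \<sigma>))"
  unfolding bq_neg_rel_def by (intro D_disj D_conj D_eq DF_num D_const)

lemma D_add [def_intro]: "fun_definable f \<Longrightarrow> fun_definable g \<Longrightarrow> definable (\<lambda>\<sigma>. add_rel k (f \<sigma>) (g \<sigma>))"
proof (rule D_app2[of "add_rel k"], induct k)
  case 0
  have "add_rel 0 x y \<longleftrightarrow> is_number x \<and> y = x" for x y by (auto simp: add_rel_def is_number_def)
  moreover have "definable (\<lambda>\<sigma>. is_number (\<sigma> 0) \<and> \<sigma> 1 = \<sigma> 0)" by (intro def_intro)
  ultimately show ?case by simp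
next
  case (Suc k)
  have "add_rel (Suc k) x y \<longleftrightarrow> (\<exists>z. add_rel k x z \<and> suc_rel z y)" for x y
    by (auto simp: add_rel_def suc_rel_def)
  moreover have "definable (\<lambda>\<sigma>. add_rel k (\<sigma> 1) (\<sigma> 0))"
    using D_rename[OF Suc(1), of "\<lambda>i. 1 - i"] Suc(2,3) by simp
  then have "definable (\<lambda>\<sigma>. \<exists>z. add_rel k (\<sigma> 0) z \<and> suc_rel z (\<sigma> 1))"
    by (intro D_ex D_conj def_intro) simp
  ultimately show ?case by simp
qed

lemma D_in [def_intro]:
  "fun_definable f \<Longrightarrow> fun_definable g \<Longrightarrow> definable (\<lambda>\<sigma>. scope_rel (f \<sigma>) (g \<sigma>))"
proof (rule D_app2[of scope_rel])
  show "definable2 scope_rel" unfolding scope_rel_def by (intro def_intro)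
qed

lemma D_fun_wf [def_intro]:
  "fun_definable f \<Longrightarrow> fun_definable g \<Longrightarrow> definable (\<lambda>\<sigma>. fun_wf_rel (f \<sigma>) (g \<sigma>))"
  unfolding fun_wf_rel_def by (intro D_finite_bex finite_symbols def_intro)

lemma D_qlo_wf [def_intro]:
  "fun_definable f \<Longrightarrow> fun_definable g \<Longrightarrow> fun_definable h \<Longrightarrow> fun_definable k \<Longrightarrow> fun_definable l \<Longrightarrow>
     fun_definable m \<Longrightarrow> definable (\<lambda>\<sigma>. qlo_wf_rel (f \<sigma>) (g \<sigma>) (h \<sigma>) (k \<sigma>) (l \<sigma>) (m \<sigma>))"
proof (rule D_app6[of qlo_wf_rel])
  show "definable6 qlo_wf_rel"
    unfolding qlo_wf_rel_def by (intro D_finite_bex finite_symbols def_intro)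
qed

lemma D_atom_wf [def_intro]:
  "fun_definable f \<Longrightarrow> fun_definable g \<Longrightarrow> fun_definable h \<Longrightarrow> fun_definable k \<Longrightarrow> fun_definable l \<Longrightarrow>
     definable (\<lambda>\<sigma>. atom_wf_rel (f \<sigma>) (g \<sigma>) (h \<sigma>) (k \<sigma>) (l \<sigma>))"
proof (rule D_app5[of atom_wf_rel])
  show "definable5 atom_wf_rel"
    unfolding atom_wf_rel_def by (intro D_finite_bex finite_rsyms def_intro D_const)
qed


subsection \<open>The evaluation operator\<close>

text \<open>
  The judgements are: \<open>t\<close> has referent \<open>v\<close>; the terms \<open>ts\<close> have referents \<open>w\<close>; \<open>\<phi>\<close> has truth
  value \<open>v\<close> (0 or 1; 2 means that it has some truth value); all instances of the compound formula \<open>\<phi>\<close> have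
  truth value \<open>v\<close>; the bound of \<open>\<phi>\<close> has referent \<open>u\<close>; \<open>\<phi>\<close> is negatable; \<open>t\<close> (or \<open>ts\<close>, \<open>\<phi>\<close>, \<open>\<phi>s\<close>)
  is well-formed with free variables in the blocks \<open>B\<close> and has length \<open>l' - l\<close>; and \<open>l\<close> is
  less than the number of iterations.

  The frame \<open>F\<close> is empty for proper terms and formulas.  While a reductive interpretation is being
  evaluated, it consists of the environment, variables, terms and formulas of the QLO.
\<close>

abbreviation "jT F e t v \<equiv> enc [num 0, F, e, t, v]"
abbreviation "jTs F e ts w \<equiv> enc [num (Suc 0), F, e, ts, w]"
abbreviation "jF F e \<phi> v \<equiv> enc [num 2, F, e, \<phi>, v]"
abbreviation "jInst F e \<phi> u v \<equiv> enc [num 3, F, e, \<phi>, u, v]"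
abbreviation "jBound F e \<phi> u \<equiv> enc [num 4, F, e, \<phi>, u]"
abbreviation "jNeg F \<phi> \<equiv> enc [num 5, F, \<phi>]"
abbreviation "jWT B t l l' \<equiv> enc [num 6, B, t, l, l']"
abbreviation "jWTs B ts l l' \<equiv> enc [num 7, B, ts, l, l']"
abbreviation "jWF B \<phi> l l' \<equiv> enc [num 8, B, \<phi>, l, l']"
abbreviation "jWFs B \<phi>s l l' \<equiv> enc [num 9, B, \<phi>s, l, l']"
abbreviation "jLe l \<equiv> enc [num 10, l]"

text \<open>A family of premises without a fixed number of members. Naming it puts the rule into the
  form \<open>\<forall>y. R y \<longrightarrow> T y\<close>, as required by
  \<open>Op_all\<close>.\<close>

definition "inst_prem F e \<phi> u v y \<longleftrightarrow> (\<exists>e' \<phi>'. inst_rel e \<phi> u e' \<phi>' \<and> y = jF F e' \<phi>' v)"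
definition "qlo_neg_prem q \<phi>s y \<longleftrightarrow> (\<exists>q'\<in>qlos L. q = num (cq q') \<and>
  (\<exists>j\<in>qlo_neg L q'. \<exists>\<phi>. nth_rel \<phi>s (num (Suc j)) \<phi> \<and> y = jNeg (enc []) \<phi>))"

text \<open>One round of evaluation: the premises refer to the result \<open>T\<close> of earlier
  rounds, so nothing is recursive and \<open>inductive\<close> only supplies the case analysis.
  \<open>Qlo\<close> guesses the referent \<open>s\<close> and checks the reduct, with the arguments
  as frame. \<open>TPar\<close> and \<open>FPar\<close> leave the frame and return to the stored
  environment, extended by the values of the hole's arguments. \<open>AllFalse\<close> and
  \<open>ExTrue\<close> need a deciding instance and, by weak Kleene logic, a truth value for all
  the others.\<close>

inductive step :: "('a \<Rightarrow> bool) \<Rightarrow> 'a \<Rightarrow> bool" for T where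
  Var: "lookup_rel e x v \<Longrightarrow> step T (jT F e (enc [num 0, x]) v)"
| Fun: "T (jTs F e ts w) \<Longrightarrow> app_rel f w v \<Longrightarrow> step T (jT F e (enc [num (Suc 0), f, ts]) v)"
| Qlo: "reduct_rel q \<theta> \<Longrightarrow> T (jF (enc [e, xs, ts, \<phi>s]) (enc [enc [enc [num 0], enc [s]]]) \<theta> (num (Suc 0))) \<Longrightarrow>
    step T (jT (enc []) e (enc [num 2, q, xs, ts, \<phi>s]) s)"
| TPar: "F = enc [e0, xs, ts0, \<phi>s0] \<Longrightarrow> T (jTs F e ts w) \<Longrightarrow> nth_rel ts0 i t \<Longrightarrow>
    cons_rel (enc [xs, w]) e0 e' \<Longrightarrow> T (jT (enc []) e' t v) \<Longrightarrow> step T (jT F e (enc [num 3, i, ts]) v)"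
| TsNil: "step T (jTs F e (enc []) (enc []))"
| TsCons: "T (jT F e t v) \<Longrightarrow> T (jTs F e ts w) \<Longrightarrow> cons_rel t ts ts' \<Longrightarrow> cons_rel v w w' \<Longrightarrow>
    step T (jTs F e ts' w')"
| Atom: "T (jTs F e ts w) \<Longrightarrow> atom_rel b R w v \<Longrightarrow> step T (jF F e (enc [num 4, b, R, ts]) v)"
| FPar: "F = enc [e0, xs, ts0, \<phi>s0] \<Longrightarrow> T (jTs F e ts w) \<Longrightarrow> nth_rel \<phi>s0 j \<phi> \<Longrightarrow>
    cons_rel (enc [xs, w]) e0 e' \<Longrightarrow> T (jF (enc []) e' \<phi> v') \<Longrightarrow> sign_rel b v' v \<Longrightarrow>
    step T (jF F e (enc [num 5, b, j, ts]) v)"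
| AllTrue: "pol_rel \<phi> (num (Suc 0)) \<Longrightarrow> T (jBound F e \<phi> u) \<Longrightarrow> T (jInst F e \<phi> u (num (Suc 0))) \<Longrightarrow> step T (jF F e \<phi> (num (Suc 0)))"
| ExFalse: "pol_rel \<phi> (num 0) \<Longrightarrow> T (jNeg F \<phi>) \<Longrightarrow> T (jBound F e \<phi> u) \<Longrightarrow> T (jInst F e \<phi> u (num 0)) \<Longrightarrow>
    step T (jF F e \<phi> (num 0))"
| AllFalse: "pol_rel \<phi> (num (Suc 0)) \<Longrightarrow> T (jNeg F \<phi>) \<Longrightarrow> T (jBound F e \<phi> u) \<Longrightarrow> T (jInst F e \<phi> u (num 2)) \<Longrightarrow>
    inst_rel e \<phi> u e' \<phi>' \<Longrightarrow> T (jF F e' \<phi>' (num 0)) \<Longrightarrow> step T (jF F e \<phi> (num 0))"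
| ExTrue: "pol_rel \<phi> (num 0) \<Longrightarrow> T (jBound F e \<phi> u) \<Longrightarrow> T (jInst F e \<phi> u (num 2)) \<Longrightarrow>
    inst_rel e \<phi> u e' \<phi>' \<Longrightarrow> T (jF F e' \<phi>' (num (Suc 0))) \<Longrightarrow> step T (jF F e \<phi> (num (Suc 0)))"
| Det: "T (jF F e \<phi> v) \<Longrightarrow> bool_rel v \<Longrightarrow> step T (jF F e \<phi> (num 2))"
| Inst: "\<forall>y. inst_prem F e \<phi> u v y \<longrightarrow> T y \<Longrightarrow> step T (jInst F e \<phi> u v)"
| BoundBin: "step T (jBound F e (enc [num 6, b, \<phi>, \<psi>]) u)"
| BoundBQ: "bq_rel b \<Longrightarrow> T (jT F e t u) \<Longrightarrow> step T (jBound F e (enc [num 7, b, x, t, \<phi>]) u)"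
| BoundQ: "step T (jBound F e (enc [num 8, b, x, \<phi>]) u)"
| NegAtom: "neg_atom_rel b R \<Longrightarrow> step T (jNeg F (enc [num 4, b, R, ts]))"
| NegFPar0: "step T (jNeg F (enc [num 5, num 0, j, ts]))"
| NegFPar1: "F = enc [e0, xs, ts0, \<phi>s0] \<Longrightarrow> nth_rel \<phi>s0 j \<phi> \<Longrightarrow> T (jNeg (enc []) \<phi>) \<Longrightarrow>
    step T (jNeg F (enc [num 5, num (Suc 0), j, ts]))"
| NegBin: "T (jNeg F \<phi>) \<Longrightarrow> T (jNeg F \<psi>) \<Longrightarrow> step T (jNeg F (enc [num 6, b, \<phi>, \<psi>]))"
| NegBQ: "bq_neg_rel b \<Longrightarrow> T (jNeg F \<phi>) \<Longrightarrow> step T (jNeg F (enc [num 7, b, x, t, \<phi>]))"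
| NegQ: "T (jNeg F \<phi>) \<Longrightarrow> step T (jNeg F (enc [num 8, b, x, \<phi>]))"
| WTVar: "scope_rel x B \<Longrightarrow> add_rel (Suc 0) l l' \<Longrightarrow> step T (jWT B (enc [num 0, x]) l l')"
| WTFun: "fun_wf_rel f ts \<Longrightarrow> add_rel (Suc 0) l l1 \<Longrightarrow> T (jWTs B ts l1 l') \<Longrightarrow> step T (jWT B (enc [num (Suc 0), f, ts]) l l')"
| WTQlo: "qlo_wf_rel q xs ts \<phi>s l l1 \<Longrightarrow> cons_rel xs B B' \<Longrightarrow> T (jWTs B' ts l1 l2) \<Longrightarrow> T (jWFs B' \<phi>s l2 l') \<Longrightarrow>
    \<forall>y. qlo_neg_prem q \<phi>s y \<longrightarrow> T y \<Longrightarrow> step T (jWT B (enc [num 2, q, xs, ts, \<phi>s]) l l')"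
| WTsNil: "step T (jWTs B (enc []) l l)"
| WTsCons: "T (jWT B t l l1) \<Longrightarrow> T (jWTs B ts l1 l') \<Longrightarrow> cons_rel t ts ts' \<Longrightarrow> step T (jWTs B ts' l l')"
| WFAtom: "atom_wf_rel b R ts l l1 \<Longrightarrow> T (jWTs B ts l1 l') \<Longrightarrow> step T (jWF B (enc [num 4, b, R, ts]) l l')"
| WFBin: "bool_rel b \<Longrightarrow> add_rel (Suc 0) l l1 \<Longrightarrow> T (jWF B \<phi> l1 l2) \<Longrightarrow> T (jWF B \<psi> l2 l') \<Longrightarrow>
    step T (jWF B (enc [num 6, b, \<phi>, \<psi>]) l l')"
| WFBQ: "bq_rel b \<Longrightarrow> is_number x \<Longrightarrow> add_rel 3 l l1 \<Longrightarrow> T (jWT B t l1 l2) \<Longrightarrow> cons_rel (enc [x]) B B' \<Longrightarrow>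
    T (jWF B' \<phi> l2 l') \<Longrightarrow> step T (jWF B (enc [num 7, b, x, t, \<phi>]) l l')"
| WFQ: "bool_rel b \<Longrightarrow> is_number x \<Longrightarrow> add_rel 2 l l1 \<Longrightarrow> cons_rel (enc [x]) B B' \<Longrightarrow>
    T (jWF B' \<phi> l1 l') \<Longrightarrow> step T (jWF B (enc [num 8, b, x, \<phi>]) l l')"
| WFsNil: "step T (jWFs B (enc []) l l)"
| WFsCons: "T (jWF B \<phi> l l1) \<Longrightarrow> T (jWFs B \<phi>s l1 l') \<Longrightarrow> cons_rel \<phi> \<phi>s \<phi>s' \<Longrightarrow> step T (jWFs B \<phi>s' l l')"
| LeZero: "step T (jLe (num 0))"
| LeSuc: "T (jLe l) \<Longrightarrow> add_rel (Suc 0) l l' \<Longrightarrow> step T (jLe l')"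

lemma D_inst_prem [def_intro]:
  "fun_definable f \<Longrightarrow> fun_definable g \<Longrightarrow> fun_definable h \<Longrightarrow> fun_definable k \<Longrightarrow> fun_definable l \<Longrightarrow>
     fun_definable m \<Longrightarrow> definable (\<lambda>\<sigma>. inst_prem (f \<sigma>) (g \<sigma>) (h \<sigma>) (k \<sigma>) (l \<sigma>) (m \<sigma>))"
proof (rule D_app6[of inst_prem])
  show "definable6 inst_prem" unfolding inst_prem_def by (intro def_intro)
qed

lemma D_qlo_neg_prem [def_intro]:
  "fun_definable f \<Longrightarrow> fun_definable g \<Longrightarrow> fun_definable h \<Longrightarrow>
     definable (\<lambda>\<sigma>. qlo_neg_prem (f \<sigma>) (g \<sigma>) (h \<sigma>))"
proof (rule D_app3[of qlo_neg_prem])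
  show "definable3 qlo_neg_prem"
    unfolding qlo_neg_prem_def by (intro D_finite_bex finite_symbols def_intro)
qed

text \<open>Unfolding the rules gives a disjunction of existentially quantified conjunctions in
  which \<open>T\<close> occurs only positively, so the closure rules for operators suffice.\<close>

lemma op_definable_step: "op_definable (\<lambda>\<sigma> T. step T (\<sigma> 0))"
  unfolding step.simps by (intro op_intro Op_base def_intro)

inductive_simps step_jT: "step T (jT F e t v)"
inductive_simps step_jTs: "step T (jTs F e ts w)"
inductive_simps step_jF: "step T (jF F e \<phi> v)"
inductive_simps step_jInst: "step T (jInst F e \<phi> u v)"
inductive_simps step_jBound: "step T (jBound F e \<phi> u)"
inductive_simps step_jNeg: "step T (jNeg F \<phi>)"
inductive_simps step_jWT: "step T (jWT B t l l')"
inductive_simps step_jWTs: "step T (jWTs B ts l l')"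
inductive_simps step_jWF: "step T (jWF B \<phi> l l')"
inductive_simps step_jWFs: "step T (jWFs B \<phi>s l l')"
inductive_simps step_jLe: "step T (jLe l)"

end

subsection \<open>Environments and frames\<close>

definition look :: "(nat list \<times> 'a list) list \<Rightarrow> nat \<Rightarrow> 'a option" where
  "look e = map_of (concat (map (\<lambda>b. zip (fst b) (snd b)) e))"

text \<open>The default \<open>undefined\<close> makes the empty environment the one in which
  \<open>referent\<close> evaluates closed terms.\<close>

definition env_val :: "(nat list \<times> 'a list) list \<Rightarrow> nat \<Rightarrow> 'a" where
  "env_val e x = (case look e x of None \<Rightarrow> undefined | Some a \<Rightarrow> a)"

lemma look_Nil [simp]: "look [] = Map.empty"
  by (simp add: look_def)

lemma look_Cons: "look (b # e) = look e ++ map_of (zip (fst b) (snd b))"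
  by (simp add: look_def)

lemma env_val_Nil [simp]: "env_val [] = (\<lambda>_. undefined)"
  by (simp add: env_val_def fun_eq_iff)

lemma env_val_Cons [simp]: "env_val ((xs, ws) # e) = assign (env_val e) xs ws"
  by (rule ext) (simp add: env_val_def look_Cons assign_def map_add_def split: option.split)

lemma assign_single [simp]: "assign \<sigma> [x] [d] = \<sigma>(x := d)"
  by (auto simp: assign_def)

definition scope :: "(nat list \<times> 'a list) list \<Rightarrow> nat set" where
  "scope e = dom (look e)"

lemma scope_Nil [simp]: "scope [] = {}"
  by (simp add: scope_def)

lemma scope_Cons [simp]: "length ws = length xs \<Longrightarrow> scope ((xs, ws) # e) = scope e \<union> set xs"
  by (auto simp: scope_def look_Cons)

lemma scopeD: "x \<in> scope e \<Longrightarrow> look e x = Some (env_val e x)"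
  by (auto simp: scope_def env_val_def)

text \<open>\<open>map_of\<close> returns the first match, whence the minimality clause. The lists
  may differ in length, since \<open>zip\<close> truncates.\<close>

lemma map_of_zip_eq_Some_iff:
  "map_of (zip xs ws) x = Some v \<longleftrightarrow>
     (\<exists>p. p < length xs \<and> p < length ws \<and> xs ! p = x \<and> ws ! p = v \<and> (\<forall>p'<p. xs ! p' \<noteq> x))"
proof (induct xs ws rule: list_induct2')
  case (4 y xs w ws)
  have "(\<exists>p. p < length (y # xs) \<and> p < length (w # ws) \<and> (y # xs) ! p = x \<and> (w # ws) ! p = v \<and>
      (\<forall>p'<p. (y # xs) ! p' \<noteq> x)) \<longleftrightarrow>
    (y = x \<and> w = v) \<or> (\<exists>p. Suc p < length (y # xs) \<and> Suc p < length (w # ws) \<and> (y # xs) ! Suc p = x \<and>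
      (w # ws) ! Suc p = v \<and> (\<forall>p'<Suc p. (y # xs) ! p' \<noteq> x))" (is "(\<exists>p. ?P p) \<longleftrightarrow> _ \<or> (\<exists>p. ?Q p)")
  proof
    assume "\<exists>p. ?P p"
    then obtain p where "?P p" by blast
    then show "(y = x \<and> w = v) \<or> (\<exists>p. ?Q p)" by (cases p) auto
  next
    assume "(y = x \<and> w = v) \<or> (\<exists>p. ?Q p)"
    then show "\<exists>p. ?P p" by (elim disjE exE) (rule exI[of _ 0], simp, blast)
  qed
  then show ?case using 4 by (auto simp: All_less_Suc2)
qed auto

lemma map_of_zip_eq_None_iff:
  "map_of (zip xs ws) x = None \<longleftrightarrow> \<not> (\<exists>p. p < length xs \<and> p < length ws \<and> xs ! p = x)"
proof -
  have "fst ` set (zip xs ws) = {xs ! p |p. p < length xs \<and> p < length ws}"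
    by (force simp: set_zip image_iff)
  then show ?thesis unfolding map_of_eq_None_iff by auto
qed

lemma look_eq_Some_iff:
  "look e x = Some v \<longleftrightarrow> (\<exists>i<length e. map_of (zip (fst (e ! i)) (snd (e ! i))) x = Some v \<and>
     (\<forall>j<i. map_of (zip (fst (e ! j)) (snd (e ! j))) x = None))"
proof (induct e)
  case (Cons b e)
  then show ?case
    by (cases "map_of (zip (fst b) (snd b)) x") (auto simp: look_Cons Ex_less_Suc2 All_less_Suc2 map_add_def)
qed simp

section \<open>Lengths, and the values of weak Kleene quantifiers in positive form\<close>

definition fm_length :: "('f, 'r, 'q) fm \<Rightarrow> nat" where
  "fm_length \<phi> = length (symbols_fm \<phi>)"

lemma length_simps [simp]:
  "trm_length (Var x) = 1"
  "trm_length (Fun f ts) = Suc (sum_list (map trm_length ts))"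
  "trm_length (Qlo q xs ts \<phi>s) =
     Suc (length xs + sum_list (map trm_length ts) + sum_list (map fm_length \<phi>s))"
  "trm_length (TPar i ts) = Suc (sum_list (map trm_length ts))"
  "fm_length (Atom b R ts) = (if b then 1 else 2) + sum_list (map trm_length ts)"
  "fm_length (FPar b j ts) = (if b then 1 else 2) + sum_list (map trm_length ts)"
  "fm_length (And \<phi> \<psi>) = Suc (fm_length \<phi> + fm_length \<psi>)"
  "fm_length (Or \<phi> \<psi>) = Suc (fm_length \<phi> + fm_length \<psi>)"
  "fm_length (BAll x t \<phi>) = 3 + trm_length t + fm_length \<phi>"
  "fm_length (BEx x t \<phi>) = 3 + trm_length t + fm_length \<phi>"
  "fm_length (All x \<phi>) = 2 + fm_length \<phi>"
  "fm_length (Ex x \<phi>) = 2 + fm_length \<phi>"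
  by (simp_all add: trm_length_def[abs_def] fm_length_def[abs_def] length_concat comp_def)

lemma length_pos: "trm_length t \<ge> 1" "fm_length \<phi> \<ge> 1"
  by (cases t; simp) (cases \<phi>; simp)

lemma never_false_unless_eq_Some: "never_false_unless c w = Some v \<longleftrightarrow> w = Some v \<and> (\<not> v \<longrightarrow> c)"
  by (auto simp: never_false_unless_def)

text \<open>Rephrases the test for indeterminacy in the definition as positive statements about
  instances, matching the premises of \<open>AllTrue\<close> and \<open>AllFalse\<close>.\<close>

lemma kleene_all_eq_Some:
  "kleene_all (f ` A) = Some v \<longleftrightarrow> v \<and> (\<forall>d\<in>A. f d = Some True) \<or>
     \<not> v \<and> (\<forall>d\<in>A. f d \<noteq> None) \<and> (\<exists>d\<in>A. f d = Some False)"
proof (cases "\<exists>d\<in>A. f d = None")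
  case True
  then obtain d where "d \<in> A" "f d = None" by blast
  then have "\<not> (\<forall>d\<in>A. f d = Some b)" "\<not> (\<forall>d\<in>A. f d \<noteq> None)" for b
    by (auto intro!: bexI[of _ d])
  with True show ?thesis unfolding kleene_all_ex_iff by simp
next
  case False
  then have "f d = Some True \<longleftrightarrow> f d \<noteq> Some False" if "d \<in> A" for d
    using that by (cases "f d") auto
  then have q: "(\<exists>d\<in>A. f d = Some False) \<longleftrightarrow> \<not> (\<forall>d\<in>A. f d = Some True)" by blast
  then have k: "kleene_all (f ` A) = Some (\<forall>d\<in>A. f d = Some True)"
    unfolding kleene_all_ex_iff if_not_P[OF False] by blast
  show ?thesis unfolding k q option.inject using False by (cases v) (simp_all del: not_None_eq)
qed

lemma kleene_ex_eq_Some: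
  "kleene_ex (f ` A) = Some v \<longleftrightarrow> \<not> v \<and> (\<forall>d\<in>A. f d = Some False) \<or>
     v \<and> (\<forall>d\<in>A. f d \<noteq> None) \<and> (\<exists>d\<in>A. f d = Some True)"
proof (cases "\<exists>d\<in>A. f d = None")
  case True
  then obtain d where "d \<in> A" "f d = None" by blast
  then have "\<not> (\<forall>d\<in>A. f d = Some b)" "\<not> (\<forall>d\<in>A. f d \<noteq> None)" for b
    by (auto intro!: bexI[of _ d])
  with True show ?thesis unfolding kleene_all_ex_iff by simp
next
  case False
  then have "f d = Some False \<longleftrightarrow> f d \<noteq> Some True" if "d \<in> A" for d
    using that by (cases "f d") auto
  then have q: "(\<exists>d\<in>A. f d = Some True) \<longleftrightarrow> \<not> (\<forall>d\<in>A. f d = Some False)" by blast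
  then have k: "kleene_ex (f ` A) = Some (\<not> (\<forall>d\<in>A. f d = Some False))"
    unfolding kleene_all_ex_iff if_not_P[OF False] by blast
  show ?thesis unfolding k q option.inject using False by (cases v) (simp_all del: not_None_eq)
qed

subsection \<open>Meaning of the judgements\<close>

type_synonym ('a, 'f, 'r, 'q) frame =
  "((nat list \<times> 'a list) list \<times> nat list \<times> ('f, 'r, 'q) trm list \<times> ('f, 'r, 'q) fm list) option"

fun insts :: "('a, 'f, 'r, 'q) pt_lang \<Rightarrow> (nat list \<times> 'a list) list \<Rightarrow> ('f, 'r, 'q) fm \<Rightarrow> 'a \<Rightarrow>
    ((nat list \<times> 'a list) list \<times> ('f, 'r, 'q) fm) set" where
  "insts L e (And \<phi> \<psi>) u = {(e, \<phi>), (e, \<psi>)}"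
| "insts L e (Or \<phi> \<psi>) u = {(e, \<phi>), (e, \<psi>)}"
| "insts L e (BAll x t \<phi>) u = (\<lambda>d. (([x], [d]) # e, \<phi>)) ` below L u"
| "insts L e (BEx x t \<phi>) u = (\<lambda>d. (([x], [d]) # e, \<phi>)) ` below L u"
| "insts L e (All x \<phi>) u = range (\<lambda>d. (([x], [d]) # e, \<phi>))"
| "insts L e (Ex x \<phi>) u = range (\<lambda>d. (([x], [d]) # e, \<phi>))"
| "insts L e _ u = {}"

fun polarity :: "('f, 'r, 'q) fm \<Rightarrow> bool option" where
  "polarity (And \<phi> \<psi>) = Some True"
| "polarity (Or \<phi> \<psi>) = Some False"
| "polarity (BAll x t \<phi>) = Some True"
| "polarity (BEx x t \<phi>) = Some False"
| "polarity (All x \<phi>) = Some True"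
| "polarity (Ex x \<phi>) = Some False"
| "polarity _ = None"

lemma insts_length: "(e', \<phi>') \<in> insts L e \<phi> u \<Longrightarrow> fm_length \<phi>' < fm_length \<phi>"
  by (cases \<phi>) auto

context coded_language
begin

text \<open>A frame is present only while a reduct is evaluated. Reducts contain no QLOs, so the
  dummy interpretation of \<open>reduct_true\<close> is used there.\<close>

fun QF :: "('a, 'f, 'r, 'q) frame \<Rightarrow> ('a, 'q) qlo_interp" where
  "QF None = qlo_val L"
| "QF (Some _) = (\<lambda>_ _ _ _. None)"

fun NF :: "('a, 'f, 'r, 'q) frame \<Rightarrow> nat set" where
  "NF None = {}"
| "NF (Some (e, xs, ts, \<phi>s)) = {j. j < length \<phi>s \<and> negatable L {} (\<phi>s ! j)}"

fun PF :: "('a, 'f, 'r, 'q) frame \<Rightarrow> nat \<Rightarrow> 'a list \<Rightarrow> 'a option" where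
  "PF None = (\<lambda>_ _. None)"
| "PF (Some (e, xs, ts, \<phi>s)) = (\<lambda>i as. map (trm_val L (assign (env_val e) xs as)) ts ! i)"

fun GF :: "('a, 'f, 'r, 'q) frame \<Rightarrow> nat \<Rightarrow> 'a list \<Rightarrow> bool option" where
  "GF None = (\<lambda>_ _. None)"
| "GF (Some (e, xs, ts, \<phi>s)) = (\<lambda>j as. map (fm_val L (assign (env_val e) xs as)) \<phi>s ! j)"

abbreviation "TV F \<equiv> tval L (QF F) (NF F) (PF F) (GF F)"
abbreviation "FV F \<equiv> fval L (QF F) (NF F) (PF F) (GF F)"

fun LF :: "('a, 'f, 'r, 'q) frame \<Rightarrow> ('a, 'f, 'r, 'q) pt_lang" where
  "LF None = L"
| "LF (Some _) = L\<lparr>qlos := {}\<rparr>"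

fun taF :: "('a, 'f, 'r, 'q) frame \<Rightarrow> nat list" where
  "taF None = []"
| "taF (Some (e, xs, ts, \<phi>s)) = replicate (length ts) (length xs)"

fun faF :: "('a, 'f, 'r, 'q) frame \<Rightarrow> nat list" where
  "faF None = []"
| "faF (Some (e, xs, ts, \<phi>s)) = replicate (length \<phi>s) (length xs)"

fun okF :: "('a, 'f, 'r, 'q) frame \<Rightarrow> bool" where
  "okF None \<longleftrightarrow> True"
| "okF (Some (e, xs, ts, \<phi>s)) \<longleftrightarrow>
     (\<forall>t\<in>set ts. is_term L t \<and> fv_trm t \<subseteq> scope e \<union> set xs) \<and>
     (\<forall>\<phi>\<in>set \<phi>s. is_formula L \<phi> \<and> fv_fm \<phi> \<subseteq> scope e \<union> set xs)"

text \<open>The set \<open>M\<close> is left open because a reduct is well-formed with respect to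
  \<open>qlo_neg\<close>, whereas its evaluation uses the possibly larger set \<open>NF F\<close> of
  arguments that are in fact negatable.\<close>

definition okT :: "('a, 'f, 'r, 'q) frame \<Rightarrow> (nat list \<times> 'a list) list \<Rightarrow> ('f, 'r, 'q) trm \<Rightarrow> bool" where
  "okT F e t \<longleftrightarrow> okF F \<and> fv_trm t \<subseteq> scope e \<and>
  (\<exists>M. (F = None \<longrightarrow> M = {}) \<and> wf_trm (LF F) (taF F) (faF F) M t)"
definition okM :: "('a, 'f, 'r, 'q) frame \<Rightarrow> (nat list \<times> 'a list) list \<Rightarrow> ('f, 'r, 'q) fm \<Rightarrow> bool" where
  "okM F e \<phi> \<longleftrightarrow> okF F \<and> fv_fm \<phi> \<subseteq> scope e \<and>
  (\<exists>M. (F = None \<longrightarrow> M = {}) \<and> wf_fm (LF F) (taF F) (faF F) M \<phi>)"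

lemma LF_simps [simp]:
  "funs (LF F) = funs L" "fun_arity (LF F) = fun_arity L" "is_rsym (LF F) R = is_rsym L R"
  "arity (LF F) R = arity L R" "has_ball (LF F) = has_ball L" "has_bex (LF F) = has_bex L"
  "neg_rels (LF F) = neg_rels L"
  by (cases F; cases R; simp)+

lemma okT_None [simp]: "okT None e t \<longleftrightarrow> is_term L t \<and> fv_trm t \<subseteq> scope e"
  by (auto simp: okT_def)

lemma okM_None [simp]: "okM None e \<phi> \<longleftrightarrow> is_formula L \<phi> \<and> fv_fm \<phi> \<subseteq> scope e"
  by (auto simp: okM_def)

lemma okT_Fun: "okT F e (Fun f ts) \<Longrightarrow> f \<in> funs L \<and> length ts = fun_arity L f \<and> (\<forall>t\<in>set ts. okT F e t)"
  unfolding okT_def by auto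

lemma okT_TPar:
  assumes "okT F e (TPar i ts)"
  obtains e0 xs ts0 \<phi>s0 where "F = Some (e0, xs, ts0, \<phi>s0)" "i < length ts0" "length ts = length xs"
    "\<forall>t\<in>set ts. okT F e t" "okF F"
proof (cases F)
  case None
  then show ?thesis using assms by (simp add: okT_def)
next
  case (Some a)
  obtain e0 xs ts0 \<phi>s0 where "a = (e0, xs, ts0, \<phi>s0)" by (cases a) auto
  then show ?thesis using assms Some by (intro that) (auto simp: okT_def)
qed

lemma okM_Atom: "okM F e (Atom b R ts) \<Longrightarrow> is_rsym L R \<and> length ts = arity L R \<and> (\<forall>t\<in>set ts. okT F e t)"
  unfolding okT_def okM_def by auto

lemma okM_FPar:
  assumes "okM F e (FPar b j ts)"
  obtains e0 xs ts0 \<phi>s0 where "F = Some (e0, xs, ts0, \<phi>s0)" "j < length \<phi>s0" "length ts = length xs"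
    "\<forall>t\<in>set ts. okT F e t" "okF F"
proof (cases F)
  case None
  then show ?thesis using assms by (simp add: okM_def)
next
  case (Some a)
  obtain e0 xs ts0 \<phi>s0 where "a = (e0, xs, ts0, \<phi>s0)" by (cases a) auto
  then show ?thesis using assms Some by (intro that) (auto simp: okM_def okT_def)
qed

lemma okM_insts: "okM F e \<phi> \<Longrightarrow> (e', \<phi>') \<in> insts L e \<phi> u \<Longrightarrow> okM F e' \<phi>'"
  by (cases \<phi>) (auto simp: okM_def)

lemma okM_bound: "okM F e (BAll x t \<phi>) \<Longrightarrow> has_ball L \<and> okT F e t"
  "okM F e (BEx x t \<phi>) \<Longrightarrow> has_bex L \<and> okT F e t"
  by (auto simp: okM_def okT_def)

lemma okM_and: "okM F e (And \<phi> \<psi>) \<Longrightarrow> okM F e \<phi> \<and> okM F e \<psi>"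
  "okM F e (Or \<phi> \<psi>) \<Longrightarrow> okM F e \<phi> \<and> okM F e \<psi>"
  by (auto simp: okM_def)

text \<open>Well-posedness gives at most one referent, so a guessed \<open>s\<close> that satisfies
  the reduct is the referent, and uniqueness need not be checked by evaluation.\<close>

lemma qlo_val_iff:
  assumes "okT None e (Qlo q xs ts \<phi>s)" and F: "F = Some (e, xs, ts, \<phi>s)"
  shows "okM F [([0], [s])] (reduct L q)" (is ?A)
    and "TV None (env_val e) (Qlo q xs ts \<phi>s) = Some s \<longleftrightarrow>
      FV F (env_val [([0], [s])]) (reduct L q) = Some True" (is ?B)
proof -
  have wf: "q \<in> qlos L" "length xs = qlo_vars L q" "length ts = qlo_terms L q" "length \<phi>s = qlo_forms L q"
    "\<forall>\<phi>\<in>set \<phi>s. is_formula L \<phi>" "\<forall>j<length \<phi>s. j \<in> qlo_neg L q \<longrightarrow> negatable L {} (\<phi>s ! j)"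
    using assms(1) by auto
  have q: "qlo_neg L q \<subseteq> {..<qlo_forms L q}" "fv_fm (reduct L q) \<subseteq> {0}"
    "wf_fm (L\<lparr>qlos := {}\<rparr>) (replicate (qlo_terms L q) (qlo_vars L q))
          (replicate (qlo_forms L q) (qlo_vars L q)) (qlo_neg L q) (reduct L q)"
    "\<And>N tp fp s s'. qlo_neg L q \<subseteq> N \<Longrightarrow> (\<forall>j as. j \<notin> N \<longrightarrow> fp j as \<noteq> Some False) \<Longrightarrow>
           reduct_true L q N tp fp s \<Longrightarrow> reduct_true L q N tp fp s' \<Longrightarrow> s = s'"
    using pt wf(1) unfolding pt_language_def by blast+
  have "okF F" using assms by auto
  then show ?A using q(2,3) wf F by (auto simp: okM_def)
  \<comment> \<open>\<open>reduct_true\<close> assigns \<open>s\<close> to every variable, the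
    judgement only to variable 0. The reduct has no other free variable.\<close>
  have R: "reduct_true L q (NF F) (PF F) (GF F) s \<longleftrightarrow> FV F (env_val [([0], [s])]) (reduct L q) = Some True" for s
  proof -
    have "fval L (\<lambda>_ _ _ _. None) (NF F) (PF F) (GF F) (\<lambda>_. s) (reduct L q) =
      fval L (\<lambda>_ _ _ _. None) (NF F) (PF F) (GF F) (env_val [([0], [s])]) (reduct L q)"
      using q(2) by (intro val_cong(2)[OF qlo_local_no_qlos q(3)]) (auto simp: agree_def)
    then show ?thesis by (simp add: reduct_true_def F)
  qed
  have u: "s = s'" if "reduct_true L q (NF F) (PF F) (GF F) s" "reduct_true L q (NF F) (PF F) (GF F) s'" for s s'
  proof -
    \<comment> \<open>Beyond the last argument \<open>!\<close> is arbitrary and might be false, but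
      the uniqueness clause demands that holes which are not negatable are never false. Cutting
      \<open>GF F\<close> off there does not affect the reduct.\<close>
    let ?G = "\<lambda>j as. if j < length \<phi>s then GF F j as else None"
    have "reduct_true L q (NF F) (PF F) (GF F) = reduct_true L q (NF F) (PF F) ?G"
      using wf by (intro reduct_true_cong[OF pt]) (auto simp: agree_def)
    moreover have "qlo_neg L q \<subseteq> NF F" using q(1) wf F by auto
    moreover have "\<forall>j as. j \<notin> NF F \<longrightarrow> ?G j as \<noteq> Some False"
    proof (intro allI impI notI)
      fix j as assume j: "j \<notin> NF F" "?G j as = Some False"
      then have "j < length \<phi>s" "fm_val L (assign (env_val e) xs as) (\<phi>s ! j) = Some False"
        by (auto simp: F split: if_splits)
      moreover from this(2) have "negatable L {} (\<phi>s ! j)"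
        unfolding fm_val_def by (rule negatable_if_false) simp
      ultimately show False using j(1) F by simp
    qed
    ultimately show ?thesis using q(4)[of "NF F" ?G "PF F" s s'] that by simp
  qed
  have "TV None (env_val e) (Qlo q xs ts \<phi>s) = qlo_val L q (NF F) (PF F) (GF F)"
    by (simp add: F trm_val_def fm_val_def)
  also have "\<dots> = Some s \<longleftrightarrow> reduct_true L q (NF F) (PF F) (GF F) s"
    unfolding qlo_val_def using u by (auto intro: the_equality theI)
  finally show ?B by (simp add: R)
qed

fun bound_is :: "('a, 'f, 'r, 'q) frame \<Rightarrow> (nat list \<times> 'a list) list \<Rightarrow> ('f, 'r, 'q) fm \<Rightarrow> 'a \<Rightarrow> bool" where
  "bound_is F e (BAll x t \<phi>) u \<longleftrightarrow> TV F (env_val e) t = Some u"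
| "bound_is F e (BEx x t \<phi>) u \<longleftrightarrow> TV F (env_val e) t = Some u"
| "bound_is F e _ u \<longleftrightarrow> True"

text \<open>One description for all six compound forms: the value named by the polarity needs all
  instances, the opposite value needs a witness and determinacy. Without a bound, \<open>u\<close>
  is arbitrary.\<close>

lemma FV_compound:
  assumes "polarity \<phi> = Some b"
  shows "FV F (env_val e) \<phi> = Some v \<longleftrightarrow> (\<exists>u. bound_is F e \<phi> u \<and> (\<not> v \<longrightarrow> negatable L (NF F) \<phi>) \<and>
    (v = b \<and> (\<forall>(e', \<phi>')\<in>insts L e \<phi> u. FV F (env_val e') \<phi>' = Some b) \<or>
     v = (\<not> b) \<and> (\<forall>(e', \<phi>')\<in>insts L e \<phi> u. FV F (env_val e') \<phi>' \<noteq> None) \<and>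
       (\<exists>(e', \<phi>')\<in>insts L e \<phi> u. FV F (env_val e') \<phi>' = Some (\<not> b))))"
proof (cases \<phi>)
  case (And \<phi>1 \<phi>2)
  then show ?thesis using assms
    by (cases "FV F (env_val e) \<phi>1"; cases "FV F (env_val e) \<phi>2")
       (auto simp: never_false_unless_eq_Some kleene2_def)
next
  case (Or \<phi>1 \<phi>2)
  then show ?thesis using assms
    by (cases "FV F (env_val e) \<phi>1"; cases "FV F (env_val e) \<phi>2")
       (auto simp: never_false_unless_eq_Some kleene2_def)
next
  case (BAll x t \<psi>)
  then show ?thesis using assms
    by (cases "TV F (env_val e) t") (auto simp: never_false_unless_eq_Some kleene_all_eq_Some)
next
  case (BEx x t \<psi>)
  then show ?thesis using assms
    by (cases "TV F (env_val e) t") (auto simp: never_false_unless_eq_Some kleene_ex_eq_Some)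
next
  case (All x \<psi>)
  then show ?thesis using assms by (auto simp: never_false_unless_eq_Some kleene_all_eq_Some)
next
  case (Ex x \<psi>)
  then show ?thesis using assms by (auto simp: never_false_unless_eq_Some kleene_ex_eq_Some)
qed (use assms in simp_all)

subsection \<open>Codes of environments and frames\<close>

definition env_code :: "(nat list \<times> 'a list) list \<Rightarrow> 'a" where
  "env_code e = enc (map (\<lambda>b. enc [enc (map num (fst b)), enc (snd b)]) e)"

fun frame_code :: "('a, 'f, 'r, 'q) frame \<Rightarrow> 'a" where
  "frame_code None = enc []"
| "frame_code (Some (e, xs, ts, \<phi>s)) =
     enc [env_code e, enc (map num xs), enc (map trm_code ts), enc (map fm_code \<phi>s)]"

lemma env_code_Cons [simp]:
  "cons_rel (enc [enc (map num xs), enc ws]) (env_code e) e' \<longleftrightarrow> e' = env_code ((xs, ws) # e)"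
  by (simp add: env_code_def)

lemma cons_rel_single [simp]:
  "cons_rel (enc [enc [num x], enc [d]]) (env_code e) e' \<longleftrightarrow> e' = env_code (([x], [d]) # e)"
  using env_code_Cons[of "[x]" "[d]"] by simp

text \<open>\<open>hit\<close> concerns the block that provides the value, \<open>skip\<close> the
  blocks passed over before it. A block provides a value only if both of its lists reach the
  position.\<close>

lemma lookup_rel_iff: "lookup_rel (env_code e) (num x) v \<longleftrightarrow> look e x = Some v"
proof -
  have block: "nth_rel (env_code e) i (enc [xs, ws]) \<longleftrightarrow>
      (\<exists>k<length e. i = num (Suc k) \<and> xs = enc (map num (fst (e ! k))) \<and> ws = enc (snd (e ! k)))" for i xs ws
    by (auto simp: nth_rel_def env_code_def)
  have hit: "(\<exists>p. nth_rel (enc (map num xs)) p (num x) \<and> nth_rel (enc ws) p v \<and>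
      (\<forall>p'. lt_rel p' p \<longrightarrow> \<not> nth_rel (enc (map num xs)) p' (num x))) \<longleftrightarrow> map_of (zip xs ws) x = Some v" for xs ws
  proof -
    have "(\<forall>p'. lt_rel p' (num (Suc p)) \<longrightarrow> \<not> nth_rel (enc (map num xs)) p' (num x)) \<longleftrightarrow>
        (\<forall>p'<p. xs ! p' \<noteq> x)" if "p < length xs" for p
    proof
      assume a: "\<forall>p'. lt_rel p' (num (Suc p)) \<longrightarrow> \<not> nth_rel (enc (map num xs)) p' (num x)"
      show "\<forall>p'<p. xs ! p' \<noteq> x"
      proof (intro allI impI)
        fix p' assume "p' < p"
        then show "xs ! p' \<noteq> x" using a[rule_format, of "num (Suc p')"] that by simp
      qed
    next
      assume "\<forall>p'<p. xs ! p' \<noteq> x"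
      then show "\<forall>p'. lt_rel p' (num (Suc p)) \<longrightarrow> \<not> nth_rel (enc (map num xs)) p' (num x)"
        by (auto simp: lt_rel_def nth_rel_def)
    qed
    then have eq: "(nth_rel (enc (map num xs)) (num (Suc p)) (num x) \<and> nth_rel (enc ws) (num (Suc p)) v \<and>
        (\<forall>p'. lt_rel p' (num (Suc p)) \<longrightarrow> \<not> nth_rel (enc (map num xs)) p' (num x))) \<longleftrightarrow>
        p < length xs \<and> p < length ws \<and> xs ! p = x \<and> ws ! p = v \<and> (\<forall>p'<p. xs ! p' \<noteq> x)" for p
      by (cases "p < length xs") auto
    have "\<exists>k. p = num (Suc k)" if "nth_rel (enc ws) p v" for p
      using that by (auto simp: nth_rel_def)
    then have "(\<exists>p. nth_rel (enc (map num xs)) p (num x) \<and> nth_rel (enc ws) p v \<and>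
      (\<forall>p'. lt_rel p' p \<longrightarrow> \<not> nth_rel (enc (map num xs)) p' (num x))) \<longleftrightarrow>
      (\<exists>p. nth_rel (enc (map num xs)) (num (Suc p)) (num x) \<and> nth_rel (enc ws) (num (Suc p)) v \<and>
      (\<forall>p'. lt_rel p' (num (Suc p)) \<longrightarrow> \<not> nth_rel (enc (map num xs)) p' (num x)))" by blast
    then show ?thesis unfolding map_of_zip_eq_Some_iff eq .
  qed
  have skip: "(\<exists>p v'. nth_rel (enc (map num xs)) p (num x) \<and> nth_rel (enc ws) p v') \<longleftrightarrow>
      map_of (zip xs ws) x \<noteq> None" for xs ws
  proof -
    have "\<exists>k. p = num (Suc k)" if "nth_rel (enc ws) p v" for p v
      using that by (auto simp: nth_rel_def)
    then have "(\<exists>p v'. nth_rel (enc (map num xs)) p (num x) \<and> nth_rel (enc ws) p v') \<longleftrightarrow>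
        (\<exists>k v'. nth_rel (enc (map num xs)) (num (Suc k)) (num x) \<and> nth_rel (enc ws) (num (Suc k)) v')" by blast
    then show ?thesis unfolding map_of_zip_eq_None_iff nth_rel_enc by auto
  qed
  show ?thesis (is "_ \<longleftrightarrow> ?R")
  proof
    assume "lookup_rel (env_code e) (num x) v"
    then obtain k where k: "k < length e" "map_of (zip (fst (e ! k)) (snd (e ! k))) x = Some v"
      and s: "\<And>j xs' ws'. lt_rel j (num (Suc k)) \<Longrightarrow> nth_rel (env_code e) j (enc [xs', ws']) \<Longrightarrow>
        \<not> (\<exists>p v'. nth_rel xs' p (num x) \<and> nth_rel ws' p v')"
      unfolding lookup_rel_def block using hit by blast
    have "map_of (zip (fst (e ! j)) (snd (e ! j))) x = None" if "j < k" for j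
    proof -
      have "\<not> (\<exists>p v'. nth_rel (enc (map num (fst (e ! j)))) p (num x) \<and> nth_rel (enc (snd (e ! j))) p v')"
        by (rule s[of "num (Suc j)"]) (use that k(1) in \<open>simp_all add: block\<close>)
      then show ?thesis unfolding skip by simp
    qed
    with k show ?R unfolding look_eq_Some_iff by blast
  next
    assume ?R
    then obtain k where k: "k < length e" "map_of (zip (fst (e ! k)) (snd (e ! k))) x = Some v"
      "\<forall>j<k. map_of (zip (fst (e ! j)) (snd (e ! j))) x = None" unfolding look_eq_Some_iff by blast
    show "lookup_rel (env_code e) (num x) v"
      unfolding lookup_rel_def
    proof (rule exI[of _ "num (Suc k)"], rule exI[of _ "enc (map num (fst (e ! k)))"],
        rule exI[of _ "enc (snd (e ! k))"], rule conjI[OF _ conjI])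
      show "nth_rel (env_code e) (num (Suc k)) (enc [enc (map num (fst (e ! k))), enc (snd (e ! k))])"
        using k(1) by (simp add: block)
      show "\<forall>j xs' ws'. lt_rel j (num (Suc k)) \<and> nth_rel (env_code e) j (enc [xs', ws']) \<longrightarrow>
        \<not> (\<exists>p v'. nth_rel xs' p (num x) \<and> nth_rel ws' p v')"
      proof (intro allI impI, elim conjE)
        fix j xs' ws' assume "lt_rel j (num (Suc k))" "nth_rel (env_code e) j (enc [xs', ws'])"
        then obtain j' where "j' < k" "xs' = enc (map num (fst (e ! j')))" "ws' = enc (snd (e ! j'))"
          by (auto simp: block lt_rel_def)
        with k(3) skip show "\<not> (\<exists>p v'. nth_rel xs' p (num x) \<and> nth_rel ws' p v')" by simp
      qed
    qed (rule hit[THEN iffD2, OF k(2)])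
  qed
qed

text \<open>As soon as there is a bounded quantifier, well-posedness makes \<open>less_rel\<close> a
  declared binary relation.\<close>

lemma below_rel_iff: "has_ball L \<or> has_bex L \<Longrightarrow> below_rel d u \<longleftrightarrow> d \<in> below L u"
  using pt by (auto simp: below_rel_def below_def pt_language_def)

lemma inst_rel_iff:
  assumes "okM F e \<phi>"
  shows "inst_rel (env_code e) (fm_code \<phi>) u e' \<psi> \<longleftrightarrow>
    (\<exists>(e1, \<phi>1)\<in>insts L e \<phi> u. e' = env_code e1 \<and> \<psi> = fm_code \<phi>1)"
  using assms below_rel_iff okM_bound[of F e]
  by (cases \<phi>) (auto simp: inst_rel_def)

lemma pol_rel_iff: "pol_rel (fm_code \<phi>) b \<longleftrightarrow> (\<exists>c. polarity \<phi> = Some c \<and> b = bool_code c)"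
  by (cases \<phi>) (auto simp: pol_rel_def)

end

context coded_language
begin

subsection \<open>Soundness of the evaluation operator\<close>

definition "fval_is F e \<phi> v \<longleftrightarrow> (\<exists>b. v = bool_code b \<and> FV F (env_val e) \<phi> = Some b) \<or>
  v = num 2 \<and> FV F (env_val e) \<phi> \<noteq> None"

definition "scope_code B = enc (map (\<lambda>xs. enc (map num xs)) B)"

definition "well_formed_trm B s \<longleftrightarrow> is_term L s \<and> fv_trm s \<subseteq> (\<Union>xs\<in>set B. set xs)"
definition "well_formed_fm B \<phi> \<longleftrightarrow> is_formula L \<phi> \<and> fv_fm \<phi> \<subseteq> (\<Union>xs\<in>set B. set xs)"

text \<open>Evaluation judgements are claimed to be correct only on codes of well-formed
  expressions. The well-formedness judgements start from any element of the domain and certify that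
  it is such a code.\<close>

definition "sound_T T \<longleftrightarrow> (\<forall>F e t v. okT F e t \<longrightarrow>
  T (jT (frame_code F) (env_code e) (trm_code t) v) \<longrightarrow> TV F (env_val e) t = Some v)"
definition "sound_Ts T \<longleftrightarrow> (\<forall>F e ts w. (\<forall>t\<in>set ts. okT F e t) \<longrightarrow>
  T (jTs (frame_code F) (env_code e) (enc (map trm_code ts)) w) \<longrightarrow>
  (\<exists>vs. w = enc vs \<and> map (TV F (env_val e)) ts = map Some vs))"
definition "sound_F T \<longleftrightarrow> (\<forall>F e \<phi> v. okM F e \<phi> \<longrightarrow>
  T (jF (frame_code F) (env_code e) (fm_code \<phi>) v) \<longrightarrow> fval_is F e \<phi> v)"
definition "sound_Inst T \<longleftrightarrow> (\<forall>F e \<phi> u v. okM F e \<phi> \<longrightarrow>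
  T (jInst (frame_code F) (env_code e) (fm_code \<phi>) u v) \<longrightarrow>
  (\<forall>(e', \<phi>')\<in>insts L e \<phi> u. fval_is F e' \<phi>' v))"
definition "sound_Bound T \<longleftrightarrow> (\<forall>F e \<phi> u. okM F e \<phi> \<longrightarrow>
  T (jBound (frame_code F) (env_code e) (fm_code \<phi>) u) \<longrightarrow> bound_is F e \<phi> u)"
definition "sound_Neg T \<longleftrightarrow> (\<forall>F e \<phi>. okM F e \<phi> \<longrightarrow>
  T (jNeg (frame_code F) (fm_code \<phi>)) \<longrightarrow> negatable L (NF F) \<phi>)"
definition "sound_WT T \<longleftrightarrow> (\<forall>B t n l. T (jWT (scope_code B) t (num n) l) \<longrightarrow>
  (\<exists>s. t = trm_code s \<and> well_formed_trm B s \<and> l = num (n + trm_length s)))"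
definition "sound_WTs T \<longleftrightarrow> (\<forall>B ts n l. T (jWTs (scope_code B) ts (num n) l) \<longrightarrow>
  (\<exists>ss. ts = enc (map trm_code ss) \<and> (\<forall>s\<in>set ss. well_formed_trm B s) \<and>
     l = num (n + sum_list (map trm_length ss))))"
definition "sound_WF T \<longleftrightarrow> (\<forall>B t n l. T (jWF (scope_code B) t (num n) l) \<longrightarrow>
  (\<exists>s. t = fm_code s \<and> well_formed_fm B s \<and> l = num (n + fm_length s)))"
definition "sound_WFs T \<longleftrightarrow> (\<forall>B ts n l. T (jWFs (scope_code B) ts (num n) l) \<longrightarrow>
  (\<exists>ss. ts = enc (map fm_code ss) \<and> (\<forall>s\<in>set ss. well_formed_fm B s) \<and>
     l = num (n + sum_list (map fm_length ss))))"

lemma env_code_single: "enc [enc [enc [num 0], enc [s]]] = env_code [([0], [s])]"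
  by (simp add: env_code_def)

lemma sound_T_step:
  assumes "sound_T T" "sound_Ts T" "sound_F T"
  shows "sound_T (step T)"
  unfolding sound_T_def
proof (intro allI impI)
  fix F e t v
  assume ok: "okT F e t" and st: "step T (jT (frame_code F) (env_code e) (trm_code t) v)"
  show "TV F (env_val e) t = Some v"
  proof (cases t)
    case (Var x)
    then show ?thesis using st by (simp add: step_jT lookup_rel_iff env_val_def)
  next
    case (Fun f ts)
    then obtain w where w: "T (jTs (frame_code F) (env_code e) (enc (map trm_code ts)) w)" "app_rel (num (cf f)) w v"
      using st by (auto simp: step_jT)
    have f: "f \<in> funs L" "\<forall>t\<in>set ts. okT F e t" using okT_Fun ok Fun by blast+
    then obtain vs where vs: "w = enc vs" "map (TV F (env_val e)) ts = map Some vs"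
      using assms(2) w(1) unfolding sound_Ts_def by blast
    from w(2) vs(1) inj_onD[OF inj_cf] f(1) have "v = fun_val L f vs" by (auto simp: app_rel_def)
    moreover have "those (map (TV F (env_val e)) ts) = Some vs" unfolding those_eq_Some_iff by (rule vs(2))
    ultimately show ?thesis using Fun by simp
  next
    case (Qlo q xs ts \<phi>s)
    \<comment> \<open>Under a frame the language of reducts has no QLOs, so a well-formed QLO term
      excludes the frame.\<close>
    have F: "F = None"
      using ok Qlo by (cases F) (auto simp: okT_def)
    let ?F = "Some (e, xs, ts, \<phi>s)"
    from ok Qlo F have ok': "okT None e (Qlo q xs ts \<phi>s)" by simp
    from st Qlo F obtain \<theta> where "reduct_rel (num (cq q)) \<theta>"
      "T (jF (frame_code ?F) (env_code [([0], [v])]) \<theta> (num (Suc 0)))"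
      by (auto simp: step_jT env_code_single)
    moreover have "q \<in> qlos L" using ok' by simp
    ultimately have "T (jF (frame_code ?F) (env_code [([0], [v])]) (fm_code (reduct L q)) (num (Suc 0)))"
      using inj_onD[OF inj_cq] by (auto simp: reduct_rel_def)
    with assms(3) qlo_val_iff(1)[OF ok' refl, of v] have "fval_is ?F [([0], [v])] (reduct L q) (num (Suc 0))"
      unfolding sound_F_def by blast
    then have "FV ?F (env_val [([0], [v])]) (reduct L q) = Some True" by (auto simp: fval_is_def)
    with qlo_val_iff(2)[OF ok' refl, of v] show ?thesis unfolding Qlo F by blast
  next
    case (TPar i ts)
    from ok[unfolded TPar] obtain e0 xs ts0 \<phi>s0 where F: "F = Some (e0, xs, ts0, \<phi>s0)" "i < length ts0"
      "length ts = length xs" "\<forall>t\<in>set ts. okT F e t" "okF F" by (rule okT_TPar)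
    from st TPar F obtain w e' where w: "T (jTs (frame_code F) (env_code e) (enc (map trm_code ts)) w)"
      "cons_rel (enc [enc (map num xs), w]) (env_code e0) e'" "T (jT (enc []) e' (trm_code (ts0 ! i)) v)"
      by (auto simp: step_jT)
    from assms(2) w(1) F(4) obtain vs where vs: "w = enc vs" "map (TV F (env_val e)) ts = map Some vs"
      unfolding sound_Ts_def by blast
    then have l: "length vs = length xs" using F(3) by (metis length_map)
    \<comment> \<open>The argument behind the hole is a proper term, so its evaluation continues
      without a frame.\<close>
    have ok': "okT None ((xs, vs) # e0) (ts0 ! i)" using F l by auto
    from w(2,3) vs(1) have "T (jT (frame_code None) (env_code ((xs, vs) # e0)) (trm_code (ts0 ! i)) v)" by simp
    with assms(1) ok' have "TV None (env_val ((xs, vs) # e0)) (ts0 ! i) = Some v"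
      unfolding sound_T_def by blast
    moreover have "those (map (TV F (env_val e)) ts) = Some vs" unfolding those_eq_Some_iff by (rule vs(2))
    ultimately show ?thesis using TPar F(1,2) by (simp add: trm_val_def)
  qed
qed

lemma sound_Ts_step:
  assumes "sound_T T" "sound_Ts T"
  shows "sound_Ts (step T)"
  unfolding sound_Ts_def
proof (intro allI impI)
  fix F e ts w
  assume ok: "\<forall>t\<in>set ts. okT F e t"
    and st: "step T (jTs (frame_code F) (env_code e) (enc (map trm_code ts)) w)"
  show "\<exists>vs. w = enc vs \<and> map (TV F (env_val e)) ts = map Some vs"
  proof (cases ts)
    case Nil
    then show ?thesis using st by (auto simp: step_jTs cons_rel_def)
  next
    case (Cons t ts')
    then obtain v w' where "T (jT (frame_code F) (env_code e) (trm_code t) v)"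
      "T (jTs (frame_code F) (env_code e) (enc (map trm_code ts')) w')" "cons_rel v w' w"
      using st by (auto simp: step_jTs cons_rel_def)
    moreover from this(1) have "TV F (env_val e) t = Some v"
      using assms(1) ok Cons unfolding sound_T_def by auto
    moreover obtain vs where "w' = enc vs" "map (TV F (env_val e)) ts' = map Some vs"
      using assms(2) ok Cons calculation(2) unfolding sound_Ts_def by (metis list.set_intros(2))
    ultimately show ?thesis using Cons by (intro exI[of _ "v # vs"]) simp
  qed
qed

lemma bool_rel_iff: "bool_rel v \<longleftrightarrow> (\<exists>b. v = bool_code b)"
  by (auto simp: bool_rel_def bool_code_def)

lemma flip_rel_iff: "flip_rel (bool_code b) v \<longleftrightarrow> v = bool_code (\<not> b)"
  by (cases b) (auto simp: flip_rel_def bool_code_def)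

lemma sign_rel_iff: "sign_rel (bool_code b) v' v \<longleftrightarrow> (\<exists>c. v' = bool_code c \<and> v = bool_code (if b then c else \<not> c))"
  by (cases b) (auto simp: sign_rel_def flip_rel_def bool_rel_def bool_code_def)

text \<open>Strong negatability identifies \<open>fails\<close> with the complement of
  \<open>sat\<close>, and \<open>RDown\<close> never fails.\<close>

lemma atom_rel_iff:
  assumes "is_rsym L R" "length vs = arity L R"
  shows "atom_rel (bool_code b) (num (rsym_code cr R)) (enc vs) v \<longleftrightarrow>
    (sat L R vs \<and> v = bool_code b \<or> R \<in> neg_rels L \<and> fails L R vs \<and> v = bool_code (\<not> b))"
proof -
  have "atom_rel (bool_code b) (num (rsym_code cr R)) (enc vs) v \<longleftrightarrow>
    (sat L R vs \<and> v = bool_code b \<or> R \<noteq> RDown \<and> \<not> sat L R vs \<and> v = bool_code (\<not> b))"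
    using assms rsym_code_inj unfolding atom_rel_def flip_rel_iff bool_rel_iff by auto
  also have "\<dots> \<longleftrightarrow> (sat L R vs \<and> v = bool_code b \<or> R \<in> neg_rels L \<and> fails L R vs \<and> v = bool_code (\<not> b))"
    using fails_iff[OF assms(1) _ assms(2)] neg_relsI[OF assms(1)] by (cases "R = RDown") auto
  finally show ?thesis .
qed

lemma sat_fails_disjoint: "is_rsym L R \<Longrightarrow> length vs = arity L R \<Longrightarrow> fails L R vs \<Longrightarrow> \<not> sat L R vs"
  using fails_iff[of R vs] by (cases "R = RDown") auto

lemma fval_is_bool: "fval_is F e \<phi> (bool_code b) \<longleftrightarrow> FV F (env_val e) \<phi> = Some b"
  by (auto simp: fval_is_def)

lemma num_bool_code: "num 0 = bool_code False" "num (Suc 0) = bool_code True"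
  by simp_all

lemma sound_F_step:
  assumes "sound_T T" "sound_Ts T" "sound_F T" "sound_Inst T" "sound_Bound T" "sound_Neg T"
  shows "sound_F (step T)"
  unfolding sound_F_def
proof (intro allI impI)
  fix F e \<phi> v
  assume ok: "okM F e \<phi>" and st: "step T (jF (frame_code F) (env_code e) (fm_code \<phi>) v)"
  show "fval_is F e \<phi> v"
  \<comment> \<open>The rule \<open>Det\<close> fits every formula, so it is split off before the
    case analysis on the shape of \<open>\<phi>\<close>.\<close>
  proof (cases "v = num 2 \<and> (\<exists>v'. T (jF (frame_code F) (env_code e) (fm_code \<phi>) v') \<and> bool_rel v')")
    case True
    then obtain b where "T (jF (frame_code F) (env_code e) (fm_code \<phi>) (bool_code b))" by (auto simp: bool_rel_iff)
    then have "fval_is F e \<phi> (bool_code b)" using assms(3) ok unfolding sound_F_def by blast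
    then show ?thesis using True by (auto simp: fval_is_def)
  next
    case nd: False
    show ?thesis
    proof (cases "polarity \<phi>")
      case (Some c)
      then have np: "(\<nexists>b R ts. fm_code \<phi> = enc [num 4, b, R, ts])" "(\<nexists>b R ts. fm_code \<phi> = enc [num 5, b, R, ts])"
        by (cases \<phi>; simp)+
      define inst where "inst u v \<longleftrightarrow> (\<forall>(e', \<phi>')\<in>insts L e \<phi> u. fval_is F e' \<phi>' v)" for u v
      have I: "T (jInst (frame_code F) (env_code e) (fm_code \<phi>) u v) \<Longrightarrow> inst u v" for u v
        using assms(4) ok unfolding sound_Inst_def inst_def by blast
      have B: "T (jBound (frame_code F) (env_code e) (fm_code \<phi>) u) \<Longrightarrow> bound_is F e \<phi> u" for u
        using assms(5) ok unfolding sound_Bound_def by blast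
      have N: "T (jNeg (frame_code F) (fm_code \<phi>)) \<Longrightarrow> negatable L (NF F) \<phi>"
        using assms(6) ok unfolding sound_Neg_def by blast
      have W: "\<exists>(e', \<phi>')\<in>insts L e \<phi> u. FV F (env_val e') \<phi>' = Some b"
        if i: "inst_rel (env_code e) (fm_code \<phi>) u e' \<psi>" and t: "T (jF (frame_code F) e' \<psi> (bool_code b))" for u e' \<psi> b
      proof -
        obtain e1 \<phi>1 where 1: "(e1, \<phi>1) \<in> insts L e \<phi> u" "e' = env_code e1" "\<psi> = fm_code \<phi>1"
          using i unfolding inst_rel_iff[OF ok] by blast
        with t okM_insts[OF ok] assms(3) have "fval_is F e1 \<phi>1 (bool_code b)" unfolding sound_F_def by blast
        with 1 show ?thesis by (auto simp: fval_is_bool)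
      qed
      have ib: "inst u (bool_code b) \<longleftrightarrow> (\<forall>(e', \<phi>')\<in>insts L e \<phi> u. FV F (env_val e') \<phi>' = Some b)" for u b
        unfolding inst_def by (simp add: fval_is_bool)
      have i2: "inst u (num 2) \<longleftrightarrow> (\<forall>(e', \<phi>')\<in>insts L e \<phi> u. FV F (env_val e') \<phi>' \<noteq> None)" for u
        unfolding inst_def by (simp add: fval_is_def)
      \<comment> \<open>The seven goals are the rules with conclusion \<open>jF\<close>, in their
        order. \<open>np\<close> refutes the rules for atoms and holes by the tag, and
        \<open>nd\<close> refutes \<open>Det\<close>.\<close>
      from st[unfolded step_jF pol_rel_iff Some num_bool_code bool_code_simps(1) option.inject]
      have "\<exists>b. v = bool_code b \<and> FV F (env_val e) \<phi> = Some b"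
      proof (elim disjE, goal_cases)
        case 1
        then show ?case using np by blast
      next
        case 2
        then show ?case using np by blast
      next
        case 3
        then have c: "c = True" by auto
        from 3 obtain u where "bound_is F e \<phi> u" "inst u (bool_code True)" using I B by blast
        then have "FV F (env_val e) \<phi> = Some True"
          unfolding FV_compound[OF Some] c ib by (intro exI[of _ u]) simp
        with 3 show ?case by blast
      next
        case 4
        then have c: "c = False" by auto
        from 4 obtain u where "bound_is F e \<phi> u" "inst u (bool_code False)" "negatable L (NF F) \<phi>"
          using I B N by blast
        then have "FV F (env_val e) \<phi> = Some False"
          unfolding FV_compound[OF Some] c ib by (intro exI[of _ u]) simp
        with 4 show ?case by blast
      next
        case 5
        then have c: "c = True" by auto
        from 5 obtain u where "bound_is F e \<phi> u" "inst u (num 2)" "negatable L (NF F) \<phi>"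
          "\<exists>(e', \<phi>')\<in>insts L e \<phi> u. FV F (env_val e') \<phi>' = Some False"
          using I B N W by blast
        then have "FV F (env_val e) \<phi> = Some False"
          unfolding FV_compound[OF Some] c i2 by (intro exI[of _ u]) simp
        with 5 show ?case by blast
      next
        case 6
        then have c: "c = False" by auto
        from 6 obtain u where "bound_is F e \<phi> u" "inst u (num 2)"
          "\<exists>(e', \<phi>')\<in>insts L e \<phi> u. FV F (env_val e') \<phi>' = Some True"
          using I B W by blast
        then have "FV F (env_val e) \<phi> = Some True"
          unfolding FV_compound[OF Some] c i2 by (intro exI[of _ u]) simp
        with 6 show ?case by blast
      next
        case 7
        then show ?case using nd by blast
      qed
      then obtain b where "v = bool_code b" "FV F (env_val e) \<phi> = Some b" by blast
      then show ?thesis by (simp add: fval_is_bool)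
    next
      case None
      then have np: "\<not> pol_rel (fm_code \<phi>) b" for b by (simp add: pol_rel_iff)
      show ?thesis
      proof (cases \<phi>)
        case (Atom b R ts)
        from st nd np Atom obtain w where w: "T (jTs (frame_code F) (env_code e) (enc (map trm_code ts)) w)"
          "atom_rel (bool_code b) (num (rsym_code cr R)) w v" by (auto simp: step_jF)
        have R: "is_rsym L R" "length ts = arity L R" "\<forall>t\<in>set ts. okT F e t" using okM_Atom ok Atom by blast+
        with assms(2) w(1) obtain vs where vs: "w = enc vs" "map (TV F (env_val e)) ts = map Some vs"
          unfolding sound_Ts_def by blast
        then have l: "length vs = arity L R" using R(2) by (metis length_map)
        have "those (map (TV F (env_val e)) ts) = Some vs" unfolding those_eq_Some_iff by (rule vs(2))
        moreover from w(2) have "sat L R vs \<and> v = bool_code b \<or> R \<in> neg_rels L \<and> fails L R vs \<and> v = bool_code (\<not> b)"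
          unfolding vs(1) atom_rel_iff[OF R(1) l] .
        ultimately show ?thesis using Atom sat_fails_disjoint[OF R(1) l] by (auto simp: fval_is_bool)
      next
        case (FPar b j ts)
        from ok[unfolded FPar] obtain e0 xs ts0 \<phi>s0 where F: "F = Some (e0, xs, ts0, \<phi>s0)" "j < length \<phi>s0"
          "length ts = length xs" "\<forall>t\<in>set ts. okT F e t" "okF F" by (rule okM_FPar)
        from st nd np FPar F obtain w e' v' where w: "T (jTs (frame_code F) (env_code e) (enc (map trm_code ts)) w)"
          "cons_rel (enc [enc (map num xs), w]) (env_code e0) e'" "T (jF (enc []) e' (fm_code (\<phi>s0 ! j)) v')"
          "sign_rel (bool_code b) v' v"
          by (auto simp: step_jF)
        from assms(2) w(1) F(4) obtain vs where vs: "w = enc vs" "map (TV F (env_val e)) ts = map Some vs"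
          unfolding sound_Ts_def by blast
        then have l: "length vs = length xs" using F(3) by (metis length_map)
        have ok': "okM None ((xs, vs) # e0) (\<phi>s0 ! j)" using F l by auto
        from w(2,3) vs(1) have "T (jF (frame_code None) (env_code ((xs, vs) # e0)) (fm_code (\<phi>s0 ! j)) v')" by simp
        with assms(3) ok' have "fval_is None ((xs, vs) # e0) (\<phi>s0 ! j) v'" unfolding sound_F_def by blast
        moreover from w(4) obtain c where "v' = bool_code c" "v = bool_code (if b then c else \<not> c)"
          unfolding sign_rel_iff by blast
        moreover have "those (map (TV F (env_val e)) ts) = Some vs" unfolding those_eq_Some_iff by (rule vs(2))
        ultimately show ?thesis using FPar F(1,2) by (auto simp: fval_is_bool fm_val_def)
      qed (use None in simp_all)
    qed
  qed
qed

lemma sound_Inst_step: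
  assumes "sound_F T"
  shows "sound_Inst (step T)"
  unfolding sound_Inst_def step_jInst inst_prem_def
proof (intro allI impI ballI, clarify)
  fix F e \<phi> u v e1 \<phi>1
  assume ok: "okM F e \<phi>" and i: "(e1, \<phi>1) \<in> insts L e \<phi> u"
    and a: "\<forall>y. (\<exists>e' \<phi>'. inst_rel (env_code e) (fm_code \<phi>) u e' \<phi>' \<and> y = jF (frame_code F) e' \<phi>' v) \<longrightarrow> T y"
  have "inst_rel (env_code e) (fm_code \<phi>) u (env_code e1) (fm_code \<phi>1)"
    unfolding inst_rel_iff[OF ok] using i by blast
  with a have "T (jF (frame_code F) (env_code e1) (fm_code \<phi>1) v)" by blast
  with assms okM_insts[OF ok i] show "fval_is F e1 \<phi>1 v" unfolding sound_F_def by blast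
qed

lemma sound_Bound_step:
  assumes "sound_T T"
  shows "sound_Bound (step T)"
  unfolding sound_Bound_def
proof (intro allI impI)
  fix F e \<phi> u
  assume ok: "okM F e \<phi>" and st: "step T (jBound (frame_code F) (env_code e) (fm_code \<phi>) u)"
  have T: "okT F e t \<Longrightarrow> T (jT (frame_code F) (env_code e) (trm_code t) u) \<Longrightarrow> TV F (env_val e) t = Some u" for t
    using assms unfolding sound_T_def by blast
  show "bound_is F e \<phi> u"
    using ok st okM_bound[of F e] by (cases \<phi>) (auto simp: step_jBound intro: T)
qed

lemma okM_body: "okM F e (BAll x t \<phi>) \<Longrightarrow> okM F (([x], [d]) # e) \<phi>"
  "okM F e (BEx x t \<phi>) \<Longrightarrow> okM F (([x], [d]) # e) \<phi>"
  "okM F e (All x \<phi>) \<Longrightarrow> okM F (([x], [d]) # e) \<phi>"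
  "okM F e (Ex x \<phi>) \<Longrightarrow> okM F (([x], [d]) # e) \<phi>"
  by (auto simp: okM_def)

lemma neg_atom_rel_iff:
  "is_rsym L R \<Longrightarrow> neg_atom_rel (bool_code b) (num (rsym_code cr R)) \<longleftrightarrow> (b \<longrightarrow> R \<in> neg_rels L)"
  using rsym_code_inj by (auto simp: neg_atom_rel_def)

lemma bq_rel_iff [simp]:
  "bq_rel (bool_code b) \<longleftrightarrow> (if b then has_ball L else has_bex L)"
  "bq_neg_rel (bool_code b) \<longleftrightarrow> (if b then has_bex L else has_ball L)"
  by (auto simp: bq_rel_def bq_neg_rel_def)

lemma sound_Neg_step:
  assumes "sound_Neg T"
  shows "sound_Neg (step T)"
  unfolding sound_Neg_def
proof (intro allI impI)
  fix F e \<phi>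
  assume ok: "okM F e \<phi>" and st: "step T (jNeg (frame_code F) (fm_code \<phi>))"
  have N: "okM F e \<phi> \<Longrightarrow> T (jNeg (frame_code F) (fm_code \<phi>)) \<Longrightarrow> negatable L (NF F) \<phi>" for F e \<phi>
    using assms unfolding sound_Neg_def by blast
  show "negatable L (NF F) \<phi>"
  proof (cases \<phi>)
    case (Atom b R ts)
    then show ?thesis using st okM_Atom ok by (auto simp: step_jNeg neg_atom_rel_iff)
  next
    case (FPar b j ts)
    from ok[unfolded FPar] obtain e0 xs ts0 \<phi>s0 where F: "F = Some (e0, xs, ts0, \<phi>s0)" "j < length \<phi>s0" "okF F"
      by (rule okM_FPar)
    \<comment> \<open>Negatability is independent of values. Any block of the right length serves to
      bring the free variables into scope.\<close>
    have ok': "okM None ((xs, replicate (length xs) undefined) # e0) (\<phi>s0 ! j)" using F by auto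
    have "b \<longrightarrow> T (jNeg (frame_code None) (fm_code (\<phi>s0 ! j)))" using st F(1,2) FPar by (auto simp: step_jNeg)
    with N[OF ok'] have "b \<longrightarrow> negatable L (NF None) (\<phi>s0 ! j)" by blast
    then show ?thesis using F(1,2) FPar by simp
  next
    case (And \<psi> \<psi>')
    with st have "T (jNeg (frame_code F) (fm_code \<psi>))" "T (jNeg (frame_code F) (fm_code \<psi>'))"
      by (simp_all add: step_jNeg)
    moreover have "okM F e \<psi>" "okM F e \<psi>'" using okM_and(1)[OF ok[unfolded And]] by simp_all
    ultimately have "negatable L (NF F) \<psi>" "negatable L (NF F) \<psi>'" using N by blast+
    then show ?thesis using And by simp
  next
    case (Or \<psi> \<psi>')
    with st have "T (jNeg (frame_code F) (fm_code \<psi>))" "T (jNeg (frame_code F) (fm_code \<psi>'))"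
      by (simp_all add: step_jNeg)
    moreover have "okM F e \<psi>" "okM F e \<psi>'" using okM_and(2)[OF ok[unfolded Or]] by simp_all
    ultimately have "negatable L (NF F) \<psi>" "negatable L (NF F) \<psi>'" using N by blast+
    then show ?thesis using Or by simp
  next
    case (BAll x t \<psi>)
    with st have "T (jNeg (frame_code F) (fm_code \<psi>))" "has_bex L" by (simp_all add: step_jNeg)
    moreover from this(1) have "negatable L (NF F) \<psi>" using N okM_body(1)[OF ok[unfolded BAll]] by blast
    ultimately show ?thesis using BAll by simp
  next
    case (BEx x t \<psi>)
    with st have "T (jNeg (frame_code F) (fm_code \<psi>))" "has_ball L" by (simp_all add: step_jNeg)
    moreover from this(1) have "negatable L (NF F) \<psi>" using N okM_body(2)[OF ok[unfolded BEx]] by blast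
    ultimately show ?thesis using BEx by simp
  next
    case (All x \<psi>)
    with st have "T (jNeg (frame_code F) (fm_code \<psi>))" "True" by (simp_all add: step_jNeg)
    moreover from this(1) have "negatable L (NF F) \<psi>" using N okM_body(3)[OF ok[unfolded All]] by blast
    ultimately show ?thesis using All by simp
  next
    case (Ex x \<psi>)
    with st have "T (jNeg (frame_code F) (fm_code \<psi>))" "True" by (simp_all add: step_jNeg)
    moreover from this(1) have "negatable L (NF F) \<psi>" using N okM_body(4)[OF ok[unfolded Ex]] by blast
    ultimately show ?thesis using Ex by simp
  qed
qed

section \<open>Soundness of the well-formedness judgements\<close>

lemma scope_rel_iff: "scope_rel x (scope_code B) \<longleftrightarrow> (\<exists>n\<in>(\<Union>xs\<in>set B. set xs). x = num n)"
proof
  assume "scope_rel x (scope_code B)"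
  then obtain i p where "i < length B" "p < length (B ! i)" "x = num (B ! i ! p)"
    by (auto simp: scope_rel_def scope_code_def nth_rel_def)
  then show "\<exists>n\<in>(\<Union>xs\<in>set B. set xs). x = num n"
    by (intro bexI[of _ "B ! i ! p"] UN_I[of "B ! i"]) simp_all
next
  assume "\<exists>n\<in>(\<Union>xs\<in>set B. set xs). x = num n"
  then obtain i p where "i < length B" "p < length (B ! i)" "x = num (B ! i ! p)"
    by (auto simp: in_set_conv_nth)
  then show "scope_rel x (scope_code B)"
    unfolding scope_rel_def scope_code_def
    by (intro exI[of _ "num (Suc i)"] exI[of _ "enc (map num (B ! i))"] exI[of _ "num (Suc p)"]) simp
qed

lemma scope_code_Cons [simp]:
  "cons_rel (enc (map num xs)) (scope_code B) B' \<longleftrightarrow> B' = scope_code (xs # B)"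
  "cons_rel (enc [num x]) (scope_code B) B' \<longleftrightarrow> B' = scope_code ([x] # B)"
  by (simp_all add: scope_code_def)

lemma add_rel_num [simp]: "add_rel k (num n) l \<longleftrightarrow> l = num (n + k)"
  by (simp add: add_rel_def)

lemma qlo_wf_relE:
  assumes "qlo_wf_rel q xs ts \<phi>s (num n) l"
  obtains q' ys as bs where "q' \<in> qlos L" "q = num (cq q')" "xs = enc (map num ys)" "distinct ys"
    "length ys = qlo_vars L q'" "ts = enc as" "length as = qlo_terms L q'" "\<phi>s = enc bs"
    "length bs = qlo_forms L q'" "l = num (n + Suc (qlo_vars L q'))"
proof -
  obtain q' where q': "q' \<in> qlos L" "q = num (cq q')" "len_rel xs (num (qlo_vars L q'))"
    "len_rel ts (num (qlo_terms L q'))" "len_rel \<phi>s (num (qlo_forms L q'))" "add_rel (Suc (qlo_vars L q')) (num n) l"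
    and n: "\<And>p x. nth_rel xs p x \<Longrightarrow> is_number x"
    and d: "\<And>p p' x. nth_rel xs p x \<and> nth_rel xs p' x \<Longrightarrow> p = p'"
    using assms unfolding qlo_wf_rel_def by blast
  obtain zs as bs where "xs = enc zs" "ts = enc as" "\<phi>s = enc bs" using q'(3-5) by (auto simp: len_rel_def)
  with q' have q: "q' \<in> qlos L" "q = num (cq q')" "xs = enc zs" "length zs = qlo_vars L q'"
    "ts = enc as" "length as = qlo_terms L q'" "\<phi>s = enc bs"
    "length bs = qlo_forms L q'" "l = num (n + Suc (qlo_vars L q'))" by simp_all
  have "is_number z" if "z \<in> set zs" for z
    using that n[of "num (Suc _)" z] q(3) by (auto simp: in_set_conv_nth)
  then have "\<forall>z\<in>set zs. \<exists>y. z = num y" by (simp add: is_number_def)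
  then have "zs \<in> lists (range num)" by auto
  then obtain ys where ys: "zs = map num ys" by (auto simp: lists_image)
  have "distinct zs"
    unfolding distinct_conv_nth
  proof (intro allI impI notI)
    fix i j assume "i < length zs" "j < length zs" "i \<noteq> j" "zs ! i = zs ! j"
    with d[of "num (Suc i)" "zs ! i" "num (Suc j)"] q(3) show False by simp
  qed
  with ys have "distinct ys" by (simp add: distinct_map)
  with ys q show ?thesis by (intro that[of q' ys as bs]) auto
qed

lemma sound_WT_step:
  assumes "sound_WTs T" "sound_WFs T" "sound_Neg T"
  shows "sound_WT (step T)"
  unfolding sound_WT_def
proof (intro allI impI)
  fix B t n l
  assume "step T (jWT (scope_code B) t (num n) l)"
  then show "\<exists>s. t = trm_code s \<and> well_formed_trm B s \<and> l = num (n + trm_length s)"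
    unfolding step_jWT
  proof (elim disjE exE conjE, goal_cases)
    case (1 x)
    then obtain m where "m \<in> (\<Union>xs\<in>set B. set xs)" "x = num m" by (auto simp: scope_rel_iff)
    with 1 show ?case by (intro exI[of _ "Var m"]) (simp add: well_formed_trm_def)
  next
    case (2 f ts l1)
    then have "T (jWTs (scope_code B) ts (num (n + 1)) l)" by simp
    with assms(1) obtain ss where ss: "ts = enc (map trm_code ss)" "\<forall>s\<in>set ss. well_formed_trm B s"
      "l = num (n + 1 + sum_list (map trm_length ss))" unfolding sound_WTs_def by blast
    with 2 obtain g where "g \<in> funs L" "f = num (cf g)" "length ss = fun_arity L g"
      by (auto simp: fun_wf_rel_def)
    with 2 ss show ?case by (intro exI[of _ "Fun g ss"]) (auto simp: well_formed_trm_def)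
  next
    case (3 q xs ts \<phi>s l1 B' l2)
    from 3(2) obtain q' ys as bs where q: "q' \<in> qlos L" "q = num (cq q')" "xs = enc (map num ys)" "distinct ys"
      "length ys = qlo_vars L q'" "ts = enc as" "length as = qlo_terms L q'" "\<phi>s = enc bs"
      "length bs = qlo_forms L q'" "l1 = num (n + Suc (qlo_vars L q'))" by (rule qlo_wf_relE)
    from 3(3) q(3) have B': "B' = scope_code (ys # B)" by simp
    from assms(1) 3(4) obtain ss where ss: "ts = enc (map trm_code ss)" "\<forall>s\<in>set ss. well_formed_trm (ys # B) s"
      "l2 = num (n + Suc (qlo_vars L q') + sum_list (map trm_length ss))"
      unfolding sound_WTs_def B' q(10) by blast
    from assms(2) 3(5) obtain \<psi>s where ps: "\<phi>s = enc (map fm_code \<psi>s)" "\<forall>s\<in>set \<psi>s. well_formed_fm (ys # B) s"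
      "l = num (n + Suc (qlo_vars L q') + sum_list (map trm_length ss) + sum_list (map fm_length \<psi>s))"
      unfolding sound_WFs_def B' ss(3) by blast
    have ln: "length ss = qlo_terms L q'" "length \<psi>s = qlo_forms L q'" using q ss ps by auto
    have "negatable L {} (\<psi>s ! j)" if "j < length \<psi>s" "j \<in> qlo_neg L q'" for j
    proof -
      have "qlo_neg_prem q \<phi>s (jNeg (enc []) (fm_code (\<psi>s ! j)))"
        unfolding qlo_neg_prem_def using q(1,2) that ps(1)
        by (intro bexI[of _ q'] conjI bexI[of _ j] exI[of _ "fm_code (\<psi>s ! j)"]) simp_all
      with 3(6) have "T (jNeg (frame_code None) (fm_code (\<psi>s ! j)))" by simp
      \<comment> \<open>One block with dummy values for all variables in scope; soundness of
        \<open>jNeg\<close> only asks for some environment that covers the free variables.\<close>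
      moreover have "okM None [(concat (ys # B), replicate (length (concat (ys # B))) undefined)] (\<psi>s ! j)"
        using ps(2)[rule_format, OF nth_mem[OF that(1)]] by (simp add: well_formed_fm_def)
      ultimately have "negatable L (NF None) (\<psi>s ! j)" using assms(3) unfolding sound_Neg_def by blast
      then show ?thesis by simp
    qed
    then have "is_term L (Qlo q' ys ss \<psi>s)"
      using q ln ss(2) ps(2) by (auto simp: well_formed_trm_def well_formed_fm_def)
    moreover have "fv_trm (Qlo q' ys ss \<psi>s) \<subseteq> (\<Union>xs\<in>set B. set xs)"
    proof -
      have "\<forall>s\<in>set ss. fv_trm s \<subseteq> set ys \<union> (\<Union>xs\<in>set B. set xs)"
        "\<forall>s\<in>set \<psi>s. fv_fm s \<subseteq> set ys \<union> (\<Union>xs\<in>set B. set xs)"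
        using ss(2) ps(2) by (simp_all add: well_formed_trm_def well_formed_fm_def)
      then show ?thesis unfolding fv_trm.simps by blast
    qed
    ultimately show ?case using 3(1) q ss ps
      by (intro exI[of _ "Qlo q' ys ss \<psi>s"]) (simp add: well_formed_trm_def)
  qed
qed

lemma sound_WTs_step:
  assumes "sound_WT T" "sound_WTs T"
  shows "sound_WTs (step T)"
  unfolding sound_WTs_def
proof (intro allI impI)
  fix B ts n l
  assume "step T (jWTs (scope_code B) ts (num n) l)"
  then show "\<exists>ss. ts = enc (map trm_code ss) \<and> (\<forall>s\<in>set ss. well_formed_trm B s) \<and>
     l = num (n + sum_list (map trm_length ss))"
    unfolding step_jWTs
  proof (elim disjE exE conjE, goal_cases)
    case 1
    then show ?case by (intro exI[of _ "[]"]) simp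
  next
    case (2 t l1 ts')
    from assms(1) 2(1) obtain s where s: "t = trm_code s" "well_formed_trm B s" "l1 = num (n + trm_length s)"
      unfolding sound_WT_def by blast
    from assms(2) 2(2) obtain ss where "ts' = enc (map trm_code ss)" "\<forall>s\<in>set ss. well_formed_trm B s"
      "l = num (n + trm_length s + sum_list (map trm_length ss))" unfolding sound_WTs_def s(3) by blast
    with s 2 show ?case by (intro exI[of _ "s # ss"]) simp
  qed
qed

lemma sound_WFs_step:
  assumes "sound_WF T" "sound_WFs T"
  shows "sound_WFs (step T)"
  unfolding sound_WFs_def
proof (intro allI impI)
  fix B ts n l
  assume "step T (jWFs (scope_code B) ts (num n) l)"
  then show "\<exists>ss. ts = enc (map fm_code ss) \<and> (\<forall>s\<in>set ss. well_formed_fm B s) \<and>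
     l = num (n + sum_list (map fm_length ss))"
    unfolding step_jWFs
  proof (elim disjE exE conjE, goal_cases)
    case 1
    then show ?case by (intro exI[of _ "[]"]) simp
  next
    case (2 t l1 ts')
    from assms(1) 2(1) obtain s where s: "t = fm_code s" "well_formed_fm B s" "l1 = num (n + fm_length s)"
      unfolding sound_WF_def by blast
    from assms(2) 2(2) obtain ss where "ts' = enc (map fm_code ss)" "\<forall>s\<in>set ss. well_formed_fm B s"
      "l = num (n + fm_length s + sum_list (map fm_length ss))" unfolding sound_WFs_def s(3) by blast
    with s 2 show ?case by (intro exI[of _ "s # ss"]) simp
  qed
qed

lemma sound_WF_step:
  assumes "sound_WT T" "sound_WTs T" "sound_WF T"
  shows "sound_WF (step T)"
  unfolding sound_WF_def
proof (intro allI impI)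
  fix B t n l
  assume "step T (jWF (scope_code B) t (num n) l)"
  then show "\<exists>s. t = fm_code s \<and> well_formed_fm B s \<and> l = num (n + fm_length s)"
    unfolding step_jWF
  proof (elim disjE exE conjE, goal_cases)
    case (1 b R ts l1)
    from 1(2) obtain R' where R': "is_rsym L R'" "R = num (rsym_code cr R')" "len_rel ts (num (arity L R'))"
      "b = num (Suc 0) \<and> add_rel (Suc 0) (num n) l1 \<or> b = num 0 \<and> R' \<in> neg_rels L \<and> add_rel 2 (num n) l1"
      unfolding atom_wf_rel_def by blast
    define c where "c \<longleftrightarrow> b = num (Suc 0)"
    have R: "is_rsym L R'" "R = num (rsym_code cr R')" "len_rel ts (num (arity L R'))"
      "b = bool_code c" "\<not> c \<longrightarrow> R' \<in> neg_rels L" "l1 = num (n + (if c then 1 else 2))"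
      using R' by (auto simp: c_def bool_code_def)
    from assms(2) 1(3) obtain ss where ss: "ts = enc (map trm_code ss)" "\<forall>s\<in>set ss. well_formed_trm B s"
      "l = num (n + (if c then 1 else 2) + sum_list (map trm_length ss))"
      unfolding sound_WTs_def R(6) by blast
    with 1(1) R show ?case
      by (intro exI[of _ "Atom c R' ss"]) (auto simp: well_formed_trm_def well_formed_fm_def)
  next
    case (2 b l1 \<phi> l2 \<psi>)
    then obtain c where c: "b = bool_code c" by (auto simp: bool_rel_iff)
    from 2 have l1: "l1 = num (n + 1)" by simp
    from assms(3) 2(4) obtain s where s: "\<phi> = fm_code s" "well_formed_fm B s" "l2 = num (n + 1 + fm_length s)"
      unfolding sound_WF_def l1 by blast
    from assms(3) 2(5) obtain s' where s': "\<psi> = fm_code s'" "well_formed_fm B s'"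
      "l = num (n + 1 + fm_length s + fm_length s')" unfolding sound_WF_def s(3) by blast
    show ?case using 2(1) c s s'
      by (intro exI[of _ "if c then And s s' else Or s s'"]) (auto simp: well_formed_fm_def)
  next
    case (3 b x l1 t l2 B' \<phi>)
    from 3(2) obtain c where c: "b = bool_code c" unfolding bq_rel_def num_bool_code by blast
    from 3 obtain m where m: "x = num m" by (auto simp: is_number_def)
    from 3 have l1: "l1 = num (n + 3)" by simp
    from 3(6) m have B': "B' = scope_code ([m] # B)" by simp
    from assms(1) 3(5) obtain s where s: "t = trm_code s" "well_formed_trm B s" "l2 = num (n + 3 + trm_length s)"
      unfolding sound_WT_def l1 by blast
    from assms(3) 3(7) obtain s' where s': "\<phi> = fm_code s'" "well_formed_fm ([m] # B) s'"
      "l = num (n + 3 + trm_length s + fm_length s')" unfolding sound_WF_def s(3) B' by blast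
    show ?case using 3(1,2) c m s s'
      by (intro exI[of _ "if c then BAll m s s' else BEx m s s'"])
         (auto simp: well_formed_fm_def well_formed_trm_def split: if_splits)
  next
    case (4 b x l1 B' \<phi>)
    then obtain c where c: "b = bool_code c" by (auto simp: bool_rel_iff)
    from 4 obtain m where m: "x = num m" by (auto simp: is_number_def)
    from 4 have l1: "l1 = num (n + 2)" by simp
    from 4(5) m have B': "B' = scope_code ([m] # B)" by simp
    from assms(3) 4(6) obtain s' where s': "\<phi> = fm_code s'" "well_formed_fm ([m] # B) s'"
      "l = num (n + 2 + fm_length s')" unfolding sound_WF_def l1 B' by blast
    show ?case using 4(1) c m s'
      by (intro exI[of _ "if c then All m s' else Ex m s'"]) (auto simp: well_formed_fm_def)
  qed
qed

section \<open>Iterates of the evaluation operator\<close>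

definition "stage k = (step ^^ k) (\<lambda>_. False)"

lemma stage_0 [simp]: "stage 0 = (\<lambda>_. False)"
  by (simp add: stage_def)

lemma stage_Suc [simp]: "stage (Suc k) = step (stage k)"
  by (simp add: stage_def)

lemma sound_stage:
  "sound_T (stage k) \<and> sound_Ts (stage k) \<and> sound_F (stage k) \<and> sound_Inst (stage k) \<and>
   sound_Bound (stage k) \<and> sound_Neg (stage k) \<and> sound_WT (stage k) \<and> sound_WTs (stage k) \<and>
   sound_WF (stage k) \<and> sound_WFs (stage k)"
proof (induct k)
  case 0
  show ?case
    unfolding sound_T_def sound_Ts_def sound_F_def sound_Inst_def sound_Bound_def sound_Neg_def
      sound_WT_def sound_WTs_def sound_WF_def sound_WFs_def by simp
next
  case (Suc k)
  then show ?case
    by (simp add: sound_T_step sound_Ts_step sound_F_step sound_Inst_step sound_Bound_step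
        sound_Neg_step sound_WT_step sound_WTs_step sound_WF_step sound_WFs_step)
qed

text \<open>The first round yields 0 and every further round one more number. The stage thus
  compares a length with a number given by the count of rounds.\<close>

lemma stage_Le: "stage k (jLe l) \<longleftrightarrow> (\<exists>m<k. l = num m)"
proof (induct k arbitrary: l)
  case (Suc k)
  show ?case
    unfolding stage_Suc step_jLe Suc by (auto simp: Ex_less_Suc2 add_rel_def)
qed simp

end

context coded_language
begin

subsection \<open>Completeness of the evaluation operator\<close>

text \<open>Rounds paid for by one symbol of a proper expression. If the symbol is a QLO, its reduct
  is evaluated at 4 rounds per symbol; the sum over all QLOs bounds each reduct, and 8 is a safety
  margin.\<close>

definition eval_rate :: nat where
  "eval_rate = 4 * (\<Sum>q\<in>qlos L. fm_length (reduct L q)) + 8"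

fun rate :: "('a, 'f, 'r, 'q) frame \<Rightarrow> nat" where
  "rate None = eval_rate"
| "rate (Some _) = 4"

text \<open>The reserve for the arguments stored in a frame. A hole passes to one of them, and calls
  from different holes run in parallel, so the sum is ample however often an argument occurs in the
  reduct.\<close>

fun base :: "('a, 'f, 'r, 'q) frame \<Rightarrow> nat" where
  "base None = 0"
| "base (Some (e, xs, ts, \<phi>s)) = eval_rate * (sum_list (map trm_length ts) + sum_list (map fm_length \<phi>s))"

lemma rate_ge: "4 \<le> rate F" "8 \<le> eval_rate"
  by (cases F) (simp_all add: eval_rate_def)

lemma eval_rate_reduct: "q \<in> qlos L \<Longrightarrow> 4 * fm_length (reduct L q) + 8 \<le> eval_rate"
  using member_le_sum[of q "qlos L" "\<lambda>q. fm_length (reduct L q)"] finite_symbols(2)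
  by (simp add: eval_rate_def)

lemma base_ge:
  "i < length ts \<Longrightarrow> eval_rate * trm_length (ts ! i) \<le> base (Some (e, xs, ts, \<phi>s))"
  "j < length \<phi>s \<Longrightarrow> eval_rate * fm_length (\<phi>s ! j) \<le> base (Some (e, xs, ts, \<phi>s))"
  using member_le_sum_list[of "trm_length (ts ! i)" "map trm_length ts"]
    member_le_sum_list[of "fm_length (\<phi>s ! j)" "map fm_length \<phi>s"]
  by (simp_all add: trans_le_add1 trans_le_add2)

text \<open>
  The bounds on \<open>k\<close> are chosen such that each premise of a rule needs one iteration less than
  its conclusion.
\<close>

definition "complete_T k T \<longleftrightarrow> (\<forall>F e t v. okT F e t \<longrightarrow> TV F (env_val e) t = Some v \<longrightarrow>
  base F + rate F * trm_length t \<le> k \<longrightarrow> T (jT (frame_code F) (env_code e) (trm_code t) v))"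
definition "complete_Ts k T \<longleftrightarrow> (\<forall>F e ts vs. (\<forall>t\<in>set ts. okT F e t) \<longrightarrow>
  map (TV F (env_val e)) ts = map Some vs \<longrightarrow> base F + rate F * sum_list (map trm_length ts) + 1 \<le> k \<longrightarrow>
  T (jTs (frame_code F) (env_code e) (enc (map trm_code ts)) (enc vs)))"
definition "complete_F k T \<longleftrightarrow> (\<forall>F e \<phi> b. okM F e \<phi> \<longrightarrow> FV F (env_val e) \<phi> = Some b \<longrightarrow>
  base F + rate F * fm_length \<phi> \<le> k \<longrightarrow> T (jF (frame_code F) (env_code e) (fm_code \<phi>) (bool_code b)))"
definition "complete_Det k T \<longleftrightarrow> (\<forall>F e \<phi> b. okM F e \<phi> \<longrightarrow> FV F (env_val e) \<phi> = Some b \<longrightarrow>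
  base F + rate F * fm_length \<phi> + 1 \<le> k \<longrightarrow> T (jF (frame_code F) (env_code e) (fm_code \<phi>) (num 2)))"
definition "complete_Inst k T \<longleftrightarrow> (\<forall>F e \<phi> u v. okM F e \<phi> \<longrightarrow>
  (\<forall>(e', \<phi>')\<in>insts L e \<phi> u. fval_is F e' \<phi>' v) \<longrightarrow> base F + rate F * (fm_length \<phi> - 1) + 2 \<le> k \<longrightarrow>
  T (jInst (frame_code F) (env_code e) (fm_code \<phi>) u v))"
definition "complete_Bound k T \<longleftrightarrow> (\<forall>F e \<phi> u. okM F e \<phi> \<longrightarrow> polarity \<phi> \<noteq> None \<longrightarrow>
  bound_is F e \<phi> u \<longrightarrow> base F + rate F * (fm_length \<phi> - 1) + 2 \<le> k \<longrightarrow>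
  T (jBound (frame_code F) (env_code e) (fm_code \<phi>) u))"
definition "complete_Neg k T \<longleftrightarrow> (\<forall>F e \<phi>. okM F e \<phi> \<longrightarrow> negatable L (NF F) \<phi> \<longrightarrow>
  base F + rate F * (fm_length \<phi> - 1) + 2 \<le> k \<longrightarrow> T (jNeg (frame_code F) (fm_code \<phi>)))"
definition "complete_WT k T \<longleftrightarrow> (\<forall>B s n. well_formed_trm B s \<longrightarrow> eval_rate * trm_length s \<le> k \<longrightarrow>
  T (jWT (scope_code B) (trm_code s) (num n) (num (n + trm_length s))))"
definition "complete_WTs k T \<longleftrightarrow> (\<forall>B ss n. (\<forall>s\<in>set ss. well_formed_trm B s) \<longrightarrow>
  eval_rate * sum_list (map trm_length ss) + 1 \<le> k \<longrightarrow>
  T (jWTs (scope_code B) (enc (map trm_code ss)) (num n) (num (n + sum_list (map trm_length ss)))))"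
definition "complete_WF k T \<longleftrightarrow> (\<forall>B s n. well_formed_fm B s \<longrightarrow> eval_rate * fm_length s \<le> k \<longrightarrow>
  T (jWF (scope_code B) (fm_code s) (num n) (num (n + fm_length s))))"
definition "complete_WFs k T \<longleftrightarrow> (\<forall>B ss n. (\<forall>s\<in>set ss. well_formed_fm B s) \<longrightarrow>
  eval_rate * sum_list (map fm_length ss) + 1 \<le> k \<longrightarrow>
  T (jWFs (scope_code B) (enc (map fm_code ss)) (num n) (num (n + sum_list (map fm_length ss)))))"

lemma complete_T_step:
  assumes "complete_T k T" "complete_Ts k T" "complete_F k T"
  shows "complete_T (Suc k) (step T)"
  unfolding complete_T_def
proof (intro allI impI)
  fix F e t v
  assume ok: "okT F e t" and v: "TV F (env_val e) t = Some v"
    and k: "base F + rate F * trm_length t \<le> Suc k"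
  show "step T (jT (frame_code F) (env_code e) (trm_code t) v)"
  proof (cases t)
    case (Var x)
    with ok have "x \<in> scope e" by (simp add: okT_def)
    with v Var have "lookup_rel (env_code e) (num x) v" by (simp add: lookup_rel_iff scopeD)
    then show ?thesis using Var by (simp add: step.Var)
  next
    case (Fun f ts)
    then obtain vs where vs: "map (TV F (env_val e)) ts = map Some vs" "v = fun_val L f vs"
      using v by (auto simp: those_eq_Some_iff simp del: map_eq_conv)
    have f: "f \<in> funs L" "length ts = fun_arity L f" "\<forall>t\<in>set ts. okT F e t" using okT_Fun ok Fun by blast+
    have "length vs = length ts" using vs(1) by (metis length_map)
    with f vs have "app_rel (num (cf f)) (enc vs) v" by (auto simp: app_rel_def)
    moreover have "base F + rate F * sum_list (map trm_length ts) + 1 \<le> k"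
      using k Fun rate_ge(1)[of F] by (simp add: algebra_simps)
    with assms(2) f(3) vs(1) have "T (jTs (frame_code F) (env_code e) (enc (map trm_code ts)) (enc vs))"
      unfolding complete_Ts_def by blast
    ultimately show ?thesis unfolding Fun by (simp add: step.Fun)
  next
    case (Qlo q xs ts \<phi>s)
    have F: "F = None" using ok Qlo by (cases F) (auto simp: okT_def)
    let ?F = "Some (e, xs, ts, \<phi>s)"
    from ok Qlo F have ok': "okT None e (Qlo q xs ts \<phi>s)" by simp
    then have q: "q \<in> qlos L" by simp
    have "FV ?F (env_val [([0], [v])]) (reduct L q) = Some True"
      using v qlo_val_iff(2)[OF ok' refl, of v] unfolding Qlo F by blast
    \<comment> \<open>The arguments of the QLO become the reserve \<open>base ?F\<close>, and the
      QLO symbol itself pays for the reduct.\<close>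
    moreover have "base ?F + rate ?F * fm_length (reduct L q) \<le> k"
      using k eval_rate_reduct[OF q] unfolding Qlo F by (simp add: algebra_simps)
    ultimately have "T (jF (frame_code ?F) (env_code [([0], [v])]) (fm_code (reduct L q)) (bool_code True))"
      using assms(3) qlo_val_iff(1)[OF ok' refl] unfolding complete_F_def by blast
    then have "T (jF (enc [env_code e, enc (map num xs), enc (map trm_code ts), enc (map fm_code \<phi>s)])
        (enc [enc [enc [num 0], enc [v]]]) (fm_code (reduct L q)) (num (Suc 0)))"
      unfolding env_code_single num_bool_code(2) by simp
    moreover have "reduct_rel (num (cq q)) (fm_code (reduct L q))" using q by (auto simp: reduct_rel_def)
    ultimately show ?thesis
      unfolding Qlo F trm_code.simps frame_code.simps(1) by (intro step.Qlo)
  next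
    case (TPar i ts)
    from ok[unfolded TPar] obtain e0 xs ts0 \<phi>s0 where F: "F = Some (e0, xs, ts0, \<phi>s0)" "i < length ts0"
      "length ts = length xs" "\<forall>t\<in>set ts. okT F e t" "okF F" by (rule okT_TPar)
    from v TPar obtain vs where vs: "map (TV F (env_val e)) ts = map Some vs" "PF F i vs = Some v"
      by (auto simp: those_eq_Some_iff bind_eq_Some_conv simp del: map_eq_conv)
    then have l: "length vs = length xs" using F(3) by (metis length_map)
    have ok': "okT None ((xs, vs) # e0) (ts0 ! i)" using F l by auto
    have "base F + rate F * sum_list (map trm_length ts) + 1 \<le> k"
      using k TPar rate_ge(1)[of F] by (simp add: algebra_simps)
    with assms(2) F(4) vs(1) have 1: "T (jTs (frame_code F) (env_code e) (enc (map trm_code ts)) (enc vs))"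
      unfolding complete_Ts_def by blast
    have "TV None (env_val ((xs, vs) # e0)) (ts0 ! i) = Some v" using vs(2) F by (simp add: trm_val_def)
    \<comment> \<open>The reserve covers the stored argument, and the hole itself pays for the round
      that passes to it.\<close>
    moreover have "base None + rate None * trm_length (ts0 ! i) \<le> k"
    proof -
      have "1 \<le> rate F * trm_length t" using rate_ge(1)[of F] length_pos(1)[of t] by simp
      then show ?thesis
        using base_ge(1)[OF F(2), of e0 xs \<phi>s0, folded F(1)] k unfolding base.simps(1) rate.simps(1) by linarith
    qed
    ultimately have 2: "T (jT (enc []) (env_code ((xs, vs) # e0)) (trm_code (ts0 ! i)) v)"
      using assms(1) ok' unfolding complete_T_def by (metis frame_code.simps(1))
    show ?thesis
      unfolding TPar trm_code.simps
      by (rule step.TPar[OF frame_code.simps(2)[of e0 xs ts0 \<phi>s0, folded F(1)] 1 _ _ 2]) (use F(2) in simp_all)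
  qed
qed

lemma complete_Ts_step:
  assumes "complete_T k T" "complete_Ts k T"
  shows "complete_Ts (Suc k) (step T)"
  unfolding complete_Ts_def
proof (intro allI impI)
  fix F e ts vs
  assume ok: "\<forall>t\<in>set ts. okT F e t" and v: "map (TV F (env_val e)) ts = map Some vs"
    and k: "base F + rate F * sum_list (map trm_length ts) + 1 \<le> Suc k"
  show "step T (jTs (frame_code F) (env_code e) (enc (map trm_code ts)) (enc vs))"
  proof (cases ts)
    case Nil
    then show ?thesis using v by (simp add: step.TsNil)
  next
    case (Cons t ts')
    with v obtain a vs' where vs: "vs = a # vs'" "TV F (env_val e) t = Some a" "map (TV F (env_val e)) ts' = map Some vs'"
      by (cases vs) auto
    \<comment> \<open>Head and tail are evaluated in parallel. The head has at least one symbol, so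
      the tail gets at least \<open>rate F\<close> rounds less and the step along the list is paid
      for.\<close>
    have "rate F \<le> rate F * trm_length t" using length_pos(1)[of t] by simp
    moreover have "rate F * sum_list (map trm_length ts) = rate F * trm_length t + rate F * sum_list (map trm_length ts')"
      by (simp add: Cons distrib_left)
    ultimately have "base F + rate F * trm_length t \<le> k" "base F + rate F * sum_list (map trm_length ts') + 1 \<le> k"
      using k rate_ge(1)[of F] by linarith+
    with assms vs(2,3) ok Cons have "T (jT (frame_code F) (env_code e) (trm_code t) a)"
      "T (jTs (frame_code F) (env_code e) (enc (map trm_code ts')) (enc vs'))"
      unfolding complete_T_def complete_Ts_def by (metis list.set_intros)+
    then show ?thesis by (rule step.TsCons) (simp_all add: Cons vs(1))
  qed
qed

lemma complete_Det_step:
  assumes "complete_F k T"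
  shows "complete_Det (Suc k) (step T)"
  unfolding complete_Det_def
proof (intro allI impI)
  fix F e \<phi> b
  assume "okM F e \<phi>" "FV F (env_val e) \<phi> = Some b" "base F + rate F * fm_length \<phi> + 1 \<le> Suc k"
  with assms have "T (jF (frame_code F) (env_code e) (fm_code \<phi>) (bool_code b))"
    unfolding complete_F_def by simp
  then show "step T (jF (frame_code F) (env_code e) (fm_code \<phi>) (num 2))"
    by (rule step.Det) (auto simp: bool_rel_iff)
qed

lemma complete_Inst_step:
  assumes "complete_F k T" "complete_Det k T"
  shows "complete_Inst (Suc k) (step T)"
  unfolding complete_Inst_def step_jInst inst_prem_def
proof (intro allI impI, elim exE conjE)
  fix F e \<phi> u v y e' \<phi>'
  assume ok: "okM F e \<phi>" and all: "\<forall>(e', \<phi>')\<in>insts L e \<phi> u. fval_is F e' \<phi>' v"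
    and k: "base F + rate F * (fm_length \<phi> - 1) + 2 \<le> Suc k"
    and i: "inst_rel (env_code e) (fm_code \<phi>) u e' \<phi>'" and y: "y = jF (frame_code F) e' \<phi>' v"
  from i obtain e1 \<phi>1 where 1: "(e1, \<phi>1) \<in> insts L e \<phi> u" "e' = env_code e1" "\<phi>' = fm_code \<phi>1"
    unfolding inst_rel_iff[OF ok] by blast
  \<comment> \<open>Instances are shorter than the formula, which absorbs the additional round of
    \<open>Det\<close>.\<close>
  have "fm_length \<phi>1 \<le> fm_length \<phi> - 1" using insts_length[OF 1(1)] by simp
  then have "rate F * fm_length \<phi>1 \<le> rate F * (fm_length \<phi> - 1)" by (rule mult_le_mono2)
  with k have k': "base F + rate F * fm_length \<phi>1 + 1 \<le> k" by linarith
  have ok1: "okM F e1 \<phi>1" by (rule okM_insts[OF ok 1(1)])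
  from all 1(1) have "fval_is F e1 \<phi>1 v" by blast
  then consider b where "v = bool_code b" "FV F (env_val e1) \<phi>1 = Some b" |
    b where "v = num 2" "FV F (env_val e1) \<phi>1 = Some b" unfolding fval_is_def by blast
  then show "T y"
  proof cases
    case 1
    then show ?thesis using assms(1) ok1 k' unfolding y \<open>e' = _\<close> \<open>\<phi>' = _\<close> complete_F_def by simp
  next
    case 2
    then show ?thesis using assms(2) ok1 k' unfolding y \<open>e' = _\<close> \<open>\<phi>' = _\<close> complete_Det_def by blast
  qed
qed

lemma complete_Bound_step:
  assumes "complete_T k T"
  shows "complete_Bound (Suc k) (step T)"
  unfolding complete_Bound_def
proof (intro allI impI)
  fix F e \<phi> u
  assume ok: "okM F e \<phi>" and p: "polarity \<phi> \<noteq> None" and b: "bound_is F e \<phi> u"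
    and k: "base F + rate F * (fm_length \<phi> - 1) + 2 \<le> Suc k"
  have T: "T (jT (frame_code F) (env_code e) (trm_code t) u)"
    if "okT F e t" "TV F (env_val e) t = Some u" "trm_length t \<le> fm_length \<phi> - 1" for t
  proof -
    from that(3) have "rate F * trm_length t \<le> rate F * (fm_length \<phi> - 1)" by (rule mult_le_mono2)
    with k have "base F + rate F * trm_length t \<le> k" by linarith
    with assms that show ?thesis unfolding complete_T_def by blast
  qed
  show "step T (jBound (frame_code F) (env_code e) (fm_code \<phi>) u)"
  proof (cases \<phi>)
    case (BAll x t \<psi>)
    then show ?thesis using b okM_bound(1)[OF ok[unfolded BAll]] T[of t] by (simp add: step_jBound)
  next
    case (BEx x t \<psi>)
    then show ?thesis using b okM_bound(2)[OF ok[unfolded BEx]] T[of t] by (simp add: step_jBound)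
  qed (use p in \<open>simp_all add: step_jBound\<close>)
qed

lemma complete_Neg_step:
  assumes "complete_Neg k T"
  shows "complete_Neg (Suc k) (step T)"
  unfolding complete_Neg_def
proof (intro allI impI)
  fix F e \<phi>
  assume ok: "okM F e \<phi>" and n: "negatable L (NF F) \<phi>" and k: "base F + rate F * (fm_length \<phi> - 1) + 2 \<le> Suc k"
  have T: "T (jNeg (frame_code F) (fm_code \<psi>))"
    if "okM F e' \<psi>" "negatable L (NF F) \<psi>" "fm_length \<psi> < fm_length \<phi>" for e' \<psi>
  proof -
    from that(3) length_pos(2)[of \<psi>] have "fm_length \<phi> - 1 = Suc (fm_length \<psi> - 1) + (fm_length \<phi> - fm_length \<psi> - 1)"
      by simp
    then have "rate F * (fm_length \<phi> - 1) \<ge> rate F * Suc (fm_length \<psi> - 1)" by (metis le_add1 mult_le_mono2)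
    with k rate_ge(1)[of F] have "base F + rate F * (fm_length \<psi> - 1) + 2 \<le> k" by simp
    with assms that show ?thesis unfolding complete_Neg_def by blast
  qed
  show "step T (jNeg (frame_code F) (fm_code \<phi>))"
  proof (cases \<phi>)
    case (Atom b R ts)
    then show ?thesis using n okM_Atom ok by (auto simp: step_jNeg neg_atom_rel_iff)
  next
    case (FPar b j ts)
    from ok[unfolded FPar] obtain e0 xs ts0 \<phi>s0 where F: "F = Some (e0, xs, ts0, \<phi>s0)" "j < length \<phi>s0" "okF F"
      by (rule okM_FPar)
    have ok': "okM None ((xs, replicate (length xs) undefined) # e0) (\<phi>s0 ! j)" using F by auto
    show ?thesis
    proof (cases b)
      case True
      then have "negatable L (NF None) (\<phi>s0 ! j)" using n FPar F by simp
      moreover have "base None + rate None * (fm_length (\<phi>s0 ! j) - 1) + 2 \<le> k"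
      proof -
        have "Suc (fm_length (\<phi>s0 ! j) - 1) = fm_length (\<phi>s0 ! j)" using length_pos(2)[of "\<phi>s0 ! j"] by simp
        then have "eval_rate * fm_length (\<phi>s0 ! j) = eval_rate + eval_rate * (fm_length (\<phi>s0 ! j) - 1)"
          by (metis mult_Suc_right)
        then show ?thesis using base_ge(2)[OF F(2), of e0 xs ts0] k rate_ge(2) unfolding F(1) by simp
      qed
      ultimately have "T (jNeg (enc []) (fm_code (\<phi>s0 ! j)))"
        using assms ok' unfolding complete_Neg_def by (metis frame_code.simps(1))
      then show ?thesis using FPar F True by (simp add: step_jNeg)
    next
      case False
      then show ?thesis using FPar by (simp add: step_jNeg)
    qed
  next
    case (And \<psi> \<psi>')
    then show ?thesis using n T[of e \<psi>] T[of e \<psi>'] okM_and(1)[OF ok[unfolded And]] by (simp add: step_jNeg)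
  next
    case (Or \<psi> \<psi>')
    then show ?thesis using n T[of e \<psi>] T[of e \<psi>'] okM_and(2)[OF ok[unfolded Or]] by (simp add: step_jNeg)
  next
    case (BAll x t \<psi>)
    then show ?thesis using n T[OF okM_body(1)[OF ok[unfolded BAll]]] by (simp add: step_jNeg)
  next
    case (BEx x t \<psi>)
    then show ?thesis using n T[OF okM_body(2)[OF ok[unfolded BEx]]] by (simp add: step_jNeg)
  next
    case (All x \<psi>)
    then show ?thesis using n T[OF okM_body(3)[OF ok[unfolded All]]] by (simp add: step_jNeg)
  next
    case (Ex x \<psi>)
    then show ?thesis using n T[OF okM_body(4)[OF ok[unfolded Ex]]] by (simp add: step_jNeg)
  qed
qed

lemma complete_F_step:
  assumes "complete_Ts k T" "complete_F k T" "complete_Inst k T" "complete_Bound k T" "complete_Neg k T"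
  shows "complete_F (Suc k) (step T)"
  unfolding complete_F_def
proof (intro allI impI)
  fix F e \<phi> b
  assume ok: "okM F e \<phi>" and v: "FV F (env_val e) \<phi> = Some b"
    and k: "base F + rate F * fm_length \<phi> \<le> Suc k"
  show "step T (jF (frame_code F) (env_code e) (fm_code \<phi>) (bool_code b))"
  proof (cases "polarity \<phi>")
    case (Some c)
    \<comment> \<open>The longest chain to a shorter formula passes through \<open>jInst\<close> and
      the value 2 and takes three rounds. A rate of 4 per symbol covers it.\<close>
    have k': "base F + rate F * (fm_length \<phi> - 1) + 2 \<le> k"
    proof -
      have "Suc (fm_length \<phi> - 1) = fm_length \<phi>" using length_pos(2)[of \<phi>] by simp
      then have "rate F * fm_length \<phi> = rate F + rate F * (fm_length \<phi> - 1)" by (metis mult_Suc_right)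
      then show ?thesis using k rate_ge(1)[of F] by simp
    qed
    from v obtain u where u: "bound_is F e \<phi> u" "\<not> b \<longrightarrow> negatable L (NF F) \<phi>"
      "b = c \<and> (\<forall>(e', \<phi>')\<in>insts L e \<phi> u. FV F (env_val e') \<phi>' = Some c) \<or>
       b = (\<not> c) \<and> (\<forall>(e', \<phi>')\<in>insts L e \<phi> u. FV F (env_val e') \<phi>' \<noteq> None) \<and>
       (\<exists>(e', \<phi>')\<in>insts L e \<phi> u. FV F (env_val e') \<phi>' = Some (\<not> c))"
      unfolding FV_compound[OF Some] by blast
    have B: "T (jBound (frame_code F) (env_code e) (fm_code \<phi>) u)"
      using assms(4) ok Some u(1) k' unfolding complete_Bound_def by blast
    have N: "\<not> b \<Longrightarrow> T (jNeg (frame_code F) (fm_code \<phi>))"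
      using assms(5) ok u(2) k' unfolding complete_Neg_def by blast
    have P: "pol_rel (fm_code \<phi>) (bool_code c)" using Some by (simp add: pol_rel_iff)
    from u(3) show ?thesis
    proof (elim disjE conjE)
      assume bc: "b = c" and a: "\<forall>(e', \<phi>')\<in>insts L e \<phi> u. FV F (env_val e') \<phi>' = Some c"
      have "T (jInst (frame_code F) (env_code e) (fm_code \<phi>) u (bool_code c))"
        using assms(3) ok a k' unfolding complete_Inst_def fval_is_bool[symmetric] by blast
      then show ?thesis
        using B N P bc step.AllTrue[of "fm_code \<phi>" T "frame_code F" "env_code e" u]
          step.ExFalse[of "fm_code \<phi>" T "frame_code F" "env_code e" u]
        unfolding num_bool_code by (cases b) simp_all
    next
      assume bc: "b = (\<not> c)" and a: "\<forall>(e', \<phi>')\<in>insts L e \<phi> u. FV F (env_val e') \<phi>' \<noteq> None"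
        and "\<exists>(e', \<phi>')\<in>insts L e \<phi> u. FV F (env_val e') \<phi>' = Some (\<not> c)"
      then obtain e1 \<phi>1 where 1: "(e1, \<phi>1) \<in> insts L e \<phi> u" "FV F (env_val e1) \<phi>1 = Some b" by blast
      have "\<forall>(e', \<phi>')\<in>insts L e \<phi> u. fval_is F e' \<phi>' (num 2)" using a by (auto simp: fval_is_def)
      then have I: "T (jInst (frame_code F) (env_code e) (fm_code \<phi>) u (num 2))"
        using assms(3) ok k' unfolding complete_Inst_def by blast
      have "fm_length \<phi>1 \<le> fm_length \<phi> - 1" using insts_length[OF 1(1)] by simp
      then have "rate F * fm_length \<phi>1 \<le> rate F * (fm_length \<phi> - 1)" by (rule mult_le_mono2)
      with k' have "base F + rate F * fm_length \<phi>1 \<le> k" by linarith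
      with assms(2) okM_insts[OF ok 1(1)] 1(2)
      have W: "T (jF (frame_code F) (env_code e1) (fm_code \<phi>1) (bool_code b))"
        unfolding complete_F_def by blast
      have i: "inst_rel (env_code e) (fm_code \<phi>) u (env_code e1) (fm_code \<phi>1)"
        unfolding inst_rel_iff[OF ok] using 1(1) by blast
      show ?thesis
        using B N P bc I W i step.AllFalse[of "fm_code \<phi>" T "frame_code F" "env_code e" u "env_code e1" "fm_code \<phi>1"]
          step.ExTrue[of "fm_code \<phi>" T "frame_code F" "env_code e" u "env_code e1" "fm_code \<phi>1"]
        unfolding num_bool_code by (cases b) simp_all
    qed
  next
    case None
    show ?thesis
    proof (cases \<phi>)
      case (Atom c R ts)
      have R: "is_rsym L R" "length ts = arity L R" "\<forall>t\<in>set ts. okT F e t" using okM_Atom ok Atom by blast+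
      from v Atom obtain vs where vs: "map (TV F (env_val e)) ts = map Some vs"
        "(if sat L R vs then Some c else if R \<in> neg_rels L \<and> fails L R vs then Some (\<not> c) else None) = Some b"
        by (auto simp: those_eq_Some_iff bind_eq_Some_conv simp del: map_eq_conv)
      then have l: "length vs = arity L R" using R(2) by (metis length_map)
      have "base F + rate F * sum_list (map trm_length ts) + 1 \<le> k"
        using k Atom rate_ge(1)[of F] by (simp add: algebra_simps split: if_splits)
      with assms(1) R(3) vs(1) have "T (jTs (frame_code F) (env_code e) (enc (map trm_code ts)) (enc vs))"
        unfolding complete_Ts_def by blast
      moreover have "atom_rel (bool_code c) (num (rsym_code cr R)) (enc vs) (bool_code b)"
        unfolding atom_rel_iff[OF R(1) l] using vs(2) by (auto split: if_splits)
      ultimately show ?thesis unfolding Atom fm_code.simps by (rule step.Atom)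
    next
      case (FPar c j ts)
      from ok[unfolded FPar] obtain e0 xs ts0 \<phi>s0 where F: "F = Some (e0, xs, ts0, \<phi>s0)" "j < length \<phi>s0"
        "length ts = length xs" "\<forall>t\<in>set ts. okT F e t" "okF F" by (rule okM_FPar)
      from v FPar obtain vs where vs: "map (TV F (env_val e)) ts = map Some vs"
        "(if c then GF F j vs else map_option Not (GF F j vs)) = Some b"
        by (auto simp: those_eq_Some_iff bind_eq_Some_conv simp del: map_eq_conv)
      then have l: "length vs = length xs" using F(3) by (metis length_map)
      have ok': "okM None ((xs, vs) # e0) (\<phi>s0 ! j)" using F l by auto
      have "base F + rate F * sum_list (map trm_length ts) + 1 \<le> k"
        using k FPar rate_ge(1)[of F] by (simp add: algebra_simps split: if_splits)
      with assms(1) F(4) vs(1) have 1: "T (jTs (frame_code F) (env_code e) (enc (map trm_code ts)) (enc vs))"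
        unfolding complete_Ts_def by blast
      have G: "GF F j vs = Some (if c then b else \<not> b)" using vs(2) by (auto split: if_splits)
      then have "FV None (env_val ((xs, vs) # e0)) (\<phi>s0 ! j) = Some (if c then b else \<not> b)"
        using F by (simp add: fm_val_def)
      moreover have "base None + rate None * fm_length (\<phi>s0 ! j) \<le> k"
      proof -
        have "1 \<le> rate F * fm_length \<phi>" using rate_ge(1)[of F] length_pos(2)[of \<phi>] by simp
        then show ?thesis
          using base_ge(2)[OF F(2), of e0 xs ts0, folded F(1)] k unfolding base.simps(1) rate.simps(1) by linarith
      qed
      ultimately have 2: "T (jF (enc []) (env_code ((xs, vs) # e0)) (fm_code (\<phi>s0 ! j)) (bool_code (if c then b else \<not> b)))"
        using assms(2) ok' unfolding complete_F_def by (metis frame_code.simps(1))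
      show ?thesis
        unfolding FPar fm_code.simps
        by (rule step.FPar[OF frame_code.simps(2)[of e0 xs ts0 \<phi>s0, folded F(1)] 1 _ _ 2])
           (use F(2) in \<open>auto simp: sign_rel_iff\<close>)
    qed (use None in simp_all)
  qed
qed


lemma complete_WT_step:
  assumes "complete_WTs k T" "complete_WFs k T" "complete_Neg k T"
  shows "complete_WT (Suc k) (step T)"
  unfolding complete_WT_def
proof (intro allI impI)
  fix B s n
  assume wf: "well_formed_trm B s" and k: "eval_rate * trm_length s \<le> Suc k"
  show "step T (jWT (scope_code B) (trm_code s) (num n) (num (n + trm_length s)))"
  proof (cases s)
    case (Var x)
    then show ?thesis using wf by (simp add: step_jWT scope_rel_iff well_formed_trm_def)
  next
    case (Fun f ts)
    have f: "f \<in> funs L" "length ts = fun_arity L f" "\<forall>t\<in>set ts. well_formed_trm B t"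
      using wf Fun by (auto simp: well_formed_trm_def)
    have "eval_rate * sum_list (map trm_length ts) + 1 \<le> k"
      using k Fun rate_ge(2) by (simp add: algebra_simps)
    with assms(1) f(3) have "T (jWTs (scope_code B) (enc (map trm_code ts)) (num (n + Suc 0))
        (num (n + Suc 0 + sum_list (map trm_length ts))))"
      unfolding complete_WTs_def by blast
    moreover have "fun_wf_rel (num (cf f)) (enc (map trm_code ts))" using f by (auto simp: fun_wf_rel_def)
    ultimately show ?thesis unfolding Fun by (simp add: step_jWT)
  next
    case (Qlo q xs ts \<phi>s)
    have q: "q \<in> qlos L" "length xs = qlo_vars L q" "length ts = qlo_terms L q" "length \<phi>s = qlo_forms L q"
      "distinct xs" "\<forall>j<length \<phi>s. j \<in> qlo_neg L q \<longrightarrow> negatable L {} (\<phi>s ! j)"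
      "\<forall>t\<in>set ts. well_formed_trm (xs # B) t" "\<forall>\<phi>\<in>set \<phi>s. well_formed_fm (xs # B) \<phi>"
      using wf Qlo by (auto simp: well_formed_trm_def well_formed_fm_def)
    let ?t = "sum_list (map trm_length ts)" and ?f = "sum_list (map fm_length \<phi>s)"
    have k': "eval_rate * ?t + 1 \<le> k" "eval_rate * ?f + 1 \<le> k"
      using k Qlo rate_ge(2) by (simp_all add: algebra_simps)
    have 1: "T (jWTs (scope_code (xs # B)) (enc (map trm_code ts)) (num (n + Suc (length xs)))
        (num (n + Suc (length xs) + ?t)))"
      using assms(1) q(7) k'(1) unfolding complete_WTs_def by blast
    have 2: "T (jWFs (scope_code (xs # B)) (enc (map fm_code \<phi>s)) (num (n + Suc (length xs) + ?t))
        (num (n + Suc (length xs) + ?t + ?f)))"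
      using assms(2) q(8) k'(2) unfolding complete_WFs_def by blast
    have 3: "T y" if prem: "qlo_neg_prem (num (cq q)) (enc (map fm_code \<phi>s)) y" for y
    proof -
      obtain q' j \<phi> where "q' \<in> qlos L" "cq q = cq q'" "j \<in> qlo_neg L q'"
        "nth_rel (enc (map fm_code \<phi>s)) (num (Suc j)) \<phi>" and y: "y = jNeg (enc []) \<phi>"
        using prem by (auto simp: qlo_neg_prem_def)
      with inj_onD[OF inj_cq _ _ q(1)] have j: "j \<in> qlo_neg L q" "j < length \<phi>s" "\<phi> = fm_code (\<phi>s ! j)" by auto
      have "okM None [(concat (xs # B), replicate (length (concat (xs # B))) undefined)] (\<phi>s ! j)"
        using q(8)[rule_format, OF nth_mem[OF j(2)]] by (simp add: well_formed_fm_def)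
      moreover have "negatable L (NF None) (\<phi>s ! j)" using q(6) j by simp
      moreover have "base None + rate None * (fm_length (\<phi>s ! j) - 1) + 2 \<le> k"
      proof -
        have "fm_length (\<phi>s ! j) - 1 \<le> ?f"
          using member_le_sum_list[of "fm_length (\<phi>s ! j)" "map fm_length \<phi>s"] j(2) by simp
        then have "eval_rate * (fm_length (\<phi>s ! j) - 1) \<le> eval_rate * ?f" by (rule mult_le_mono2)
        moreover have "eval_rate * ?f + 2 \<le> k" using k Qlo rate_ge(2) by (simp add: algebra_simps)
        ultimately show ?thesis unfolding base.simps rate.simps by linarith
      qed
      ultimately have "T (jNeg (frame_code None) (fm_code (\<phi>s ! j)))"
        using assms(3) unfolding complete_Neg_def by blast
      then show ?thesis using y j by simp
    qed
    have 4: "qlo_wf_rel (num (cq q)) (enc (map num xs)) (enc (map trm_code ts)) (enc (map fm_code \<phi>s))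
        (num n) (num (n + Suc (length xs)))"
      unfolding qlo_wf_rel_def
    proof (intro bexI[of _ q] conjI allI impI)
      fix p x assume "nth_rel (enc (map num xs)) p x"
      then show "is_number x" by (auto simp: nth_rel_def)
    next
      fix p p' x assume "nth_rel (enc (map num xs)) p x \<and> nth_rel (enc (map num xs)) p' x"
      then show "p = p'" using q(5) by (auto simp: nth_rel_def nth_eq_iff_index_eq)
    qed (use q in simp_all)
    have "step T (jWT (scope_code B) (trm_code s) (num n) (num (n + Suc (length xs) + ?t + ?f)))"
      unfolding Qlo trm_code.simps by (rule step.WTQlo[where T = T, OF 4 _ 1 2]) (use 3 in simp_all)
    then show ?thesis by (simp add: Qlo add.assoc)
  next
    case (TPar i ts)
    then show ?thesis using wf by (simp add: well_formed_trm_def)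
  qed
qed

lemma complete_WTs_step:
  assumes "complete_WT k T" "complete_WTs k T"
  shows "complete_WTs (Suc k) (step T)"
  unfolding complete_WTs_def
proof (intro allI impI)
  fix B ss n
  assume wf: "\<forall>s\<in>set ss. well_formed_trm B s" and k: "eval_rate * sum_list (map trm_length ss) + 1 \<le> Suc k"
  show "step T (jWTs (scope_code B) (enc (map trm_code ss)) (num n) (num (n + sum_list (map trm_length ss))))"
  proof (cases ss)
    case Nil
    then show ?thesis by (simp add: step.WTsNil)
  next
    case (Cons t ts)
    let ?t = "sum_list (map trm_length ts)"
    have "eval_rate * 1 \<le> eval_rate * trm_length t" using length_pos(1)[of t] by (rule mult_le_mono2)
    moreover have "eval_rate * sum_list (map trm_length ss) = eval_rate * trm_length t + eval_rate * ?t"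
      by (simp add: Cons distrib_left)
    ultimately have k': "eval_rate * trm_length t \<le> k" "eval_rate * ?t + 1 \<le> k"
      using k rate_ge(2) by linarith+
    have "T (jWT (scope_code B) (trm_code t) (num n) (num (n + trm_length t)))"
      using assms(1) k'(1) wf Cons unfolding complete_WT_def by simp
    moreover have "T (jWTs (scope_code B) (enc (map trm_code ts)) (num (n + trm_length t)) (num (n + trm_length t + ?t)))"
      using assms(2) k'(2) wf Cons unfolding complete_WTs_def by simp
    ultimately have "step T (jWTs (scope_code B) (enc (map trm_code ss)) (num n) (num (n + trm_length t + ?t)))"
      by (rule step.WTsCons) (simp add: Cons)
    then show ?thesis by (simp add: Cons add.assoc)
  qed
qed

lemma complete_WFs_step:
  assumes "complete_WF k T" "complete_WFs k T"
  shows "complete_WFs (Suc k) (step T)"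
  unfolding complete_WFs_def
proof (intro allI impI)
  fix B ss n
  assume wf: "\<forall>s\<in>set ss. well_formed_fm B s" and k: "eval_rate * sum_list (map fm_length ss) + 1 \<le> Suc k"
  show "step T (jWFs (scope_code B) (enc (map fm_code ss)) (num n) (num (n + sum_list (map fm_length ss))))"
  proof (cases ss)
    case Nil
    then show ?thesis by (simp add: step.WFsNil)
  next
    case (Cons t ts)
    let ?t = "sum_list (map fm_length ts)"
    have "eval_rate * 1 \<le> eval_rate * fm_length t" using length_pos(2)[of t] by (rule mult_le_mono2)
    moreover have "eval_rate * sum_list (map fm_length ss) = eval_rate * fm_length t + eval_rate * ?t"
      by (simp add: Cons distrib_left)
    ultimately have k': "eval_rate * fm_length t \<le> k" "eval_rate * ?t + 1 \<le> k"
      using k rate_ge(2) by linarith+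
    have "T (jWF (scope_code B) (fm_code t) (num n) (num (n + fm_length t)))"
      using assms(1) k'(1) wf Cons unfolding complete_WF_def by simp
    moreover have "T (jWFs (scope_code B) (enc (map fm_code ts)) (num (n + fm_length t)) (num (n + fm_length t + ?t)))"
      using assms(2) k'(2) wf Cons unfolding complete_WFs_def by simp
    ultimately have "step T (jWFs (scope_code B) (enc (map fm_code ss)) (num n) (num (n + fm_length t + ?t)))"
      by (rule step.WFsCons) (simp add: Cons)
    then show ?thesis by (simp add: Cons add.assoc)
  qed
qed

lemma complete_WF_step:
  assumes "complete_WT k T" "complete_WTs k T" "complete_WF k T"
  shows "complete_WF (Suc k) (step T)"
  unfolding complete_WF_def
proof (intro allI impI)
  fix B s n
  assume wf: "well_formed_fm B s" and k: "eval_rate * fm_length s \<le> Suc k"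
  have T: "T (jWF (scope_code B') (fm_code \<psi>) (num m) (num (m + fm_length \<psi>)))"
    if "well_formed_fm B' \<psi>" "eval_rate * fm_length \<psi> \<le> k" for B' \<psi> m
    using assms(3) that unfolding complete_WF_def by blast
  have T': "T (jWT (scope_code B) (trm_code t) (num m) (num (m + trm_length t)))"
    if "well_formed_trm B t" "eval_rate * trm_length t \<le> k" for t m
    using assms(1) that unfolding complete_WT_def by blast
  show "step T (jWF (scope_code B) (fm_code s) (num n) (num (n + fm_length s)))"
  proof (cases s)
    case (Atom b R ts)
    have R: "is_rsym L R" "length ts = arity L R" "\<forall>t\<in>set ts. well_formed_trm B t" "\<not> b \<longrightarrow> R \<in> neg_rels L"
      using wf Atom by (auto simp: well_formed_fm_def well_formed_trm_def)
    let ?l = "if b then 1 else 2 :: nat"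
    have "eval_rate * sum_list (map trm_length ts) + 1 \<le> k"
      using k Atom rate_ge(2) by (simp add: algebra_simps split: if_splits)
    with assms(2) R(3) have "T (jWTs (scope_code B) (enc (map trm_code ts)) (num (n + ?l))
        (num (n + ?l + sum_list (map trm_length ts))))"
      unfolding complete_WTs_def by blast
    moreover have "atom_wf_rel (bool_code b) (num (rsym_code cr R)) (enc (map trm_code ts)) (num n) (num (n + ?l))"
      unfolding atom_wf_rel_def using R by (intro bexI[of _ R]) (cases b; simp)+
    ultimately have "step T (jWF (scope_code B) (enc [num 4, bool_code b, num (rsym_code cr R), enc (map trm_code ts)])
        (num n) (num (n + ?l + sum_list (map trm_length ts))))"
      by (intro step.WFAtom)
    then show ?thesis by (simp add: Atom add.assoc)
  next
    case (FPar b j ts)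
    then show ?thesis using wf by (simp add: well_formed_fm_def)
  next
    case (And \<phi> \<psi>)
    have "well_formed_fm B \<phi>" "well_formed_fm B \<psi>" using wf And by (auto simp: well_formed_fm_def)
    moreover have "eval_rate * fm_length \<phi> \<le> k" "eval_rate * fm_length \<psi> \<le> k"
      using k And rate_ge(2) by (simp_all add: algebra_simps)
    ultimately have "T (jWF (scope_code B) (fm_code \<phi>) (num (n + Suc 0)) (num (n + Suc 0 + fm_length \<phi>)))"
      "T (jWF (scope_code B) (fm_code \<psi>) (num (n + Suc 0 + fm_length \<phi>)) (num (n + Suc 0 + fm_length \<phi> + fm_length \<psi>)))"
      using T by blast+
    then have "step T (jWF (scope_code B) (fm_code s) (num n) (num (n + Suc 0 + fm_length \<phi> + fm_length \<psi>)))"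
      unfolding And fm_code.simps by (rule step.WFBin[rotated 2]) (auto simp: bool_rel_iff)
    then show ?thesis by (simp add: And add.assoc)
  next
    case (Or \<phi> \<psi>)
    have "well_formed_fm B \<phi>" "well_formed_fm B \<psi>" using wf Or by (auto simp: well_formed_fm_def)
    moreover have "eval_rate * fm_length \<phi> \<le> k" "eval_rate * fm_length \<psi> \<le> k"
      using k Or rate_ge(2) by (simp_all add: algebra_simps)
    ultimately have "T (jWF (scope_code B) (fm_code \<phi>) (num (n + Suc 0)) (num (n + Suc 0 + fm_length \<phi>)))"
      "T (jWF (scope_code B) (fm_code \<psi>) (num (n + Suc 0 + fm_length \<phi>)) (num (n + Suc 0 + fm_length \<phi> + fm_length \<psi>)))"
      using T by blast+
    then have "step T (jWF (scope_code B) (fm_code s) (num n) (num (n + Suc 0 + fm_length \<phi> + fm_length \<psi>)))"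
      unfolding Or fm_code.simps by (rule step.WFBin[rotated 2]) (auto simp: bool_rel_iff)
    then show ?thesis by (simp add: Or add.assoc)
  next
    case (BAll x t \<psi>)
    have w: "well_formed_trm B t" "well_formed_fm ([x] # B) \<psi>" "has_ball L"
      using wf BAll by (auto simp: well_formed_fm_def well_formed_trm_def)
    have "eval_rate * trm_length t \<le> k" "eval_rate * fm_length \<psi> \<le> k"
      using k BAll rate_ge(2) by (simp_all add: algebra_simps)
    with w have 1: "T (jWT (scope_code B) (trm_code t) (num (n + 3)) (num (n + 3 + trm_length t)))"
      and 2: "T (jWF (scope_code ([x] # B)) (fm_code \<psi>) (num (n + 3 + trm_length t)) (num (n + 3 + trm_length t + fm_length \<psi>)))"
      using T T' by blast+
    have "step T (jWF (scope_code B) (fm_code s) (num n) (num (n + 3 + trm_length t + fm_length \<psi>)))"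
      unfolding BAll fm_code.simps by (rule step.WFBQ[where T = T, OF _ _ _ 1 _ 2]) (simp_all add: w)
    then show ?thesis by (simp add: BAll add.assoc)
  next
    case (BEx x t \<psi>)
    have w: "well_formed_trm B t" "well_formed_fm ([x] # B) \<psi>" "has_bex L"
      using wf BEx by (auto simp: well_formed_fm_def well_formed_trm_def)
    have "eval_rate * trm_length t \<le> k" "eval_rate * fm_length \<psi> \<le> k"
      using k BEx rate_ge(2) by (simp_all add: algebra_simps)
    with w have 1: "T (jWT (scope_code B) (trm_code t) (num (n + 3)) (num (n + 3 + trm_length t)))"
      and 2: "T (jWF (scope_code ([x] # B)) (fm_code \<psi>) (num (n + 3 + trm_length t)) (num (n + 3 + trm_length t + fm_length \<psi>)))"
      using T T' by blast+
    have "step T (jWF (scope_code B) (fm_code s) (num n) (num (n + 3 + trm_length t + fm_length \<psi>)))"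
      unfolding BEx fm_code.simps by (rule step.WFBQ[where T = T, OF _ _ _ 1 _ 2]) (simp_all add: w)
    then show ?thesis by (simp add: BEx add.assoc)
  next
    case (All x \<psi>)
    have w: "well_formed_fm ([x] # B) \<psi>" using wf All by (auto simp: well_formed_fm_def)
    have "eval_rate * fm_length \<psi> \<le> k" using k All rate_ge(2) by (simp add: algebra_simps)
    with w have 1: "T (jWF (scope_code ([x] # B)) (fm_code \<psi>) (num (n + 2)) (num (n + 2 + fm_length \<psi>)))"
      using T by blast
    have "step T (jWF (scope_code B) (fm_code s) (num n) (num (n + 2 + fm_length \<psi>)))"
      unfolding All fm_code.simps by (rule step.WFQ[where T = T, OF _ _ _ _ 1]) (auto simp: bool_rel_iff)
    then show ?thesis by (simp add: All add.assoc)
  next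
    case (Ex x \<psi>)
    have w: "well_formed_fm ([x] # B) \<psi>" using wf Ex by (auto simp: well_formed_fm_def)
    have "eval_rate * fm_length \<psi> \<le> k" using k Ex rate_ge(2) by (simp add: algebra_simps)
    with w have 1: "T (jWF (scope_code ([x] # B)) (fm_code \<psi>) (num (n + 2)) (num (n + 2 + fm_length \<psi>)))"
      using T by blast
    have "step T (jWF (scope_code B) (fm_code s) (num n) (num (n + 2 + fm_length \<psi>)))"
      unfolding Ex fm_code.simps by (rule step.WFQ[where T = T, OF _ _ _ _ 1]) (auto simp: bool_rel_iff)
    then show ?thesis by (simp add: Ex add.assoc)
  qed
qed

lemma complete_stage:
  "complete_T k (stage k) \<and> complete_Ts k (stage k) \<and> complete_F k (stage k) \<and> complete_Det k (stage k) \<and>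
   complete_Inst k (stage k) \<and> complete_Bound k (stage k) \<and> complete_Neg k (stage k) \<and>
   complete_WT k (stage k) \<and> complete_WTs k (stage k) \<and> complete_WF k (stage k) \<and> complete_WFs k (stage k)"
proof (induct k)
  case 0
  \<comment> \<open>No bound is met with 0 rounds, because lengths and rates are positive and the
    remaining bounds have a positive constant.\<close>
  have "rate F \<noteq> 0" for F using rate_ge(1)[of F] by simp
  moreover have "trm_length t \<noteq> 0" "fm_length \<phi> \<noteq> 0" for t :: "('f, 'r, 'q) trm" and \<phi> :: "('f, 'r, 'q) fm"
    using length_pos(1)[of t] length_pos(2)[of \<phi>] by simp_all
  moreover have "eval_rate \<noteq> 0" using rate_ge(2) by simp
  ultimately show ?case
    unfolding complete_T_def complete_Ts_def complete_F_def complete_Det_def complete_Inst_def complete_Bound_def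
      complete_Neg_def complete_WT_def complete_WTs_def complete_WF_def complete_WFs_def
    by simp
next
  case (Suc k)
  then show ?case
    by (simp add: complete_T_step complete_Ts_step complete_F_step complete_Det_step complete_Inst_step
        complete_Bound_step complete_Neg_step complete_WT_step complete_WTs_step complete_WF_step complete_WFs_step)
qed

end

subsection \<open>The largest representable number\<close>

context coded_language
begin

text \<open>The counter of \<open>jWT\<close> starts at 0, so \<open>l\<close> is the length of
  \<open>t\<close>, and \<open>Suc n\<close> rounds of \<open>jLe\<close> admit the lengths up to
  \<open>n\<close>. For such terms \<open>eval_rate * n\<close> rounds are enough.\<close>

definition exceeded :: "nat \<Rightarrow> 'a \<Rightarrow> bool" where
  "exceeded n x \<longleftrightarrow> (\<exists>v t l. lt_rel x v \<and> stage (eval_rate * n) (jWT (enc []) t (num 0) l) \<and>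
     stage (Suc n) (jLe l) \<and> stage (eval_rate * n) (jT (enc []) (enc []) t v))"

lemma codes_Nil: "scope_code [] = enc []" "env_code [] = enc []"
  by (simp_all add: scope_code_def env_code_def)

text \<open>From left to right by soundness, which holds at every stage. The converse is
  completeness, for which the numbers of rounds were chosen.\<close>

lemma exceeded_num: "exceeded n (num m) \<longleftrightarrow> (\<exists>k\<in>representable L num n. m < k)"
proof
  assume "exceeded n (num m)"
  then obtain v t l where *: "lt_rel (num m) v" "stage (eval_rate * n) (jWT (scope_code []) t (num 0) l)"
    "stage (Suc n) (jLe l)" "stage (eval_rate * n) (jT (frame_code None) (env_code []) t v)"
    by (auto simp: exceeded_def codes_Nil)
  from *(1) obtain k where k: "v = num k" "m < k" by (auto simp: lt_rel_def)
  from *(2) sound_stage[of "eval_rate * n"] obtain s where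
    s: "t = trm_code s" "well_formed_trm [] s" "l = num (0 + trm_length s)"
    unfolding sound_WT_def by blast
  from *(3) s(3) have "trm_length s \<le> n" unfolding stage_Le by auto
  moreover have c: "closed_term L s" using s(2) by (simp add: well_formed_trm_def)
  moreover from c have "okT None [] s" by simp
  with *(4) s(1) sound_stage[of "eval_rate * n"] have "TV None (env_val []) s = Some v"
    unfolding sound_T_def by blast
  then have "referent L s = Some (num k)" by (simp add: trm_val_def referent_def k)
  ultimately show "\<exists>k\<in>representable L num n. m < k" using k(2) by (auto simp: representable_def)
next
  assume "\<exists>k\<in>representable L num n. m < k"
  then obtain k s where s: "m < k" "closed_term L s" "trm_length s \<le> n" "referent L s = Some (num k)"
    by (auto simp: representable_def)
  have le: "eval_rate * trm_length s \<le> eval_rate * n" using s(3) by (rule mult_le_mono2)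
  have "well_formed_trm [] s" using s(2) by (simp add: well_formed_trm_def)
  with le complete_stage[of "eval_rate * n"]
  have "stage (eval_rate * n) (jWT (scope_code []) (trm_code s) (num 0) (num (0 + trm_length s)))"
    unfolding complete_WT_def by blast
  moreover have "stage (Suc n) (jLe (num (0 + trm_length s)))" unfolding stage_Le using s(3) by auto
  moreover have "okT None [] s" using s(2) by simp
  moreover have "TV None (env_val []) s = Some (num k)" using s(4) by (simp add: trm_val_def referent_def)
  moreover have "base None + rate None * trm_length s \<le> eval_rate * n" using le by simp
  ultimately have "stage (eval_rate * n) (jT (frame_code None) (env_code []) (trm_code s) (num k))"
    "stage (eval_rate * n) (jWT (scope_code []) (trm_code s) (num 0) (num (0 + trm_length s)))"
    "stage (Suc n) (jLe (num (0 + trm_length s)))"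
    using complete_stage[of "eval_rate * n"] unfolding complete_T_def by blast+
  moreover have "lt_rel (num m) (num k)" using s(1) by simp
  ultimately show "exceeded n (num m)" unfolding exceeded_def codes_Nil frame_code.simps(1) by blast
qed

text \<open>Variable 1 is the argument; variables 2, 3 and 4 are the three judgements.\<close>

lemma exceeded_uniformly_definable:
  obtains \<theta> where "\<And>n. is_formula L (\<theta> n)" "\<And>n. negatable L {} (\<theta> n)" "\<And>n. fv_fm (\<theta> n) \<subseteq> {1}"
    "\<And>n \<sigma>. fm_val L \<sigma> (\<theta> n) = Some (exceeded n (\<sigma> 1))"
    "uniform (\<lambda>n. symbols_fm (\<theta> n))" "uniform (\<lambda>n. symbols_fm (neg (\<theta> n)))"
proof -
  obtain \<Psi> p w p' w' where
    \<Psi>: "\<And>k. expresses L 1 (\<Psi> k) (\<lambda>\<sigma>. (step ^^ k) (\<lambda>_. False) (\<sigma> 0))" "\<And>k. negatable L {} (\<Psi> k)"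
      "\<And>k. symbols_fm (\<Psi> k) = concat (replicate k p) @ w"
      "\<And>k. symbols_fm (neg (\<Psi> k)) = concat (replicate k p') @ w'"
    using iterate_expresses[OF op_definable_step] by blast
  define M where "M \<sigma> \<longleftrightarrow> (\<exists>v t l. lt_rel (\<sigma> 1) v \<and> \<sigma> 2 = jWT (enc []) t (num 0) l \<and> \<sigma> 3 = jLe l \<and>
    \<sigma> 4 = jT (enc []) (enc []) t v)" for \<sigma> :: "nat \<Rightarrow> 'a"
  have "definable M" unfolding M_def[abs_def] by (intro def_intro)
  moreover have "M \<sigma> = M \<tau>" if "\<And>i. i < 5 \<Longrightarrow> \<sigma> i = \<tau> i" for \<sigma> \<tau>
    using that unfolding M_def by simp
  ultimately obtain \<mu> where \<mu>: "expresses L 5 \<mu> M" "negatable L {} \<mu>"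
    using definable_expresses[of M 5] by blast
  define move where "move i \<psi> = Ex 0 (And (Atom True REq [Var 0, Var i]) \<psi> :: ('f, 'r, 'q) fm)" for i \<psi>
  \<comment> \<open>\<open>Ex 0\<close> discharges variable 0, which may be free in
    \<open>\<mu>\<close> although \<open>M\<close> does not depend on it.\<close>
  define \<theta> where "\<theta> n = Ex 0 (Ex 2 (Ex 3 (Ex 4 (And \<mu> (And (move 2 (\<Psi> (eval_rate * n)))
    (And (move 3 (\<Psi> (Suc n))) (move 4 (\<Psi> (eval_rate * n)))))))))" for n
  have at: "fm_val L \<sigma> (move i (\<Psi> k)) = Some (stage k (\<sigma> i))" "negatable L {} (move i (\<Psi> k))"
    "is_formula L (move i (\<Psi> k))" "fv_fm (move i (\<Psi> k)) \<subseteq> {i}" if "i > 0" for \<sigma> i k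
  proof -
    have "fm_val L (\<sigma>(0 := d)) (And (Atom True REq [Var 0, Var i]) (\<Psi> k)) = Some (d = \<sigma> i \<and> stage k d)" for d
      using \<Psi>(1,2) that by (intro fm_val_And fm_val_Eq) (auto simp: expresses_def fm_val_Eq stage_def)
    from fm_val_Ex[OF _ this] \<Psi>(2) show "fm_val L \<sigma> (move i (\<Psi> k)) = Some (stage k (\<sigma> i))"
      by (simp add: move_def)
    show "negatable L {} (move i (\<Psi> k))" "is_formula L (move i (\<Psi> k))" "fv_fm (move i (\<Psi> k)) \<subseteq> {i}"
      using \<Psi>(1)[of k] \<Psi>(2) by (auto simp: move_def expresses_def)
  qed
  have body: "fm_val L \<sigma> (And \<mu> (And (move 2 (\<Psi> (eval_rate * n))) (And (move 3 (\<Psi> (Suc n))) (move 4 (\<Psi> (eval_rate * n)))))) =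
    Some (M \<sigma> \<and> stage (eval_rate * n) (\<sigma> 2) \<and> stage (Suc n) (\<sigma> 3) \<and> stage (eval_rate * n) (\<sigma> 4))" for \<sigma> n
    using \<mu> at by (intro fm_val_And) (simp_all add: expresses_def)
  show ?thesis
  proof (rule that[of \<theta>])
    fix n
    show "is_formula L (\<theta> n)" "negatable L {} (\<theta> n)"
      using \<mu> at by (simp_all add: \<theta>_def expresses_def)
    have "{..<5} = {0, 1, 2, 3, 4 :: nat}" by auto
    then have "fv_fm \<mu> \<subseteq> {0, 1, 2, 3, 4}" using \<mu>(1) by (simp add: expresses_def)
    with at(4)[of 2 "eval_rate * n"] at(4)[of 3 "Suc n"] at(4)[of 4 "eval_rate * n"]
    show "fv_fm (\<theta> n) \<subseteq> {1}" unfolding \<theta>_def fv_fm.simps by auto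
    show "fm_val L \<sigma> (\<theta> n) = Some (exceeded n (\<sigma> 1))" for \<sigma>
    proof -
      have neg: "negatable L {} (And \<mu> (And (move 2 (\<Psi> (eval_rate * n))) (And (move 3 (\<Psi> (Suc n))) (move 4 (\<Psi> (eval_rate * n))))))"
        using \<mu>(2) at(2) by simp
      have "fm_val L \<sigma> (\<theta> n) = Some (\<exists>d0 d2 d3 d4. M (\<sigma>(0 := d0, 2 := d2, 3 := d3, 4 := d4)) \<and>
        stage (eval_rate * n) d2 \<and> stage (Suc n) d3 \<and> stage (eval_rate * n) d4)"
        unfolding \<theta>_def using neg by (intro fm_val_Ex) (simp_all add: body)
      also have "\<dots> = Some (exceeded n (\<sigma> 1))"
      proof -
        have "M (\<sigma>(0 := d0, 2 := d2, 3 := d3, 4 := d4)) \<longleftrightarrow> (\<exists>v t l. lt_rel (\<sigma> 1) v \<and>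
          d2 = jWT (enc []) t (num 0) l \<and> d3 = jLe l \<and> d4 = jT (enc []) (enc []) t v)" for d0 d2 d3 d4
          by (simp add: M_def)
        then show ?thesis unfolding exceeded_def by (simp only: option.inject) blast
      qed
      finally show ?thesis .
    qed
  next
    \<comment> \<open>The numbers of rounds are linear in \<open>n\<close>: a multiple of
      \<open>n\<close> regroups the prefix into a larger power, and \<open>Suc n\<close> splits off
      one copy.\<close>
    have u: "uniform (\<lambda>n. symbols_fm (\<Psi> (eval_rate * n)))" "uniform (\<lambda>n. symbols_fm (\<Psi> (Suc n)))"
      "uniform (\<lambda>n. symbols_fm (neg (\<Psi> (eval_rate * n))))" "uniform (\<lambda>n. symbols_fm (neg (\<Psi> (Suc n))))"
      unfolding \<Psi>(3,4) replicate_Suc concat.simps append_assoc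
      by (intro uniform_power_mult uniform_append uniform_power uniform_const)+
    show "uniform (\<lambda>n. symbols_fm (\<theta> n))" "uniform (\<lambda>n. symbols_fm (neg (\<theta> n)))"
      unfolding \<theta>_def move_def neg.simps symbols_fm.simps symbols.simps list.map concat.simps if_True if_False
        append.simps simp_thms
      by (intro uniform_Cons uniform_append uniform_const uniform_Nil u)+
  qed
qed

end

lemma uniform_explicit:
  assumes "uniform (\<lambda>n. symbols (\<Phi> n))"
  shows "explicit L \<Phi>"
  unfolding explicit_def using uniform_recursive[OF assms] by blast

theorem theoremC4:
  fixes L :: "('a, 'f, 'r, 'q) pt_lang" and num :: "nat \<Rightarrow> 'a"
  assumes "pt_language L"
    and "classical L"
    and "list_compatible L num"
  shows "\<exists>\<Phi> :: nat \<Rightarrow> ('f, 'r, 'q) trm.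
           explicit L \<Phi> \<and>
           (\<lambda>n. real (trm_length (\<Phi> n))) \<in> O(\<lambda>n. real n) \<and>
           (\<forall>n. closed_term L (\<Phi> n) \<and>
              (representable L num n \<noteq> {} \<longrightarrow>
                 (\<exists>m. referent L (\<Phi> n) = Some (num m) \<and> m \<in> representable L num n \<and>
                      (\<forall>k \<in> representable L num n. k \<le> m))))"
proof -
  interpret classical_language L by standard (fact assms)+
  have N: "reproduces_number_theory L num" and "has_lists L num"
    using assms(3) by (simp_all add: list_compatible_def)
  from this(2) obtain enc where enc: "inj enc"
    "\<exists>\<phi>. expresses L 3 \<phi> (\<lambda>\<sigma>. \<exists>as i. \<sigma> 0 = enc as \<and> \<sigma> 1 = num i \<and>
                1 \<le> i \<and> i \<le> length as \<and> \<sigma> 2 = as ! (i - 1))"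
    "\<exists>\<phi>. expresses L 2 \<phi> (\<lambda>\<sigma>. \<exists>as. \<sigma> 0 = enc as \<and> \<sigma> 1 = num (length as))"
    unfolding has_lists_def by blast
  have inj: "inj num" using N unfolding reproduces_number_theory_def by (elim conjE)
  have num: "\<exists>\<phi>. expresses L 1 \<phi> (\<lambda>\<sigma>. \<sigma> 0 \<in> range num)"
    using N unfolding reproduces_number_theory_def by (elim conjE)
  have less: "\<exists>\<phi>. expresses L 2 \<phi> (\<lambda>\<sigma>. \<exists>m n. \<sigma> 0 = num m \<and> \<sigma> 1 = num n \<and> m < n)"
    using N unfolding reproduces_number_theory_def by (elim conjE)
  have "\<exists>t. scheme_trm L t \<and> fv_trm t = {} \<and>
        (\<forall>P \<sigma>. scheme_trm_val L P \<sigma> t =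
           (if \<exists>n. P (num n) then Some (num (LEAST n. P (num n))) else None))"
    using N unfolding reproduces_number_theory_def by (elim conjE)
  then obtain fst0 where fst0: "scheme_trm L fst0" "fv_trm fst0 = {}"
    "\<And>P \<sigma>. scheme_trm_val L P \<sigma> fst0 = (if \<exists>n. P (num n) then Some (num (LEAST n. P (num n))) else None)"
    by blast
  have "finite (funs L)" "finite (rels L)" "finite (qlos L)" using assms(1) by (simp_all add: pt_language_def)
  then obtain cf :: "'f \<Rightarrow> nat" and cr :: "'r \<Rightarrow> nat" and cq :: "'q \<Rightarrow> nat"
    where "inj_on cf (funs L)" "inj_on cr (rels L)" "inj_on cq (qlos L)"
    using finite_imp_inj_to_nat_seg[of "funs L"] finite_imp_inj_to_nat_seg[of "rels L"]
      finite_imp_inj_to_nat_seg[of "qlos L"] by auto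
  moreover have "definable (\<lambda>\<sigma>. \<sigma> 0 \<in> range num)"
    "definable (\<lambda>\<sigma>. \<exists>m n. \<sigma> 0 = num m \<and> \<sigma> 1 = num n \<and> m < n)"
    "definable (\<lambda>\<sigma>. \<exists>as i. \<sigma> 0 = enc as \<and> \<sigma> 1 = num i \<and> 1 \<le> i \<and> i \<le> length as \<and> \<sigma> 2 = as ! (i - 1))"
    "definable (\<lambda>\<sigma>. \<exists>as. \<sigma> 0 = enc as \<and> \<sigma> 1 = num (length as))"
    using num less enc(2,3) expresses_definable by blast+
  ultimately interpret coded_language L num enc cf cr cq
    using inj enc(1) by unfold_locales
  obtain \<theta> where \<theta>: "\<And>n. is_formula L (\<theta> n)" "\<And>n. negatable L {} (\<theta> n)" "\<And>n. fv_fm (\<theta> n) \<subseteq> {1}"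
    "\<And>n \<sigma>. fm_val L \<sigma> (\<theta> n) = Some (exceeded n (\<sigma> 1))"
    "uniform (\<lambda>n. symbols_fm (\<theta> n))" "uniform (\<lambda>n. symbols_fm (neg (\<theta> n)))"
    using exceeded_uniformly_definable by blast
  have \<theta>': "is_formula L (neg (\<theta> n))" "negatable L {} (neg (\<theta> n))" for n
    using wf_neg[OF \<theta>(1,2)] by blast+
  \<comment> \<open>Shifting by 2 frees variable 1 in the scheme for \<open>fst\<close>;
    \<open>\<theta>\<close> takes its argument at this variable.\<close>
  define \<pi> :: "nat \<Rightarrow> nat" where "\<pi> x = x + 2" for x
  have \<pi>: "inj \<pi>" by (simp add: \<pi>_def inj_def)
  define t where "t = ren_trm \<pi> fst0"
  have t: "scheme_trm L t" "fv_trm t = {}" "SVar 1 \<notin> set (symbols t)"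
    "scheme_trm_val L P \<sigma> t = (if \<exists>n. P (num n) then Some (num (LEAST n. P (num n))) else None)" for P \<sigma>
    using fst0 by (simp_all add: t_def wf_ren[OF \<pi>] fv_ren[OF \<pi>] symbols_ren SVar_ren \<pi>_def
        scheme_trm_val_def val_ren[OF \<pi>])
  \<comment> \<open>The least number that is not exceeded is sought, so positive holes receive the
    dual of \<open>\<theta>\<close> and negated holes \<open>\<theta>\<close> itself.\<close>
  define \<Phi> where "\<Phi> n = fill_trm 1 (neg (\<theta> n)) (\<theta> n) t" for n
  have u: "uniform (\<lambda>n. symbols (\<Phi> n))" unfolding \<Phi>_def by (rule uniform_fill(1)[OF \<theta>(6,5)])
  show ?thesis
  proof (intro exI[of _ \<Phi>] conjI allI impI)
    show "explicit L \<Phi>" by (rule uniform_explicit[OF u])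
    show "(\<lambda>n. real (trm_length (\<Phi> n))) \<in> O(\<lambda>n. real n)"
      unfolding trm_length_def by (rule uniform_bigo[OF u])
    fix n
    show "is_term L (\<Phi> n)"
      unfolding \<Phi>_def by (rule wf_fill(1)[OF \<theta>'(2) \<theta>(2) \<theta>'(1) \<theta>(1) t(1)])
    have "fv_trm (\<Phi> n) \<subseteq> fv_trm t" unfolding \<Phi>_def using \<theta>(3) by (intro fv_fill(1)) simp_all
    then show "fv_trm (\<Phi> n) = {}" using t(2) by simp
    let ?S = "representable L num n"
    assume ne: "?S \<noteq> {}"
    have fin: "finite ?S" by (rule finite_representable[OF assms(1) inj])
    have "referent L (\<Phi> n) = scheme_trm_val L (\<lambda>x. \<not> exceeded n x) (\<lambda>_. undefined) t"
      unfolding referent_def \<Phi>_def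
      by (rule val_fill(1)[OF \<theta>'(2) \<theta>(2) _ _ t(1,3)]) (simp_all add: \<theta>(4) fm_val_neg[OF \<theta>(1,2) \<theta>(4)])
    also have "\<dots> = Some (num (LEAST m. \<not> (\<exists>k\<in>?S. m < k)))"
    proof -
      \<comment> \<open>The maximum witnesses that \<open>fst\<close> has a referent.\<close>
      have "\<not> (\<exists>k\<in>?S. Max ?S < k)" using fin by (simp add: leD)
      then show ?thesis unfolding t(4) exceeded_num by auto
    qed
    \<comment> \<open>Every smaller number is exceeded by the maximum, which is representable itself
      because \<open>?S\<close> is finite and nonempty.\<close>
    also have "(LEAST m. \<not> (\<exists>k\<in>?S. m < k)) = Max ?S"
      using fin ne Max_in[OF fin ne] by (intro Least_equality) (auto simp: not_less)
    finally show "\<exists>m. referent L (\<Phi> n) = Some (num m) \<and> m \<in> ?S \<and> (\<forall>k\<in>?S. k \<le> m)"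
      using fin ne by (intro exI[of _ "Max ?S"]) simp
  qed
qed

end
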